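(* Let $2\le k\le 30$ and $\varepsilon\in[0,1]$. Any graphon $g$ with $t_1(g)=\varepsilon$ that maximizes $t_k$ among all graphons with edge density $\varepsilon$ is equivalent either to the g-clique with $c=\sqrt{\varepsilon}$ or to the g-anticlique with $c=1-\sqrt{1-\varepsilon}$.
   Context: A graphon is a symmetric measurable function $g:[0,1]^2\to[0,1]$, with degree function $d_g(x)=\int_0^1 g(x,y)\,dy$ and $k$-star density $t_k(g)=\int_0^1 d_g(x)^k\,dx$ ($t_1$ is the edge density). The g-clique with parameter $c\in[0,1]$ is the graphon equal to $1$ when $x<c$ and $y<c$, and $0$ otherwise. The g-anticlique with parameter $c\in[0,1]$ is the graphon equal to $0$ when $x>c$ and $y>c$, and $1$ otherwise. Two graphons $g,h$ are equivalent if their cut distance is zero, equivalently $t_F(g)=t_F(h)$ for every finite simple graph $F$, where $t_F$ denotes homomorphism density; in particular $g$ is equivalent to $h(\psi(x),\psi(y))$ for any measure-preserving $\psi:[0,1]\to[0,1]$. *)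

theory Defs
  imports "HOL-Analysis.Analysis"
begin

definition unit_interval_measure :: "real measure" where
  "unit_interval_measure = restrict_space lborel {0..1}"

definition graphon :: "(real \<Rightarrow> real \<Rightarrow> real) \<Rightarrow> bool" where
  "graphon g \<longleftrightarrow>
     (\<lambda>(x, y). g x y) \<in> borel_measurable
        (restrict_space (lborel \<Otimes>\<^sub>M lborel) ({0..1} \<times> {0..1})) \<and>
     (\<forall>x\<in>{0..1}. \<forall>y\<in>{0..1}. g x y = g y x \<and> 0 \<le> g x y \<and> g x y \<le> 1)"

definition degree_fun :: "(real \<Rightarrow> real \<Rightarrow> real) \<Rightarrow> real \<Rightarrow> real" where
  "degree_fun g x = (\<integral>y. g x y \<partial>unit_interval_measure)"

definition star_density :: "nat \<Rightarrow> (real \<Rightarrow> real \<Rightarrow> real) \<Rightarrow> real" where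
  "star_density k g = (\<integral>x. (degree_fun g x) ^ k \<partial>unit_interval_measure)"

definition edge_density :: "(real \<Rightarrow> real \<Rightarrow> real) \<Rightarrow> real" where
  "edge_density g = star_density 1 g"

definition simple_graph :: "nat \<Rightarrow> (nat \<times> nat) set \<Rightarrow> bool" where
  "simple_graph n E \<longleftrightarrow> E \<subseteq> {(i, j). i < j \<and> j < n}"

definition hom_density :: "nat \<Rightarrow> (nat \<times> nat) set \<Rightarrow> (real \<Rightarrow> real \<Rightarrow> real) \<Rightarrow> real" where
  "hom_density n E g =
     (\<integral>x. (\<Prod>(i, j)\<in>E. g (x i) (x j)) \<partial>(\<Pi>\<^sub>M i\<in>{..<n}. unit_interval_measure))"

definition graphon_equiv :: "(real \<Rightarrow> real \<Rightarrow> real) \<Rightarrow> (real \<Rightarrow> real \<Rightarrow> real) \<Rightarrow> bool" where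
  "graphon_equiv g h \<longleftrightarrow>
     (\<forall>n E. simple_graph n E \<longrightarrow> hom_density n E g = hom_density n E h)"

definition g_clique :: "real \<Rightarrow> real \<Rightarrow> real \<Rightarrow> real" where
  "g_clique c x y = (if x < c \<and> y < c then 1 else 0)"

definition g_anticlique :: "real \<Rightarrow> real \<Rightarrow> real \<Rightarrow> real" where
  "g_anticlique c x y = (if x > c \<and> y > c then 0 else 1)"

end

theory Submission
  imports Defs "HOL-Probability.Probability"
begin

text \<open>
  A maximizer \<open>g\<close> with degree function \<open>d\<close> also maximizes the linearization of \<open>t_k\<close> at \<open>g\<close>, so by the
  bathtub principle \<open>g = 1\<close> where \<open>d(x)^(k-1) + d(y)^(k-1)\<close> exceeds a level and \<open>g = 0\<close> below it; strict
  convexity of \<open>t_k\<close> forces \<open>g\<close> to be constant on the level set itself. Hence the vertex set splits into a clique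
  \<open>A\<close> and an independent set \<open>B\<close>. Reweighting the vertices inside \<open>A\<close> (or \<open>B\<close>) by \<open>1 + s h\<close> with \<open>h\<close>
  orthogonal to \<open>1\<close> and \<open>d\<close> preserves the edge density while \<open>t_k\<close> is convex in \<open>s\<close>; maximality then
  makes every function \<open>min(d, d(r))\<close> affine in \<open>d\<close> on \<open>A\<close> and on \<open>B\<close>, so \<open>d\<close> takes at most two values on
  each. What remains are weighted threshold graphs on four vertices. Along suitable curves of constant edge
  density, every such graph other than a clique or an anticlique violates the first or the
  second order condition for a maximum.
\<close>

section \<open>One-parameter families of constant edge density\<close>

text \<open>The extremal problem is posed over pairs of a probability distribution on the line and a
  kernel, so that changed vertex weights and finitely many weighted vertices are competitors at
  once; a quantile function turns them into graphons only at the end. The functions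
  \<open>min(d, d(r))\<close> arise as codegrees: in a threshold graph neighbourhoods are nested, so
  two vertices share exactly the neighbours of the one with smaller degree. On a homogeneous class,
  the residual of such a function after L2 projection to the span of 1 and \<open>d\<close> is an
  admissible weight change. Maximality says that this change moves no degree, which amounts to the
  residual being orthogonal to the function itself, so it is zero. For four-vertex graphs no
  critical point has to be located: the derivative along each curve is a positive factor times a
  function that is increasing wherever it vanishes, so a critical point is never a maximum. The
  choice of the positive factor is what makes these estimates uniform in the exponent.\<close>

text \<open>At a maximum \<open>H x0 = 0\<close>, hence \<open>H\<close> is positive just to the
  right of \<open>x0\<close>, and the mean value theorem makes \<open>f\<close> grow there. With
  \<open>p\<close> split off, only \<open>H\<close> has to be differentiated, and only at
  \<open>x0\<close>.\<close>

lemma not_local_max: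
  fixes f p H :: "real \<Rightarrow> real"
  assumes "0 < r"
    and der: "\<And>x. \<bar>x - x0\<bar> < r \<Longrightarrow> (f has_real_derivative p x * H x) (at x)"
    and pos: "\<And>x. \<bar>x - x0\<bar> < r \<Longrightarrow> 0 < p x"
    and derH: "(H has_real_derivative l) (at x0)"
    and l: "H x0 = 0 \<Longrightarrow> 0 < l"
    and max: "\<And>x. \<bar>x - x0\<bar> < r \<Longrightarrow> f x \<le> f x0"
  shows False
proof -
  have "p x0 * H x0 = 0"
    using DERIV_local_max[of f "p x0 * H x0" x0 r] der[of x0] max \<open>0 < r\<close>
    by (auto simp: abs_minus_commute)
  moreover have "0 < p x0"
    using pos \<open>0 < r\<close> by auto
  ultimately have "H x0 = 0" by simp
  with l have "0 < l" by simp
  then obtain d where d: "0 < d" "\<And>h. 0 < h \<Longrightarrow> h < d \<Longrightarrow> H x0 < H (x0 + h)"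
    using DERIV_pos_inc_right[OF derH] by blast
  define e where "e = min d r / 2"
  have e: "0 < e" "e < d" "e < r" using d \<open>0 < r\<close> by (auto simp: e_def)
  have "\<exists>z>x0. z < x0 + e \<and> f (x0 + e) - f x0 = (x0 + e - x0) * (p z * H z)"
    using e by (intro MVT2 der) auto
  then obtain z where z: "x0 < z" "z < x0 + e" "f (x0 + e) - f x0 = e * (p z * H z)" by auto
  have "0 < H z" using d(2)[of "z - x0"] z e \<open>H x0 = 0\<close> by auto
  moreover have "0 < p z" using pos z e by auto
  ultimately have "f x0 < f (x0 + e)" using z e
    by (metis diff_gt_0_iff_gt mult_pos_pos)
  then show False using max[of "x0 + e"] e by auto
qed

section \<open>Anticlique family: second order inequality and flow\<close>

text \<open>The difference of the two sides is
  \<open>(1 - u^2) * (1 - (1 - u) ^ q * (1 + q * u))\<close> with \<open>q = n - 1\<close>, and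
  Bernoulli's inequality bounds the inner product by \<open>(1 - u^2) ^ q\<close>. With
  \<open>u = v / y\<close> this is the dehomogenized upper bound on \<open>E\<close> in the next
  lemma.\<close>

lemma power_diff_ratio_bound:
  fixes u :: real
  assumes "0 \<le> u" "u \<le> 1" "1 \<le> n"
  shows "n * (u + (1 - u) ^ n) * u \<le> (1 + (real n - 1) * u\<^sup>2) * (1 - (1 - u) ^ n)"
proof -
  obtain q where n: "n = Suc q" using assms(3) by (cases n) auto
  have "(1 - u) ^ q * (1 + q * u) \<le> (1 - u) ^ q * (1 + u) ^ q"
    using Bernoulli_inequality[of u q] assms by (intro mult_left_mono) auto
  also have "\<dots> = (1 - u\<^sup>2) ^ q"
    by (simp add: power_mult_distrib[symmetric] algebra_simps power2_eq_square)
  also have "\<dots> \<le> 1" using assms by (intro power_le_one) (auto simp: power_le_one)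
  finally have b: "(1 - u) ^ q * (1 + q * u) \<le> 1" .
  have "0 \<le> (1 + u) * (1 - u) * (1 - (1 - u) ^ q * (1 + q * u))"
    using assms b by (intro mult_nonneg_nonneg) auto
  also have "\<dots> = (1 + (real n - 1) * u\<^sup>2) * (1 - (1 - u) ^ n) - n * (u + (1 - u) ^ n) * u"
    unfolding n by (simp add: power2_eq_square) algebra
  finally show ?thesis by simp
qed

text \<open>Up to the positive factor \<open>x * y^2 / v^2\<close>, \<open>?R\<close> is the
  derivative of \<open>x * y^3 * (j * v - y) * D / v\<close> along the flow \<open>x' = -x\<close>,
  \<open>y' = v\<close>, \<open>v' = y\<close>. Its four summands come from differentiating
  \<open>x * y^3\<close>, \<open>j * v - y\<close>, \<open>D\<close> and
  \<open>1 / v\<close>.\<close>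

lemma star_flow_second_order_pos:
  fixes x v y :: real
  assumes x: "0 < x" and v: "0 < v" and y: "y = x + v" and n: "1 \<le> n"
  defines "j \<equiv> real n + 1" and "D \<equiv> y ^ n - x ^ n"
  shows "0 < (3 * v - y) * v * (j * v - y) * D + y * v * (j * y - v) * D
     + y * v * (j * v - y) * (n * (v * y ^ (n - 1) + x ^ n)) - y\<^sup>2 * (j * v - y) * D"
    (is "0 < ?R")
proof -
  have y0: "0 < y" "x < y" "v < y" using assms by auto
  have D0: "0 < D" unfolding D_def using power_strict_mono[of x y n] y0 x n by auto
  have j2: "2 \<le> j" using n by (simp add: j_def)
  have yn: "y * y ^ (n - 1) = y ^ n" using n by (cases n) auto
  define E where "E = n * (v * y ^ n + x ^ n * y)"
  have R: "?R = (3 * v - y) * v * (j * v - y) * D + y * v * (j * y - v) * D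
     + v * (j * v - y) * E - y\<^sup>2 * (j * v - y) * D"
    unfolding E_def yn[symmetric] by algebra
  show ?thesis
  \<comment> \<open>The sign of \<open>j * v - y\<close> decides whether \<open>E\<close> has to be
    bounded from below or from above. Either bound is a multiple of \<open>D\<close>, which then
    factors out of the whole expression.\<close>
  proof (cases "y \<le> j * v")
    case True
    have "n * (v * D) \<le> E" unfolding E_def D_def using x y0 v
      by (intro mult_left_mono) (auto simp: algebra_simps intro: add_nonneg_nonneg)
    then have "v * (j * v - y) * (n * (v * D)) \<le> v * (j * v - y) * E"
      using v True by (intro mult_left_mono) auto
    then have "(3 * v - y) * v * (j * v - y) * D + y * v * (j * y - v) * D
       + v * (j * v - y) * (n * (v * D)) - y\<^sup>2 * (j * v - y) * D \<le> ?R" unfolding R by simp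
    moreover have "(3 * v - y) * v * (j * v - y) * D + y * v * (j * y - v) * D
       + v * (j * v - y) * (n * (v * D)) - y\<^sup>2 * (j * v - y) * D
      = D * (y * (y\<^sup>2 - v\<^sup>2) + v * (j * v - y) * ((j + 2) * v - y))"
      unfolding j_def by algebra
    moreover have "0 < D * (y * (y\<^sup>2 - v\<^sup>2) + v * (j * v - y) * ((j + 2) * v - y))"
    proof (intro mult_pos_pos add_pos_nonneg mult_nonneg_nonneg)
      show "0 < y\<^sup>2 - v\<^sup>2" using y0 v by (simp add: power_strict_mono)
      show "0 \<le> (j + 2) * v - y" using True v by (simp add: algebra_simps)
    qed (use D0 y0 v True in auto)
    ultimately show ?thesis by linarith
  next
    case False
    define u where "u = v / y"
    have u: "0 < u" "u < 1" using v y0 by (auto simp: u_def)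
    have vy: "v = u * y" "x = (1 - u) * y" using y0 y by (auto simp: u_def field_simps)
    have "n * (u + (1 - u) ^ n) * u * (y ^ n * y\<^sup>2) \<le> (1 + (real n - 1) * u\<^sup>2) * (1 - (1 - u) ^ n) * (y ^ n * y\<^sup>2)"
      using power_diff_ratio_bound[of u n] u n y0 by (intro mult_right_mono) auto
    then have "v * E \<le> (y\<^sup>2 + (real n - 1) * v\<^sup>2) * D"
      unfolding E_def D_def vy power_mult_distrib by (simp add: algebra_simps power2_eq_square)
    then have "(j * v - y) * ((y\<^sup>2 + (real n - 1) * v\<^sup>2) * D) \<le> (j * v - y) * (v * E)"
      using False by (intro mult_left_mono_neg) auto
    then have "(3 * v - y) * v * (j * v - y) * D + y * v * (j * y - v) * D
       + (j * v - y) * ((y\<^sup>2 + (real n - 1) * v\<^sup>2) * D) - y\<^sup>2 * (j * v - y) * D \<le> ?R"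
      unfolding R by (simp add: algebra_simps)
    moreover have "(3 * v - y) * v * (j * v - y) * D + y * v * (j * y - v) * D
       + (j * v - y) * ((y\<^sup>2 + (real n - 1) * v\<^sup>2) * D) - y\<^sup>2 * (j * v - y) * D
      = v * D * ((j * v - y) * ((j + 1) * v - y) + y * (j * y - v))"
      unfolding j_def by algebra
    moreover have "0 < (j * v - y) * ((j + 1) * v - y) + y * (j * y - v)"
    proof -
      have jy: "v < j * y - v"
      proof -
        have "2 * y \<le> j * y" using j2 y0 by (intro mult_right_mono) auto
        then show ?thesis using y0 v by linarith
      qed
      \<comment> \<open>Since \<open>y > j * v\<close>, the second factor on the left is below
        \<open>v\<close>, while \<open>j * y - v\<close> exceeds \<open>v\<close>.\<close>
      have "(y - j * v) * ((j + 1) * v - y) < y * (j * y - v)"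
      proof (cases "0 \<le> (j + 1) * v - y")
        case True
        have "(y - j * v) * ((j + 1) * v - y) \<le> y * v"
          using False True v y0 j2 by (intro mult_mono) (auto simp: algebra_simps)
        also have "\<dots> < y * (j * y - v)" using jy y0 by simp
        finally show ?thesis .
      next
        case F2: False
        have "(y - j * v) * ((j + 1) * v - y) \<le> 0" using False F2 by (intro mult_nonneg_nonpos) auto
        also have "0 < y * (j * y - v)" using jy y0 v by simp
        finally show ?thesis .
      qed
      then show ?thesis by (simp add: algebra_simps)
    qed
    ultimately show ?thesis using D0 v by (smt (verit) mult_pos_pos)
  qed
qed

text \<open>
  The flow \<open>x' = -x\<close>, \<open>y' = v\<close>, \<open>v' = y\<close> preserves \<open>y\<^sup>2 - v\<^sup>2\<close>, hence the edge density. Expanding in powers of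
  \<open>b\<close>, the derivative of the \<open>j\<close>-th coefficient is \<open>x (j v - y) (y^(j-1) - x^(j-1))\<close>; multiplied by
  \<open>y^3 / v\<close> it becomes increasing for every \<open>j\<close> simultaneously.
\<close>

lemma anticlique_family_no_interior_max:
  fixes b x v y :: real
  assumes x: "0 < x" and v: "0 < v" and y: "y = x + v" and b: "0 \<le> b" "b + y < 1" and k: "2 \<le> k"
    and max: "\<And>x' v'. 0 < x' \<Longrightarrow> 0 < v' \<Longrightarrow> b + x' + v' < 1 \<Longrightarrow>
      x' * (x' + v') + v' * x' = x * y + v * x \<Longrightarrow>
      x' * (b + x' + v') ^ k + v' * (b + x') ^ k + (1 - b - x' - v') * b ^ k
      \<le> x * (b + y) ^ k + v * (b + x) ^ k + (1 - b - y) * b ^ k"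
  shows False
proof -
  \<comment> \<open>The flow in closed form: \<open>Y - V = X\<close> decays and
    \<open>Y + V\<close> grows exponentially.\<close>
  define X where "X = (\<lambda>t. x * exp (- t))"
  define Y where "Y = (\<lambda>t. ((y + v) * exp t + x * exp (- t)) / 2)"
  define V where "V = (\<lambda>t. ((y + v) * exp t - x * exp (- t)) / 2)"
  have X0: "X 0 = x" "V 0 = v" "Y 0 = y" using y by (auto simp: X_def V_def Y_def)
  have XV: "Y t = X t + V t" for t by (simp add: X_def Y_def V_def field_simps)
  have inv: "X t * Y t + V t * X t = x * y + v * x" for t
  proof -
    have "X t * Y t + V t * X t = x * (y + v) * (exp t * exp (- t))"
      by (simp add: X_def Y_def V_def field_simps)
    then show ?thesis by (simp add: exp_minus field_simps)
  qed
  have dX: "(X has_real_derivative - X t) (at t)" for t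
    unfolding X_def by (auto intro!: derivative_eq_intros)
  have dY: "(Y has_real_derivative V t) (at t)" for t
    unfolding Y_def V_def by (auto intro!: derivative_eq_intros)
  have dV: "(V has_real_derivative Y t) (at t)" for t
    unfolding Y_def V_def by (auto intro!: derivative_eq_intros)
  have cV: "isCont V 0" "isCont Y 0" using dV dY DERIV_isCont by blast+
  have "\<forall>\<^sub>F t in at 0. 0 < V t" "\<forall>\<^sub>F t in at 0. Y t < 1 - b"
    using cV v b X0 unfolding isCont_def by (auto intro: order_tendstoD)
  then have "\<forall>\<^sub>F t in at 0. 0 < V t \<and> Y t < 1 - b" by eventually_elim auto
  then obtain r where r: "0 < r" and r': "\<And>t. t \<noteq> 0 \<Longrightarrow> \<bar>t\<bar> < r \<Longrightarrow> 0 < V t \<and> Y t < 1 - b"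
    unfolding eventually_at by (auto simp: dist_real_def)
  have rr: "0 < V t" "Y t < 1 - b" if "\<bar>t\<bar> < r" for t
    using r'[of t] that X0 v b by (cases "t = 0"; force)+
  have Xp: "0 < X t" for t using x by (simp add: X_def)
  \<comment> \<open>The sum starts at \<open>j = 1\<close>: the coefficient for \<open>j = 0\<close>
    is the total mass \<open>1 - b\<close> of the three classes, which does not move.\<close>
  define w where "w = (\<lambda>j. real (k choose j) * b ^ (k - j))"
  define f where "f = (\<lambda>t. \<Sum>j=1..k. w j * (X t * Y t ^ j + V t * X t ^ j))"
  have T: "X t * (b + Y t) ^ k + V t * (b + X t) ^ k + (1 - b - Y t) * b ^ k = f t + (1 - b) * b ^ k" for t
  proof -
    have e: "(b + z) ^ k = (\<Sum>j=1..k. w j * z ^ j) + b ^ k" for z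
      using binomial_ring[of z b k]
      by (simp add: w_def atMost_atLeast0 sum.atLeast_Suc_atMost[of 0] algebra_simps)
    have "f t = X t * (\<Sum>j=1..k. w j * Y t ^ j) + V t * (\<Sum>j=1..k. w j * X t ^ j)"
      unfolding f_def by (simp add: sum_distrib_left sum.distrib algebra_simps)
    then show ?thesis unfolding e using XV[of t] by (simp add: algebra_simps)
  qed
  define h where "h = (\<lambda>j t. X t * Y t ^ 3 * (j * V t - Y t) * (Y t ^ (j - 1) - X t ^ (j - 1)) / V t)"
  define H where "H = (\<lambda>t. \<Sum>j=1..k. w j * h j t)"
  have df: "(f has_real_derivative V t / Y t ^ 3 * H t) (at t)" if "\<bar>t - 0\<bar> < r" for t
  proof -
    have V0: "V t \<noteq> 0" "Y t \<noteq> 0" using rr(1)[of t] that Xp[of t] XV[of t] by auto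
    have "((\<lambda>t. X t * Y t ^ j + V t * X t ^ j) has_real_derivative V t / Y t ^ 3 * h j t) (at t)"
      if "j \<ge> 1" for j
    proof -
      obtain n where j: "j = Suc n" using \<open>j \<ge> 1\<close> by (cases j) auto
      have "((\<lambda>t. Y t ^ j) has_real_derivative j * (V t * Y t ^ n)) (at t)"
        "((\<lambda>t. X t ^ j) has_real_derivative j * (- X t * X t ^ n)) (at t)"
        using DERIV_power[OF dY[of t], of j] DERIV_power[OF dX[of t], of j] by (simp_all add: j)
      from DERIV_add[OF DERIV_mult'[OF dX[of t] this(1)] DERIV_mult'[OF dV[of t] this(2)]]
      have "((\<lambda>t. X t * Y t ^ j + V t * X t ^ j) has_real_derivative
          (X t * (j * (V t * Y t ^ n)) + - X t * Y t ^ j) + (V t * (j * (- X t * X t ^ n)) + Y t * X t ^ j)) (at t)" .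
      moreover have "(X t * (j * (V t * Y t ^ n)) + - X t * Y t ^ j) + (V t * (j * (- X t * X t ^ n)) + Y t * X t ^ j)
          = V t / Y t ^ 3 * h j t"
        unfolding h_def j using V0 by (simp add: field_simps)
      ultimately show ?thesis by simp
    qed
    then have "(f has_real_derivative (\<Sum>j=1..k. w j * (V t / Y t ^ 3 * h j t))) (at t)"
      unfolding f_def by (intro DERIV_sum DERIV_cmult) auto
    then show ?thesis unfolding H_def by (simp add: sum_distrib_left algebra_simps)
  qed
  define R where "R = (\<lambda>j. let n = j - 1; D = y ^ n - x ^ n in x * y\<^sup>2 / v\<^sup>2 *
     ((3 * v - y) * v * (j * v - y) * D + y * v * (j * y - v) * D
     + y * v * (j * v - y) * (n * (v * y ^ (n - 1) + x ^ n)) - y\<^sup>2 * (j * v - y) * D))"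
  have dh: "(h j has_real_derivative R j) (at 0)" for j
  proof -
    have "(h j has_real_derivative R j) (at 0)" if "j = Suc n" for n
    proof -
      have pw: "n * y ^ (n - Suc 0) * y = n * y ^ n" "n * x ^ (n - Suc 0) * x = n * x ^ n"
        by (cases n; simp)+
      define y' x' where "y' = n * y ^ (n - Suc 0)" and "x' = n * x ^ (n - Suc 0)"
      have d1: "((\<lambda>t. Y t ^ n - X t ^ n) has_real_derivative (n * v * y ^ (n - Suc 0) + n * x ^ n)) (at 0)"
        using X0 pw by (auto intro!: derivative_eq_intros dX[of 0] dY[of 0] simp: algebra_simps)
      have v0: "V 0 \<noteq> 0" using X0 v by simp
      have "((\<lambda>t. X t * Y t ^ 3 * (j * V t - Y t)) has_real_derivative
          (3 * x * y\<^sup>2 * v - x * y ^ 3) * (j * v - y) + x * y ^ 3 * (j * y - v)) (at 0)"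
        by (rule derivative_eq_intros refl dX[of 0] dY[of 0] dV[of 0] | simp)+
           (simp add: X0 algebra_simps power2_eq_square power3_eq_cube)
      from DERIV_divide[OF DERIV_mult'[OF this d1] dV[of 0] v0]
      show ?thesis unfolding h_def R_def that Let_def diff_Suc_1
        by (rule DERIV_cong)
           (use v in \<open>simp add: X0 field_simps power2_eq_square power3_eq_cube\<close>)
    qed
    moreover have "(h 0 has_real_derivative R 0) (at 0)" by (simp add: h_def R_def)
    ultimately show ?thesis by (cases j) auto
  qed
  have dH: "(H has_real_derivative (\<Sum>j=1..k. w j * R j)) (at 0)"
    unfolding H_def by (intro DERIV_sum DERIV_cmult dh)
  have y0: "0 < y" using x v y by simp
  have R0: "0 < R j" if "2 \<le> j" for j
  proof -
    have j: "real (j - 1) + 1 = j" using that by simp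
    show ?thesis unfolding R_def Let_def
      using star_flow_second_order_pos[OF x v y, of "j - 1"] that x v y0
      by (intro mult_pos_pos divide_pos_pos) (simp_all add: j zero_less_power)
  qed
  have R1: "R 1 = 0" by (simp add: R_def)
  \<comment> \<open>Strictness comes from \<open>j = k\<close>, whose weight is 1; all other weights
    vanish when \<open>b = 0\<close>.\<close>
  have "0 < (\<Sum>j=1..k. w j * R j)"
  proof (rule sum_pos2[of _ k])
    show "0 < w k * R k" using R0 k by (simp add: w_def)
    fix j assume "j \<in> {1..k}"
    then consider "j = 1" | "2 \<le> j" by fastforce
    then show "0 \<le> w j * R j" using R1 R0[of j] b by cases (auto simp: w_def less_imp_le)
  qed (use k in auto)
  moreover have "f t \<le> f 0" if "\<bar>t - 0\<bar> < r" for t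
    using max[of "X t" "V t"] Xp[of t] rr[of t] XV[of t] inv[of t] that T[of t] T[of 0] X0
    by (simp add: add.assoc diff_diff_eq)
  moreover have "0 < V t / Y t ^ 3" if "\<bar>t - 0\<bar> < r" for t
    using rr[of t] Xp[of t] XV[of t] that by simp
  ultimately show False using not_local_max[OF r df _ dH] by blast
qed

section \<open>Clique family: polynomial inequalities and the curve\<close>

lemma geometric_weight_identity:
  fixes b :: real
  shows "(1 - b) * (\<Sum>i\<le>m. real i * b ^ (i - 1)) = (\<Sum>i\<le>m. b ^ i) - (real m + 1) * b ^ m"
proof (induction m)
  case (Suc m)
  show ?case unfolding sum.atMost_Suc distrib_left Suc.IH by (simp add: algebra_simps)
qed simp

text \<open>Two summations by parts. The coefficients \<open>(j + 1) * (j + 2) / 2 * (M - j)\<close>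
  are the twofold partial sums of \<open>M - 3 * i\<close>; the slope 3 puts their root at
  \<open>j = M\<close>, so they are nonnegative up to there.\<close>

lemma geometric_tilted_sum:
  fixes b M :: real
  shows "(\<Sum>i\<le>n. (M - 3 * real i) * b ^ i) =
    (1 - b)\<^sup>2 * (\<Sum>j\<le>n. (real j + 1) * (real j + 2) / 2 * (M - j) * b ^ j)
    + (1 - b) * ((real n + 1) * (real n + 2) / 2 * (M - n)) * b ^ Suc n
    + (real n + 1) * (M - 3 * real n / 2) * b ^ Suc n"
  by (induction n) (simp_all add: field_simps power2_eq_square)

text \<open>For the polynomial \<open>Q b = (\<Sum>i\<le>m. b ^ i) - (m + 1) * b ^ m\<close> this is
  the logarithmic derivative bound \<open>3 * b * Q' b \<le> (m + 2) * Q b\<close>. It follows from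
  the preceding identity with \<open>M = m + 2\<close>, where each term is nonnegative.\<close>

lemma tilted_sum_nonneg:
  fixes b :: real
  assumes "0 \<le> b" "b \<le> 1" "1 \<le> m"
  shows "3 * ((\<Sum>i\<le>m. real i * b ^ i) - (real m + 1) * m * b ^ m)
    \<le> (real m + 2) * ((\<Sum>i\<le>m. b ^ i) - (real m + 1) * b ^ m)"
proof -
  obtain n where m: "m = Suc n" using assms(3) by (cases m) auto
  have "0 \<le> (1 - b)\<^sup>2 * (\<Sum>j\<le>n. (real j + 1) * (real j + 2) / 2 * (real m + 2 - j) * b ^ j)
    + (1 - b) * ((real n + 1) * (real n + 2) / 2 * (real m + 2 - n)) * b ^ Suc n
    + 3 / 2 * real m * (m + 1) * b ^ m"
    using assms by (intro add_nonneg_nonneg mult_nonneg_nonneg sum_nonneg) (auto simp: m)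
  also have "\<dots> = (\<Sum>i\<le>n. (real m + 2 - 3 * real i) * b ^ i) + real m * (2 * m - 2) * b ^ m"
    unfolding geometric_tilted_sum by (simp add: m field_simps)
  also have "\<dots> = (\<Sum>i\<le>m. (real m + 2 - 3 * real i) * b ^ i) + (real m + 1) * (2 * real m - 2) * b ^ m"
    by (simp add: m algebra_simps)
  also have "(\<Sum>i\<le>m. (real m + 2 - 3 * real i) * b ^ i) =
     (real m + 2) * (\<Sum>i\<le>m. b ^ i) - 3 * (\<Sum>i\<le>m. real i * b ^ i)"
    by (simp add: sum_distrib_left sum_subtractf left_diff_distrib mult.assoc)
  finally show ?thesis by (simp add: algebra_simps)
qed

lemma power_times_one_minus_le_one:
  fixes d :: real
  assumes "0 \<le> d"
  shows "(1 + d) ^ n * (1 - real n * d) \<le> 1"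
proof (cases "d \<le> 1")
  case True
  have "(1 + d) ^ n * (1 - real n * d) \<le> (1 + d) ^ n * (1 - d) ^ n"
    using Bernoulli_inequality[of "- d" n] True assms by (intro mult_left_mono) auto
  also have "\<dots> = (1 - d\<^sup>2) ^ n"
    by (simp add: power_mult_distrib[symmetric] algebra_simps power2_eq_square)
  also have "\<dots> \<le> 1" using assms True by (intro power_le_one) (auto simp: power_le_one)
  finally show ?thesis .
next
  case False
  show ?thesis
  proof (cases "n = 0")
    case F: False
    then have "1 * 1 \<le> real n * d" using False by (intro mult_mono) auto
    then have "(1 + d) ^ n * (1 - real n * d) \<le> 0" using assms by (intro mult_nonneg_nonpos) auto
    then show ?thesis by simp
  qed simp
qed

text \<open>Divided by \<open>d\<close>, the left side is twice the sum of
  \<open>(1 + d) ^ i\<close> over \<open>i < n\<close>, and the right side bounds each power by the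
  chord of this convex sequence between 0 and \<open>n\<close>. In the induction, the slack grows by
  \<open>d\<close> times the slack of the preceding lemma.\<close>

lemma power_minus_one_convexity_bound:
  fixes d :: real
  assumes "0 \<le> d" "1 \<le> n"
  shows "2 * ((1 + d) ^ n - 1) \<le> (real n - 1) * d * (1 + d) ^ n + d * (real n + 1)"
  using assms(2)
proof (induction n rule: dec_induct)
  case (step n)
  have "0 \<le> d * (1 - (1 + d) ^ n * (1 - real n * d))"
    using power_times_one_minus_le_one[OF assms(1), of n] assms(1) by (intro mult_nonneg_nonneg) auto
  with step show ?case by (simp add: algebra_simps)
qed (simp add: algebra_simps)

text \<open>The counterpart, at points above 1, of the bound
  \<open>3 * b * Q' b \<le> (m + 2) * Q b\<close>. Both sides agree to second order at
  \<open>d = 0\<close>, which fixes the constant \<open>(m + 2) / 3\<close>; it is the same constant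
  that occurs in that bound.\<close>

lemma geometric_excess_bound:
  fixes d :: real
  assumes d: "0 \<le> d" and a: "a = 1 + d"
  shows "((\<Sum>i\<le>m. a ^ i) - (real m + 1)) * (1 + d * (real m + 2) / 3) \<le> d * (\<Sum>i\<le>m. real i * a ^ i)"
proof -
  have s: "d * (\<Sum>i\<le>m. a ^ i) = a ^ Suc m - 1" for m
    by (induction m) (auto simp: a algebra_simps)
  have w: "d * (\<Sum>i\<le>m. real i * a ^ i) = real m * a ^ Suc m + 1 - (\<Sum>i\<le>m. a ^ i)"
    by (induction m) (auto simp: a algebra_simps)
  \<comment> \<open>Eliminating the sum of \<open>i * a ^ i\<close> through \<open>w\<close> turns
    the claim into this inequality, whose increment in \<open>m\<close> is controlled by the chord
    bound at \<open>m + 1\<close>.\<close>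
  have "6 * ((\<Sum>i\<le>m. a ^ i) - (real m + 1))
     \<le> (2 * real m - 2) * (a ^ Suc m - 1) + d * (real m + 1) * (real m + 2)"
  proof (induction m)
    case (Suc m)
    have "2 * (2 * (a ^ Suc m - 1)) \<le> 2 * (real m * d * a ^ Suc m + d * (real m + 2))"
      using power_minus_one_convexity_bound[OF d, of "Suc m"] by (simp add: a algebra_simps)
    moreover have "(2 * real (Suc m) - 2) * (a ^ Suc (Suc m) - 1) =
        (2 * real m - 2) * (a ^ Suc m - 1) + 2 * (a ^ Suc m - 1) + 2 * real m * d * a ^ Suc m"
      by (simp add: a algebra_simps)
    ultimately show ?case using Suc by (simp add: algebra_simps)
  qed (simp add: a algebra_simps)
  then have "6 * ((\<Sum>i\<le>m. a ^ i) - (real m + 1))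
     \<le> (2 * real m - 2) * (d * (\<Sum>i\<le>m. a ^ i)) + d * (real m + 1) * (real m + 2)"
    unfolding s .
  moreover have "d * (\<Sum>i\<le>m. real i * a ^ i) = real m * (d * (\<Sum>i\<le>m. a ^ i)) + real m + 1 - (\<Sum>i\<le>m. a ^ i)"
    unfolding w s by (simp add: algebra_simps)
  ultimately show ?thesis by (simp add: field_simps)
qed

text \<open>Splitting \<open>1 - 2 * b + b * a = (1 - b) + (a - 1) * b\<close> allows
  \<open>(1 - b) * Q' < Q\<close> and \<open>3 * b * Q' \<le> (m + 2) * Q\<close> to be used at
  once. The hypothesis \<open>zero\<close> then replaces \<open>Q\<close> by the expression in
  \<open>a\<close> to which the excess bound applies.\<close>

lemma clique_family_second_order_pos:
  fixes a b :: real
  assumes b: "0 < b" "b < 1" and a: "1 < a" and m: "1 \<le> m"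
    and zero: "(\<Sum>i\<le>m. a ^ i) - (real m + 1) = (\<Sum>i\<le>m. b ^ i) - (real m + 1) * b ^ m"
  shows "((\<Sum>i\<le>m. real i * b ^ (i - 1)) - (real m + 1) * m * b ^ (m - 1)) * (1 - 2 * b + b * a)
     < (a - 1) * (\<Sum>i\<le>m. real i * a ^ i)"
proof -
  define Q where "Q = (\<Sum>i\<le>m. b ^ i) - (real m + 1) * b ^ m"
  define Q' where "Q' = (\<Sum>i\<le>m. real i * b ^ (i - 1)) - (real m + 1) * m * b ^ (m - 1)"
  have "(1 - b) * Q' = Q - (1 - b) * ((real m + 1) * m * b ^ (m - 1))"
    using geometric_weight_identity[of b m] by (simp add: Q_def Q'_def algebra_simps)
  moreover have "0 < (1 - b) * ((real m + 1) * m * b ^ (m - 1))"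
    using b m by (intro mult_pos_pos) auto
  ultimately have 1: "(1 - b) * Q' < Q" by simp
  have bs: "b * (real i * b ^ (i - 1)) = real i * b ^ i" for i by (cases i) auto
  have "b * Q' = (\<Sum>i\<le>m. real i * b ^ i) - (real m + 1) * m * b ^ m"
  proof -
    have "b * ((real m + 1) * m * b ^ (m - 1)) = (real m + 1) * m * b ^ m"
      using bs[of m] by (metis mult.assoc mult.left_commute)
    then show ?thesis unfolding Q'_def right_diff_distrib sum_distrib_left bs by simp
  qed
  then have 2: "3 * (b * Q') \<le> (real m + 2) * Q"
    using tilted_sum_nonneg[of b m] b m by (simp add: Q_def)
  have "Q' * (1 - 2 * b + b * a) = (1 - b) * Q' + (a - 1) * (3 * (b * Q')) / 3"
    by (simp add: field_simps)
  also have "\<dots> < Q + (a - 1) * ((real m + 2) * Q) / 3"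
    using 1 2 a by (intro add_less_le_mono divide_right_mono mult_left_mono) auto
  also have "\<dots> = Q * (1 + (a - 1) * (real m + 2) / 3)"
    by (simp add: algebra_simps)
  also have "\<dots> \<le> (a - 1) * (\<Sum>i\<le>m. real i * a ^ i)"
    using geometric_excess_bound[of "a - 1" a m] a zero by (simp add: Q_def)
  finally show ?thesis by (simp add: Q'_def)
qed

lemma power_diff_eq_geometric:
  fixes x y :: real
  shows "x ^ Suc m - y ^ Suc m = (x - y) * (\<Sum>i\<le>m. x ^ i * y ^ (m - i))"
  using diff_power_eq_sum[of x m y] by (simp add: lessThan_Suc_atMost)

text \<open>
  Along the curve, the derivative in \<open>c\<close> is \<open>(c - b) c^m H\<close> where \<open>H\<close> depends only on \<open>1 / c\<close> and \<open>b / c\<close>;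
  the preceding inequality says that \<open>H\<close> is increasing at its zeros.
\<close>

lemma clique_family_no_interior_max:
  fixes b c :: real
  assumes b: "0 < b" and c: "b < c" "c < 1" and k: "2 \<le> k"
    and max: "\<And>b' c'. 0 < b' \<Longrightarrow> b' < c' \<Longrightarrow> c' < 1 \<Longrightarrow>
      2 * b' * (1 - c') + c'\<^sup>2 = 2 * b * (1 - c) + c\<^sup>2 \<Longrightarrow>
      b' + (c' - b') * c' ^ k + (1 - c') * b' ^ k \<le> b + (c - b) * c ^ k + (1 - c) * b ^ k"
  shows False
proof -
  obtain m where km: "k = Suc m" and m: "1 \<le> m" using k by (cases k) auto
  define e where "e = 2 * b * (1 - c) + c\<^sup>2"
  \<comment> \<open>The constraint is linear in \<open>b'\<close>, so the curve is a graph over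
    \<open>c'\<close>.\<close>
  define B where "B = (\<lambda>z. (e - z\<^sup>2) / (2 * (1 - z)))"
  have Bc: "B c = b"
  proof -
    have "B c = b * (2 * (1 - c)) / (2 * (1 - c))" unfolding B_def e_def by (simp add: algebra_simps)
    then show ?thesis using c by (subst (asm) nonzero_mult_div_cancel_right) auto
  qed
  have inv: "2 * B z * (1 - z) + z\<^sup>2 = e" if "z < 1" for z
  proof -
    have "B z * (2 * (1 - z)) = e - z\<^sup>2"
      unfolding B_def times_divide_eq_left using that by (subst nonzero_mult_div_cancel_right) auto
    then show ?thesis by (simp add: algebra_simps)
  qed
  have dB: "(B has_real_derivative - (z - B z) / (1 - z)) (at z)" if "z < 1" for z
  proof -
    have "(B has_real_derivative ((- 2 * z) * (2 * (1 - z)) - (e - z\<^sup>2) * (- 2)) / (2 * (1 - z))\<^sup>2) (at z)"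
      unfolding B_def using that by (auto intro!: derivative_eq_intros simp: power2_eq_square)
    moreover have "((- 2 * z) * (2 * (1 - z)) - (e - z\<^sup>2) * (- 2)) / (2 * (1 - z))\<^sup>2 = - (z - B z) / (1 - z)"
      unfolding inv[OF that, symmetric] using that by (simp add: divide_simps power2_eq_square) algebra
    ultimately show ?thesis by simp
  qed
  have cont: "isCont B c" using dB[of c] c DERIV_isCont by blast
  have "\<forall>\<^sub>F z in at c. 0 < B z"
    using cont b Bc unfolding isCont_def by (auto intro: order_tendstoD)
  moreover have "isCont (\<lambda>z. z - B z) c" using cont by (intro continuous_intros) auto
  then have "\<forall>\<^sub>F z in at c. 0 < z - B z"
    using c Bc unfolding isCont_def by (intro order_tendstoD(1)) auto
  moreover have "\<forall>\<^sub>F z in at c. z < 1"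
    using c tendsto_ident_at[of c UNIV] by (auto intro: order_tendstoD)
  ultimately have "\<forall>\<^sub>F z in at c. 0 < B z \<and> B z < z \<and> z < 1" by eventually_elim auto
  then obtain r where r: "0 < r" and r': "\<And>z. z \<noteq> c \<Longrightarrow> \<bar>z - c\<bar> < r \<Longrightarrow> 0 < B z \<and> B z < z \<and> z < 1"
    unfolding eventually_at by (auto simp: dist_real_def)
  have rr: "0 < B z" "B z < z" "z < 1" if "\<bar>z - c\<bar> < r" for z
    using r'[of z] that Bc b c by (cases "z = c"; force)+
  define f where "f = (\<lambda>z. B z + (z - B z) * z ^ k + (1 - z) * B z ^ k)"
  \<comment> \<open>The equation \<open>H z = 0\<close> is the hypothesis \<open>zero\<close> of
    \<open>clique_family_second_order_pos\<close> at \<open>a = 1 / z\<close> and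
    \<open>b = B z / z\<close>.\<close>
  define H where "H = (\<lambda>z. real k + (\<Sum>i\<le>m. (B z / z) ^ i) - k * (B z / z) ^ m - (\<Sum>i\<le>m. (1 / z) ^ i))"
  have df: "(f has_real_derivative (z - B z) * z ^ m * H z) (at z)" if "\<bar>z - c\<bar> < r" for z
  proof -
    have z: "0 < z" "z < 1" "z \<noteq> 0" using rr[OF that] by auto
    define D where "D = - (z - B z) / (1 - z)"
    have D: "D * (1 - z) = - (z - B z)" using z by (simp add: D_def)
    have p: "((\<lambda>z. g z ^ k) has_real_derivative k * (g z ^ m * d)) (at z)"
      if "(g has_real_derivative d) (at z)" for g :: "real \<Rightarrow> real" and d
      using DERIV_power[OF that, of k] by (simp add: km mult_ac)
    note DB = dB[OF z(2), folded D_def]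
    have f1: "(f has_real_derivative D + ((1 - D) * z ^ k + (z - B z) * (k * z ^ m))
         + ((- 1) * B z ^ k + (1 - z) * (k * (B z ^ m * D)))) (at z)"
      using DERIV_add[OF DERIV_add[OF DB DERIV_mult'[OF DERIV_diff[OF DERIV_ident DB] p[OF DERIV_ident]]]
          DERIV_mult'[OF DERIV_diff[OF DERIV_const[of 1] DERIV_ident] p[OF DB]]]
      unfolding f_def by (simp add: algebra_simps)
    have "D + ((1 - D) * z ^ k + (z - B z) * (k * z ^ m))
         + ((- 1) * B z ^ k + (1 - z) * (k * (B z ^ m * D)))
       = D * (1 - z ^ k) + (z ^ k - B z ^ k) + (z - B z) * (k * z ^ m) + (D * (1 - z)) * k * B z ^ m"
      by (simp add: algebra_simps)
    also have "\<dots> = (z - B z) * (- (\<Sum>i\<le>m. z ^ (m - i)) + (\<Sum>i\<le>m. z ^ (m - i) * B z ^ i) + k * z ^ m - k * B z ^ m)"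
    proof -
      have 1: "1 - z ^ k = (1 - z) * (\<Sum>i\<le>m. z ^ (m - i))"
        using power_diff_eq_geometric[of 1 m z] by (simp add: km)
      have 2: "z ^ k - B z ^ k = (z - B z) * (\<Sum>i\<le>m. z ^ (m - i) * B z ^ i)"
        using power_diff_eq_geometric[of "B z" m z] by (simp add: km algebra_simps)
      show ?thesis unfolding 1 2 using D by algebra
    qed
    also have "\<dots> = (z - B z) * z ^ m * H z"
    proof -
      have p: "z ^ m * (1 / z) ^ i = z ^ (m - i)" if "i \<le> m" for i
        using that z by (simp add: power_one_over power_diff)
      have "z ^ m * H z = k * z ^ m + (\<Sum>i\<le>m. (z ^ m * (1 / z) ^ i) * B z ^ i) - k * ((z ^ m * (1 / z) ^ m) * B z ^ m)
         - (\<Sum>i\<le>m. z ^ m * (1 / z) ^ i)"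
        unfolding H_def by (simp add: algebra_simps sum_distrib_left power_divide)
      also have "\<dots> = k * z ^ m + (\<Sum>i\<le>m. z ^ (m - i) * B z ^ i) - k * B z ^ m - (\<Sum>i\<le>m. z ^ (m - i))"
        by (simp add: p)
      finally have "z ^ m * H z = \<dots>" .
      then have "(z - B z) * (z ^ m * H z) = (z - B z) * \<dots>" by (rule arg_cong)
      then show ?thesis by (simp add: algebra_simps)
    qed
    finally show ?thesis using f1 by simp
  qed
  \<comment> \<open>The chain rule, with the derivative of \<open>B z / z\<close> already
    simplified. Since \<open>(1 / c - 1) / (1 - c) = 1 / c\<close>, multiplication by
    \<open>1 - c\<close> turns \<open>l\<close> into the gap between the two sides of
    \<open>clique_family_second_order_pos\<close>.\<close>
  define l where "l = (\<Sum>i\<le>m. real i * (b / c) ^ (i - 1)) * (- (1 - 2 * (b / c) + b / c * (1 / c)) / (1 - c))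
     - k * (m * (b / c) ^ (m - 1) * (- (1 - 2 * (b / c) + b / c * (1 / c)) / (1 - c)))
     - (\<Sum>i\<le>m. real i * (1 / c) ^ (i - 1)) * (- (1 / c\<^sup>2))"
  have c0: "0 < c" using b c by simp
  have dH: "(H has_real_derivative l) (at c)"
  proof -
    have "((\<lambda>z. B z / z) has_real_derivative (- (c - b) / (1 - c) * c - b * 1) / (c * c)) (at c)"
      using DERIV_divide[OF dB[OF c(2)] DERIV_ident] c0 by (simp add: Bc)
    moreover have "(- (c - b) / (1 - c) * c - b * 1) / (c * c) = - (1 - 2 * (b / c) + b / c * (1 / c)) / (1 - c)"
      using c c0 by (simp add: divide_simps) algebra
    ultimately have 1: "((\<lambda>z. B z / z) has_real_derivative - (1 - 2 * (b / c) + b / c * (1 / c)) / (1 - c)) (at c)"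
      by simp
    have 2: "((\<lambda>z. 1 / z) has_real_derivative - (1 / c\<^sup>2)) (at c)"
      using c0 by (auto intro!: derivative_eq_intros simp: power2_eq_square)
    have p: "((\<lambda>z. g z ^ i) has_real_derivative real i * g c ^ (i - 1) * d) (at c)"
      if "(g has_real_derivative d) (at c)" for g :: "real \<Rightarrow> real" and i d
      using DERIV_power[OF that, of i] by (simp add: mult_ac)
    have 3: "((\<lambda>z. \<Sum>i\<le>m. g z ^ i) has_real_derivative (\<Sum>i\<le>m. real i * g c ^ (i - 1)) * d) (at c)"
      if "(g has_real_derivative d) (at c)" for g :: "real \<Rightarrow> real" and d
      unfolding sum_distrib_right by (intro DERIV_sum p that)
    have "(H has_real_derivative 0 + l) (at c)"
      using DERIV_diff[OF DERIV_diff[OF DERIV_add[OF DERIV_const[of "real k"] 3[OF 1]] DERIV_cmult[OF p[OF 1, of m], of "real k"]] 3[OF 2]]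
      unfolding H_def l_def Bc by (simp add: algebra_simps)
    then show ?thesis by simp
  qed
  have lpos: "0 < l" if "H c = 0"
  proof -
    let ?a = "1 / c" and ?b = "b / c"
    let ?Q' = "(\<Sum>i\<le>m. real i * ?b ^ (i - 1)) - (real m + 1) * m * ?b ^ (m - 1)"
    have "(\<Sum>i\<le>m. ?a ^ i) - (real m + 1) = (\<Sum>i\<le>m. ?b ^ i) - (real m + 1) * ?b ^ m"
      using that by (simp add: H_def Bc km algebra_simps)
    then have "0 < (?a - 1) * (\<Sum>i\<le>m. real i * ?a ^ i) - ?Q' * (1 - 2 * ?b + ?b * ?a)"
      using clique_family_second_order_pos[of ?b ?a m] b c c0 m by simp
    then have "0 < ((?a - 1) * (\<Sum>i\<le>m. real i * ?a ^ i) - ?Q' * (1 - 2 * ?b + ?b * ?a)) / (1 - c)"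
      using c by simp
    also have "\<dots> = l"
    proof -
      have s: "(\<Sum>i\<le>m. real i * ?a ^ i) = ?a * (\<Sum>i\<le>m. real i * ?a ^ (i - 1))"
        unfolding sum_distrib_left by (intro sum.cong refl) (metis mult.left_commute mult_zero_left of_nat_0 power_eq_if)
      have "(?a - 1) / (1 - c) = ?a" using c c0 by (simp add: field_simps)
      then have "(?a - 1) * (\<Sum>i\<le>m. real i * ?a ^ i) / (1 - c) = ?a * (\<Sum>i\<le>m. real i * ?a ^ i)"
        by (metis times_divide_eq_left)
      then show ?thesis unfolding l_def s
        by (simp add: km diff_divide_distrib algebra_simps power2_eq_square add_divide_distrib)
    qed
    finally show ?thesis .
  qed
  have "f z \<le> f c" if "\<bar>z - c\<bar> < r" for z
    using max[of "B z" z] rr[OF that] inv[of z] by (simp add: f_def Bc e_def)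
  moreover have "0 < (z - B z) * z ^ m" if "\<bar>z - c\<bar> < r" for z
    using rr[OF that] by (intro mult_pos_pos) auto
  ultimately show False using not_local_max[OF r df _ dH lpos] by blast
qed

section \<open>Split family: the pattern with isolated vertices\<close>

text \<open>A clique of mass \<open>c\<close> has a part of mass \<open>b\<close> joined to an
  independent class of mass \<open>w\<close>; the rest of the total mass \<open>s\<close> is
  isolated. The edge density is \<open>c^2 + 2 * b * w\<close>, so for fixed \<open>c\<close> the
  curve is the hyperbola on which \<open>b * w\<close> is constant. The derivative divided by the
  current \<open>b\<close> is increasing whether or not it vanishes.\<close>

lemma split_family_no_interior_max:
  fixes b c w s :: real
  assumes b: "0 < b" "b < c" and w: "0 < w" "c + w < s" and k: "2 \<le> k"
    and max: "\<And>b' w'. 0 < b' \<Longrightarrow> b' < c \<Longrightarrow> 0 < w' \<Longrightarrow> c + w' < s \<Longrightarrow> b' * w' = b * w \<Longrightarrow>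
      b' * (c + w') ^ k + (c - b') * c ^ k + w' * b' ^ k \<le> b * (c + w) ^ k + (c - b) * c ^ k + w * b ^ k"
  shows False
proof -
  obtain m where km: "k = Suc m" and m: "1 \<le> m" using k by (cases k) auto
  define B where "B = (\<lambda>z. b * w / z)"
  have Bw: "B w = b" using w by (simp add: B_def)
  have dB: "(B has_real_derivative - B z / z) (at z)" if "0 < z" for z
    unfolding B_def using that by (auto intro!: derivative_eq_intros)
  have cont: "isCont B w" using dB[of w] w DERIV_isCont by blast
  have "\<forall>\<^sub>F z in at w. 0 < B z" "\<forall>\<^sub>F z in at w. B z < c"
    using cont b Bw unfolding isCont_def by (auto intro: order_tendstoD)
  moreover have "\<forall>\<^sub>F z in at w. z < s - c" "\<forall>\<^sub>F z in at w. 0 < z"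
    using w tendsto_ident_at[of w UNIV] by (auto intro: order_tendstoD)
  ultimately have "\<forall>\<^sub>F z in at w. 0 < B z \<and> B z < c \<and> 0 < z \<and> z < s - c" by eventually_elim auto
  then obtain r where r: "0 < r" and r': "\<And>z. z \<noteq> w \<Longrightarrow> \<bar>z - w\<bar> < r \<Longrightarrow> 0 < B z \<and> B z < c \<and> 0 < z \<and> z < s - c"
    unfolding eventually_at by (auto simp: dist_real_def)
  have rr: "0 < B z" "B z < c" "0 < z" "c + z < s" if "\<bar>z - w\<bar> < r" for z
    using r'[of z] that Bw b w by (cases "z = w"; force)+
  define f where "f = (\<lambda>z. B z * (c + z) ^ k + (c - B z) * c ^ k + z * B z ^ k)"
  define H where "H = (\<lambda>z. k * (c + z) ^ m - (\<Sum>i\<le>m. (c + z) ^ i * c ^ (m - i)) - m * B z ^ m)"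
  have df: "(f has_real_derivative B z * H z) (at z)" if "\<bar>z - w\<bar> < r" for z
  proof -
    have z: "0 < z" using rr[OF that] by auto
    define D where "D = - B z / z"
    have D: "D * z = - B z" using z by (simp add: D_def)
    have p: "((\<lambda>z. g z ^ k) has_real_derivative k * (g z ^ m * d)) (at z)"
      if "(g has_real_derivative d) (at z)" for g :: "real \<Rightarrow> real" and d
      using DERIV_power[OF that, of k] by (simp add: km mult_ac)
    have dc: "((\<lambda>z. c + z) has_real_derivative 1) (at z)" by (auto intro!: derivative_eq_intros)
    note DB = dB[OF z, folded D_def]
    have f1: "(f has_real_derivative (D * (c + z) ^ k + B z * (k * (c + z) ^ m)) - D * c ^ k
        + (B z ^ k + z * (k * (B z ^ m * D)))) (at z)"
      using DERIV_add[OF DERIV_add[OF DERIV_mult'[OF DB p[OF dc]]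
          DERIV_cmult_right[OF DERIV_diff[OF DERIV_const[of c] DB], of "c ^ k"]]
          DERIV_mult'[OF DERIV_ident p[OF DB]]]
      unfolding f_def by (simp add: algebra_simps)
    have "(D * (c + z) ^ k + B z * (k * (c + z) ^ m)) - D * c ^ k + (B z ^ k + z * (k * (B z ^ m * D)))
      = D * ((c + z) ^ k - c ^ k) + B z * (k * (c + z) ^ m) + B z ^ k + (D * z) * k * B z ^ m"
      by (simp add: algebra_simps)
    also have "(c + z) ^ k - c ^ k = z * (\<Sum>i\<le>m. (c + z) ^ i * c ^ (m - i))"
      using power_diff_eq_geometric[of "c + z" m c] by (simp add: km)
    also have "D * (z * (\<Sum>i\<le>m. (c + z) ^ i * c ^ (m - i))) + B z * (k * (c + z) ^ m) + B z ^ k + (D * z) * k * B z ^ m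
       = B z * H z"
      unfolding mult.assoc[symmetric] D H_def km by (simp add: algebra_simps)
    finally show ?thesis using f1 by simp
  qed
  \<comment> \<open>The \<open>m + 1\<close> copies of \<open>m * (c + w) ^ (m - 1)\<close> are
    distributed over the indices \<open>i = 0..m\<close>; each summand is then nonnegative, and the
    last term gives strictness.\<close>
  define l where "l = (\<Sum>i\<le>m. real m * (c + w) ^ (m - 1) - real i * (c + w) ^ (i - 1) * c ^ (m - i))
     + real m * (m * b ^ (m - 1) * (b / w))"
  have dH: "(H has_real_derivative l) (at w)"
  proof -
    have 1: "((\<lambda>z. (c + z) ^ i) has_real_derivative real i * (c + w) ^ (i - 1)) (at w)" for i
      by (auto intro!: derivative_eq_intros)
    have 2: "((\<lambda>z. B z ^ m) has_real_derivative real m * b ^ (m - 1) * (- b / w)) (at w)"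
      using DERIV_power[OF dB[OF w(1)], of m] by (simp add: Bw algebra_simps)
    have "(H has_real_derivative k * (real m * (c + w) ^ (m - 1)) - (\<Sum>i\<le>m. real i * (c + w) ^ (i - 1) * c ^ (m - i))
        - real m * (real m * b ^ (m - 1) * (- b / w))) (at w)"
      unfolding H_def by (intro DERIV_diff DERIV_cmult DERIV_sum DERIV_cmult_right 1 2)
    then show ?thesis unfolding l_def by (simp add: km sum_subtractf algebra_simps)
  qed
  have "0 < l" unfolding l_def
  proof (intro add_nonneg_pos sum_nonneg)
    show "0 < real m * (real m * b ^ (m - 1) * (b / w))" using m b w by simp
    fix i assume i: "i \<in> {..m}"
    show "0 \<le> real m * (c + w) ^ (m - 1) - real i * (c + w) ^ (i - 1) * c ^ (m - i)"
    proof (cases "i = 0")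
      case False
      have "real i * (c + w) ^ (i - 1) * c ^ (m - i) \<le> real m * (c + w) ^ (i - 1) * (c + w) ^ (m - i)"
        using i b w by (intro mult_mono power_mono) auto
      also have "\<dots> = real m * (c + w) ^ (m - 1)"
        using i False by (simp add: power_add[symmetric] mult.assoc)
      finally show ?thesis by simp
    qed (use b w in simp)
  qed
  moreover have "f z \<le> f w" if "\<bar>z - w\<bar> < r" for z
    using max[of "B z" z] rr[OF that] by (simp add: f_def Bw) (simp add: B_def)
  ultimately show False using not_local_max[OF r df _ dH] rr by blast
qed

section \<open>Kernels over real distributions\<close>

text \<open>The gap between a power and its tangent is a sum of nonnegative terms
  \<open>(b - a) * (b ^ i - a ^ i) * a ^ (m - i)\<close>. The term \<open>i = m\<close> carries the
  factor \<open>a ^ 0 = 1\<close>, so equality forces \<open>b = a\<close> even for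
  \<open>a = 0\<close>.\<close>

lemma power_tangent_nonneg:
  fixes a b :: real
  assumes "0 \<le> a" "0 \<le> b"
  shows "0 \<le> b ^ Suc m - a ^ Suc m - Suc m * a ^ m * (b - a)"
    and "1 \<le> m \<Longrightarrow> b ^ Suc m - a ^ Suc m - Suc m * a ^ m * (b - a) = 0 \<Longrightarrow> b = a"
proof -
  have *: "b ^ Suc m - a ^ Suc m - Suc m * a ^ m * (b - a) =
    (\<Sum>i\<le>m. (b - a) * (b ^ i - a ^ i) * a ^ (m - i))"
  proof -
    have "(\<Sum>i\<le>m. (b - a) * (b ^ i - a ^ i) * a ^ (m - i)) =
        (b - a) * (\<Sum>i\<le>m. b ^ i * a ^ (m - i)) - (b - a) * (\<Sum>i\<le>m. a ^ i * a ^ (m - i))"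
      unfolding sum_distrib_left sum_subtractf[symmetric] by (simp add: algebra_simps)
    also have "(\<Sum>i\<le>m. a ^ i * a ^ (m - i)) = (\<Sum>i\<le>m. a ^ m)"
      by (intro sum.cong) (simp_all add: power_add[symmetric])
    finally show ?thesis using power_diff_eq_geometric[of b m a] by simp
  qed
  have nn: "0 \<le> (b - a) * (b ^ i - a ^ i) * a ^ (m - i)" for i
  proof (cases "a \<le> b")
    case True
    then show ?thesis using assms by (intro mult_nonneg_nonneg) (auto intro: power_mono)
  next
    case False
    then show ?thesis using assms
      by (intro mult_nonneg_nonneg mult_nonpos_nonpos) (auto intro: power_mono)
  qed
  then show "0 \<le> b ^ Suc m - a ^ Suc m - Suc m * a ^ m * (b - a)"
    unfolding * by (intro sum_nonneg) auto
  assume m: "1 \<le> m" and z: "b ^ Suc m - a ^ Suc m - Suc m * a ^ m * (b - a) = 0"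
  have "(b - a) * (b ^ m - a ^ m) * a ^ (m - m) = 0"
    using z nn unfolding * by (subst (asm) sum_nonneg_eq_0_iff) auto
  then have "b = a \<or> b ^ m = a ^ m" by simp
  then show "b = a" using m assms power_eq_imp_eq_base[of b m a] by auto
qed

text \<open>A graphon extended to the whole line, with its properties holding everywhere, so that
  one and the same kernel can be integrated against different distributions.\<close>

definition kernel :: "(real \<Rightarrow> real \<Rightarrow> real) \<Rightarrow> bool" where
  "kernel W \<longleftrightarrow> (\<lambda>(x, y). W x y) \<in> borel_measurable (borel \<Otimes>\<^sub>M borel) \<and>
     (\<forall>x y. W x y = W y x \<and> 0 \<le> W x y \<and> W x y \<le> 1)"

definition deg :: "real measure \<Rightarrow> (real \<Rightarrow> real \<Rightarrow> real) \<Rightarrow> real \<Rightarrow> real" where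
  "deg M W x = (\<integral>y. W x y \<partial>M)"

definition star :: "nat \<Rightarrow> real measure \<Rightarrow> (real \<Rightarrow> real \<Rightarrow> real) \<Rightarrow> real" where
  "star k M W = (\<integral>x. deg M W x ^ k \<partial>M)"

abbreviation edge :: "real measure \<Rightarrow> (real \<Rightarrow> real \<Rightarrow> real) \<Rightarrow> real" where
  "edge \<equiv> star 1"

context real_distribution
begin

sublocale P: pair_prob_space M M ..

lemma sets_pair_eq_borel [simp, measurable_cong]: "sets (M \<Otimes>\<^sub>M M) = sets (borel \<Otimes>\<^sub>M borel)"
  by (intro sets_pair_measure_cong) auto

lemma prob_UNIV [simp]: "prob UNIV = 1"
  using prob_space by simp

lemma integrable_bounded:
  fixes f :: "real \<Rightarrow> real"
  assumes "f \<in> borel_measurable borel" "\<And>x. \<bar>f x\<bar> \<le> C"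
  shows "integrable M f"
  using assms by (intro integrable_const_bound[of _ C]) auto

lemma integrable_pair_bounded:
  assumes "(\<lambda>(x, y). F x y :: real) \<in> borel_measurable (borel \<Otimes>\<^sub>M borel)" "\<And>x y. \<bar>F x y\<bar> \<le> C"
  shows "integrable (M \<Otimes>\<^sub>M M) (\<lambda>(x, y). F x y)"
  using assms by (intro P.integrable_const_bound[of _ C]) auto

lemma deg_measurable [measurable]:
  assumes [measurable]: "(\<lambda>(x, y). F x y) \<in> borel_measurable (borel \<Otimes>\<^sub>M borel)"
  shows "deg M F \<in> borel_measurable borel"
  unfolding deg_def by measurable

lemma abs_deg_le:
  assumes "(\<lambda>(x, y). F x y) \<in> borel_measurable (borel \<Otimes>\<^sub>M borel)" "\<And>x y. \<bar>F x y\<bar> \<le> C"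
  shows "\<bar>deg M F x\<bar> \<le> C"
proof -
  note [measurable] = assms(1)
  have "\<bar>deg M F x\<bar> \<le> (\<integral>y. \<bar>F x y\<bar> \<partial>M)" unfolding deg_def by (rule integral_abs_bound)
  also have "\<dots> \<le> (\<integral>y. C \<partial>M)"
    using assms(2) by (intro integral_mono integrable_const integrable_bounded[where C=C]) auto
  finally show ?thesis by (simp add: prob_space)
qed

lemma integral_mult_deg:
  assumes [measurable]: "(\<lambda>(x, y). F x y) \<in> borel_measurable (borel \<Otimes>\<^sub>M borel)" "a \<in> borel_measurable borel"
    and bd: "\<And>x y. \<bar>F x y\<bar> \<le> C" "\<And>x. \<bar>a x\<bar> \<le> D"
  shows "(\<integral>x. a x * deg M F x \<partial>M) = (\<integral>(x, y). a x * F x y \<partial>(M \<Otimes>\<^sub>M M))"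
proof -
  have "integrable (M \<Otimes>\<^sub>M M) (\<lambda>(x, y). a x * F x y)"
  proof (rule integrable_pair_bounded[where C="D * C"])
    fix x y show "\<bar>a x * F x y\<bar> \<le> D * C"
      unfolding abs_mult by (intro mult_mono bd order_trans[OF abs_ge_zero bd(2)]) simp
  qed measurable
  from P.integral_fst'[OF this] show ?thesis by (simp add: deg_def)
qed

lemma integral_pair_swap:
  assumes [measurable]: "(\<lambda>(x, y). F x y :: real) \<in> borel_measurable (borel \<Otimes>\<^sub>M borel)"
  shows "(\<integral>(x, y). F y x \<partial>(M \<Otimes>\<^sub>M M)) = (\<integral>(x, y). F x y \<partial>(M \<Otimes>\<^sub>M M))"
  using P.integral_product_swap[of "\<lambda>(x, y). F x y"] by (simp add: case_prod_beta')

text \<open>Fubini and the swap of coordinates. With \<open>a = d ^ m\<close> it identifies the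
  first variation of the star functional, a degree integral, with an integral of
  \<open>\<kappa>\<close> over the square.\<close>

lemma integral_symmetric_mult:
  assumes F[measurable]: "(\<lambda>(x, y). F x y) \<in> borel_measurable (borel \<Otimes>\<^sub>M borel)"
    and a[measurable]: "a \<in> borel_measurable borel"
    and sym: "\<And>x y. F x y = F y x"
    and bd: "\<And>x y. \<bar>F x y\<bar> \<le> C" "\<And>x. \<bar>a x\<bar> \<le> D"
  shows "(\<integral>(x, y). (a x + a y) * F x y \<partial>(M \<Otimes>\<^sub>M M)) = 2 * (\<integral>x. a x * deg M F x \<partial>M)"
proof -
  have int: "integrable (M \<Otimes>\<^sub>M M) (\<lambda>(x, y). a x * F x y)" "integrable (M \<Otimes>\<^sub>M M) (\<lambda>(x, y). a y * F y x)"
    by (rule integrable_pair_bounded[where C="D * C"], measurable,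
        unfold abs_mult, intro mult_mono bd order_trans[OF abs_ge_zero bd(2)], simp)+
  have "(\<integral>(x, y). (a x + a y) * F x y \<partial>(M \<Otimes>\<^sub>M M)) =
      (\<integral>z. (case z of (x, y) \<Rightarrow> a x * F x y) + (case z of (x, y) \<Rightarrow> a y * F y x) \<partial>(M \<Otimes>\<^sub>M M))"
    using sym by (intro Bochner_Integration.integral_cong) (auto simp: algebra_simps)
  also have "\<dots> = (\<integral>(x, y). a x * F x y \<partial>(M \<Otimes>\<^sub>M M)) + (\<integral>(x, y). a y * F y x \<partial>(M \<Otimes>\<^sub>M M))"
    by (intro Bochner_Integration.integral_add int)
  also have "(\<integral>(x, y). a y * F y x \<partial>(M \<Otimes>\<^sub>M M)) = (\<integral>(x, y). a x * F x y \<partial>(M \<Otimes>\<^sub>M M))"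
    by (rule integral_pair_swap[of "\<lambda>x y. a x * F x y"]) measurable
  finally show ?thesis using integral_mult_deg[OF F a bd] by simp
qed

lemma integral_deg:
  assumes [measurable]: "(\<lambda>(x, y). F x y) \<in> borel_measurable (borel \<Otimes>\<^sub>M borel)" and bd: "\<And>x y. \<bar>F x y\<bar> \<le> C"
  shows "(\<integral>x. deg M F x \<partial>M) = (\<integral>(x, y). F x y \<partial>(M \<Otimes>\<^sub>M M))"
  using integral_mult_deg[OF assms(1) _ bd, of "\<lambda>_. 1" 1] by simp

lemma deg_add:
  assumes [measurable]: "(\<lambda>(x, y). F x y) \<in> borel_measurable (borel \<Otimes>\<^sub>M borel)"
    "(\<lambda>(x, y). G x y) \<in> borel_measurable (borel \<Otimes>\<^sub>M borel)"
    and bd: "\<And>x y. \<bar>F x y\<bar> \<le> C" "\<And>x y. \<bar>G x y\<bar> \<le> D"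
  shows "deg M (\<lambda>x y. F x y + G x y) x = deg M F x + deg M G x"
  unfolding deg_def
  by (intro Bochner_Integration.integral_add integrable_bounded[OF _ bd(1)] integrable_bounded[OF _ bd(2)]) measurable

lemma kernelD:
  assumes "kernel W"
  shows "(\<lambda>(x, y). W x y) \<in> borel_measurable (borel \<Otimes>\<^sub>M borel)" "W x y = W y x" "0 \<le> W x y" "W x y \<le> 1" "\<bar>W x y\<bar> \<le> 1"
  using assms unfolding kernel_def by auto

lemma deg_kernel:
  assumes "kernel W" shows "0 \<le> deg M W x" "deg M W x \<le> 1" "\<bar>deg M W x\<bar> \<le> 1"
  using abs_deg_le[OF kernelD(1,5)[OF assms]] kernelD(3)[OF assms]
  by (auto simp: deg_def abs_le_iff)

end

text \<open>Competitors range over all distributions as well as all kernels, because reweighting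
  changes the distribution and block configurations live on four atoms. The exponent
  \<open>m\<close> is that of the derivative of \<open>x ^ k\<close>.\<close>

locale star_maximizer = real_distribution M for M +
  fixes W :: "real \<Rightarrow> real \<Rightarrow> real" and k m :: nat
  assumes kernel: "kernel W"
    and m: "1 \<le> m" and k: "k = Suc m"
    and atomless: "measure M {x} = 0"
    and maximal: "\<And>N V. real_distribution N \<Longrightarrow> kernel V \<Longrightarrow> edge N V = edge M W \<Longrightarrow> star k N V \<le> star k M W"
begin

abbreviation "d \<equiv> deg M W"
abbreviation "\<kappa> x y \<equiv> d x ^ m + d y ^ m"

lemma W_measurable [measurable]: "(\<lambda>(x, y). W x y) \<in> borel_measurable (borel \<Otimes>\<^sub>M borel)"
  using kernelD(1)[OF kernel] .
lemmas W_simps = kernelD(3,4,5)[OF kernel]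
lemmas W_sym = kernelD(2)[OF kernel]
lemmas d_bounds = deg_kernel[OF kernel]

lemma \<kappa>_bounds: "0 \<le> \<kappa> x y" "\<kappa> x y \<le> 2"
  using d_bounds(1,2)[of x] d_bounds(1,2)[of y] power_le_one[of "d x" m] power_le_one[of "d y" m] by auto

lemma star_maximizer_cong:
  assumes "kernel V" "AE x in M. deg M V x = d x"
  shows "star_maximizer M V k m"
proof -
  have "star j M V = star j M W" for j
    unfolding star_def using assms(2) kernelD(1)[OF assms(1)]
    by (intro integral_cong_AE) (auto elim: eventually_mono)
  then show ?thesis using assms(1) m k atomless maximal by unfold_locales auto
qed

text \<open>The star functional changes by a multiple of the linear term plus the integral of the
  tangent gaps of \<open>x ^ k\<close>. Both are nonnegative while maximality bounds their sum by 0,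
  so both vanish. A vanishing gap means an unmoved degree, hence the perturbed kernel is a maximizer
  again.\<close>

lemma perturbation:
  assumes \<eta>[measurable]: "(\<lambda>(x, y). \<eta> x y) \<in> borel_measurable (borel \<Otimes>\<^sub>M borel)"
    and sym: "\<And>x y. \<eta> x y = \<eta> y x"
    and range: "\<And>x y. 0 \<le> W x y + \<eta> x y" "\<And>x y. W x y + \<eta> x y \<le> 1"
    and zero: "(\<integral>(x, y). \<eta> x y \<partial>(M \<Otimes>\<^sub>M M)) = 0"
    and pos: "0 \<le> (\<integral>(x, y). \<kappa> x y * \<eta> x y \<partial>(M \<Otimes>\<^sub>M M))"
  shows "AE x in M. deg M \<eta> x = 0"
    and "(\<integral>(x, y). \<kappa> x y * \<eta> x y \<partial>(M \<Otimes>\<^sub>M M)) = 0"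
    and "star_maximizer M (\<lambda>x y. W x y + \<eta> x y) k m"
proof -
  define V where "V = (\<lambda>x y. W x y + \<eta> x y)"
  have bd: "\<bar>\<eta> x y\<bar> \<le> 1" for x y using range[of x y] W_simps[of x y] by (auto simp: abs_le_iff)
  have kV: "kernel V" unfolding kernel_def V_def using range W_sym sym by auto
  have dV: "deg M V x = d x + deg M \<eta> x" for x
    unfolding V_def by (rule deg_add[OF W_measurable \<eta> W_simps(3) bd])
  have deta: "\<bar>deg M \<eta> x\<bar> \<le> 1" for x by (rule abs_deg_le[OF \<eta> bd])
  have pw: "\<bar>d x ^ j\<bar> \<le> 1" "\<bar>deg M V x ^ j\<bar> \<le> 1" for x j
    using d_bounds[of x] deg_kernel[OF kV, of x] by (auto simp: power_abs intro: power_le_one)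
  have [measurable]: "(\<lambda>(x, y). V x y) \<in> borel_measurable (borel \<Otimes>\<^sub>M borel)" using kernelD(1)[OF kV] .
  have int: "integrable M (\<lambda>x. d x ^ j)" "integrable M (\<lambda>x. deg M V x ^ j)" "integrable M (deg M \<eta>)" for j
    using pw deta by (auto intro!: integrable_bounded[where C=1])
  have int2: "integrable M (\<lambda>x. d x ^ m * deg M \<eta> x)"
  proof (rule integrable_bounded[where C="1 * 1"])
    show "\<bar>d x ^ m * deg M \<eta> x\<bar> \<le> 1 * 1" for x
      unfolding abs_mult using pw(1)[of x m] deta[of x] by (intro mult_mono) auto
  qed measurable
  have eta0: "(\<integral>x. deg M \<eta> x \<partial>M) = 0" using integral_deg[OF \<eta> bd] zero by simp
  have "edge M V = edge M W"
    unfolding star_def power_one_right dV using int(1)[of 1] int(3) eta0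
    by (subst Bochner_Integration.integral_add) auto
  then have le: "star k M V \<le> star k M W" using maximal[OF _ kV] real_distribution_axioms by blast
  have lin: "(\<integral>(x, y). \<kappa> x y * \<eta> x y \<partial>(M \<Otimes>\<^sub>M M)) = 2 * (\<integral>x. d x ^ m * deg M \<eta> x \<partial>M)"
    using integral_symmetric_mult[OF \<eta> _ sym bd pw(1)[of _ m]] by simp
  define g where "g = (\<lambda>x. deg M V x ^ Suc m - d x ^ Suc m - Suc m * d x ^ m * (deg M V x - d x))"
  have g0: "0 \<le> g x" for x
    unfolding g_def using power_tangent_nonneg(1) d_bounds deg_kernel[OF kV] by simp
  have g: "g x = deg M V x ^ k - d x ^ k - Suc m * (d x ^ m * deg M \<eta> x)" for x
    unfolding g_def dV k by simp
  have intg: "integrable M g" unfolding g using int int2 by auto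
  have "integral\<^sup>L M g = star k M V - star k M W - Suc m * (\<integral>x. d x ^ m * deg M \<eta> x \<partial>M)"
    unfolding g star_def using int int2 by simp
  moreover have "0 \<le> integral\<^sup>L M g" using g0 by simp
  moreover have "0 \<le> Suc m * (\<integral>x. d x ^ m * deg M \<eta> x \<partial>M)" using pos lin by simp
  ultimately have 0: "integral\<^sup>L M g = 0" "Suc m * (\<integral>x. d x ^ m * deg M \<eta> x \<partial>M) = 0" using le by linarith+
  then show "(\<integral>(x, y). \<kappa> x y * \<eta> x y \<partial>(M \<Otimes>\<^sub>M M)) = 0" using lin by simp
  have "AE x in M. g x = 0" using 0(1) integral_nonneg_eq_0_iff_AE[OF intg] g0 by simp
  then show AE: "AE x in M. deg M \<eta> x = 0"
  proof eventually_elim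
    case (elim x)
    then show ?case using power_tangent_nonneg(2)[of "d x" "deg M V x" m] d_bounds deg_kernel[OF kV] m dV
      by (simp add: g_def)
  qed
  show "star_maximizer M (\<lambda>x y. W x y + \<eta> x y) k m"
    using star_maximizer_cong[OF kV] AE dV unfolding V_def by simp
qed

end

lemma sets_pair_Collect:
  fixes P :: "real \<times> real \<Rightarrow> bool"
  shows "Measurable.pred (borel \<Otimes>\<^sub>M borel) P \<Longrightarrow> Collect P \<in> sets (borel \<Otimes>\<^sub>M borel)"
  by (simp add: pred_def space_pair_measure)

context star_maximizer
begin

text \<open>A value strictly between 0 and 1 admits small perturbations of both signs, and one sign
  has a nonnegative linear term, so a mean-zero symmetric \<open>\<eta>\<close> on \<open>L\<close>
  has zero degrees. With \<open>\<eta>\<close> proportional to \<open>g - q\<close> and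
  \<open>g (x, y) = arctan x + arctan y\<close>, testing these degrees against \<open>arctan\<close>
  gives that \<open>(g - q)^2\<close> integrates to 0 over \<open>L\<close>. For an atomless
  distribution, however, \<open>g\<close> differs from any constant almost everywhere.\<close>

lemma fractional_level_null:
  assumes L[measurable]: "L \<in> sets (borel \<Otimes>\<^sub>M borel)"
    and sym: "\<And>x y. (x, y) \<in> L \<longleftrightarrow> (y, x) \<in> L"
    and level: "\<And>x y. (x, y) \<in> L \<Longrightarrow> W x y = \<tau>" and \<tau>: "0 < \<tau>" "\<tau> < 1"
  shows "AE z in M \<Otimes>\<^sub>M M. z \<notin> L"
proof (rule ccontr)
  assume neg: "\<not> ?thesis"
  then have pL: "0 < P.prob L"
    using P.prob_eq_0[of L] by (simp add: zero_less_measure_iff)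
  \<comment> \<open>Here \<open>arctan\<close> serves as a bounded injective function.\<close>
  define g where "g = (\<lambda>(x, y). arctan x + arctan y)"
  have at4: "\<bar>arctan x\<bar> \<le> 2" for x
    using arctan_bounded[of x] pi_less_4 by (auto simp: abs_le_iff)
  have g4: "\<bar>g z\<bar> \<le> 4" for z
    using at4[of "fst z"] at4[of "snd z"] by (auto simp: g_def case_prod_beta)
  have [measurable]: "g \<in> borel_measurable (borel \<Otimes>\<^sub>M borel)" unfolding g_def by measurable
  have intL: "integrable (M \<Otimes>\<^sub>M M) (\<lambda>z. indicator L z * g z)"
    using g4 by (intro P.integrable_const_bound[of _ 4]) (auto simp: indicator_def)
  define q where "q = (\<integral>z. indicator L z * g z \<partial>(M \<Otimes>\<^sub>M M)) / P.prob L"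
  have "\<bar>\<integral>z. indicator L z * g z \<partial>(M \<Otimes>\<^sub>M M)\<bar> \<le> (\<integral>z. \<bar>indicator L z * g z\<bar> \<partial>(M \<Otimes>\<^sub>M M))"
    by (rule integral_abs_bound)
  also have "\<dots> \<le> (\<integral>z. 4 * indicator L z \<partial>(M \<Otimes>\<^sub>M M))"
    using g4 intL by (intro integral_mono integrable_abs integrable_mult_right integrable_real_indicator)
      (auto simp: indicator_def P.emeasure_eq_measure)
  finally have q4: "\<bar>q\<bar> \<le> 4" using pL by (simp add: q_def field_simps)
  \<comment> \<open>The distance of \<open>\<tau>\<close> from 0 and 1, divided by the bound 8 on
    \<open>\<bar>g - q\<bar>\<close>.\<close>
  define s where "s = min \<tau> (1 - \<tau>) / 8"
  have s: "0 < s" "8 * s \<le> \<tau>" "8 * s \<le> 1 - \<tau>" using \<tau> by (auto simp: s_def)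
  define \<eta> where "\<eta> = (\<lambda>x y. s * indicator L (x, y) * (g (x, y) - q))"
  have [measurable]: "(\<lambda>(x, y). \<eta> x y) \<in> borel_measurable (borel \<Otimes>\<^sub>M borel)" unfolding \<eta>_def by measurable
  have \<eta>sym: "\<eta> x y = \<eta> y x" for x y
    using sym[of x y] by (auto simp: \<eta>_def g_def indicator_def)
  have \<eta>8: "\<bar>\<eta> x y\<bar> \<le> 8 * s * indicator L (x, y)" for x y
  proof -
    have "\<bar>g (x, y) - q\<bar> \<le> 8" using g4[of "(x, y)"] q4 by linarith
    then have "s * \<bar>g (x, y) - q\<bar> \<le> s * 8" using s by (intro mult_left_mono) auto
    then show ?thesis using s by (auto simp: \<eta>_def indicator_def abs_mult)
  qed
  have range: "0 \<le> W x y + \<eta> x y \<and> W x y + \<eta> x y \<le> 1 \<and> 0 \<le> W x y - \<eta> x y \<and> W x y - \<eta> x y \<le> 1" for x y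
    using \<eta>8[of x y] W_simps[of x y] level[of x y] s by (cases "(x, y) \<in> L") auto
  have "(\<integral>(x, y). \<eta> x y \<partial>(M \<Otimes>\<^sub>M M)) = (\<integral>z. s * (indicator L z * g z) - s * q * indicator L z \<partial>(M \<Otimes>\<^sub>M M))"
    by (intro Bochner_Integration.integral_cong) (auto simp: \<eta>_def algebra_simps)
  also have "\<dots> = s * (q * P.prob L) - s * q * P.prob L"
    using intL pL by (subst Bochner_Integration.integral_diff) (auto simp: q_def P.emeasure_eq_measure)
  finally have zero: "(\<integral>(x, y). \<eta> x y \<partial>(M \<Otimes>\<^sub>M M)) = 0" by simp
  have AE: "AE x in M. deg M \<eta> x = 0"
  proof (cases "0 \<le> (\<integral>(x, y). \<kappa> x y * \<eta> x y \<partial>(M \<Otimes>\<^sub>M M))")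
    case True
    show ?thesis using range by (intro perturbation(1) \<eta>sym zero True) auto
  next
    case False
    have "AE x in M. deg M (\<lambda>x y. - \<eta> x y) x = 0"
    proof (rule perturbation(1))
      show "0 \<le> (\<integral>(x, y). \<kappa> x y * - \<eta> x y \<partial>(M \<Otimes>\<^sub>M M))"
        using False by (simp add: case_prod_beta')
      show "(\<integral>(x, y). - \<eta> x y \<partial>(M \<Otimes>\<^sub>M M)) = 0"
        using zero by (simp add: case_prod_beta')
    qed (use range \<eta>sym in auto)
    then show ?thesis by (simp add: deg_def)
  qed
  have \<eta>bd: "\<bar>\<eta> x y\<bar> \<le> 8 * s" for x y using \<eta>8[of x y] s by (cases "(x, y) \<in> L") auto
  have "(\<integral>(x, y). (arctan x + arctan y) * \<eta> x y \<partial>(M \<Otimes>\<^sub>M M)) = 2 * (\<integral>x. arctan x * deg M \<eta> x \<partial>M)"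
    by (rule integral_symmetric_mult[OF _ _ \<eta>sym \<eta>bd at4]) measurable
  also have "(\<integral>x. arctan x * deg M \<eta> x \<partial>M) = (\<integral>x. 0 \<partial>M)"
    using AE by (intro integral_cong_AE) (auto elim: eventually_mono)
  finally have g0: "(\<integral>(x, y). (arctan x + arctan y) * \<eta> x y \<partial>(M \<Otimes>\<^sub>M M)) = 0" by simp
  have "integrable (M \<Otimes>\<^sub>M M) (\<lambda>z. g z * (case z of (x, y) \<Rightarrow> \<eta> x y))"
  proof (rule P.integrable_const_bound[of _ "4 * (8 * s)"])
    show "AE z in M \<Otimes>\<^sub>M M. norm (g z * (case z of (x, y) \<Rightarrow> \<eta> x y)) \<le> 4 * (8 * s)"
      unfolding real_norm_def abs_mult by (intro AE_I2 mult_mono g4) (auto simp: \<eta>bd split: prod.split)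
  qed measurable
  moreover have "integrable (M \<Otimes>\<^sub>M M) (\<lambda>(x, y). \<eta> x y)" by (rule integrable_pair_bounded[OF _ \<eta>bd]) measurable
  ultimately have int: "integrable (M \<Otimes>\<^sub>M M) (\<lambda>z. g z * (case z of (x, y) \<Rightarrow> \<eta> x y) - q * (case z of (x, y) \<Rightarrow> \<eta> x y))"
    "(\<integral>z. g z * (case z of (x, y) \<Rightarrow> \<eta> x y) - q * (case z of (x, y) \<Rightarrow> \<eta> x y) \<partial>(M \<Otimes>\<^sub>M M)) = 0"
    using zero g0 by (auto simp: g_def case_prod_beta')
  have sq: "g z * (case z of (x, y) \<Rightarrow> \<eta> x y) - q * (case z of (x, y) \<Rightarrow> \<eta> x y) = s * indicator L z * (g z - q)\<^sup>2" for z
    by (cases z) (simp add: \<eta>_def power2_eq_square algebra_simps)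
  have "AE z in M \<Otimes>\<^sub>M M. s * indicator L z * (g z - q)\<^sup>2 = 0"
    using int s unfolding sq by (subst (asm) integral_nonneg_eq_0_iff_AE) auto
  moreover have "AE z in M \<Otimes>\<^sub>M M. g z \<noteq> q"
  proof (rule P.AE_pair_measure)
    show "AE x in M. AE y in M. g (x, y) \<noteq> q"
    proof (rule AE_I2)
      fix x
      have "AE y in M. y \<noteq> tan (q - arctan x)"
        using prob_eq_0[of "{tan (q - arctan x)}"] atomless by simp
      then show "AE y in M. g (x, y) \<noteq> q"
        by eventually_elim (auto simp: g_def tan_arctan algebra_simps)
    qed
  qed measurable
  ultimately have "AE z in M \<Otimes>\<^sub>M M. z \<notin> L" by eventually_elim (use s in \<open>auto simp: indicator_def\<close>)
  then show False using neg by simp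
qed

text \<open>Shifting kernel mass from \<open>?B2\<close> to \<open>?B1\<close> keeps the edge
  density and makes the linear term strictly positive, which \<open>perturbation\<close>
  forbids.\<close>

lemma bathtub:
  assumes B1: "P.prob {z. W (fst z) (snd z) < 1 \<and> l < \<kappa> (fst z) (snd z)} > 0" (is "P.prob ?B1 > 0")
    and B2: "P.prob {z. 0 < W (fst z) (snd z) \<and> \<kappa> (fst z) (snd z) < l} > 0" (is "P.prob ?B2 > 0")
  shows False
proof -
  define u1 where "u1 = (\<lambda>x y. indicator ?B1 (x, y) * (1 - W x y))"
  define u2 where "u2 = (\<lambda>x y. indicator ?B2 (x, y) * W x y)"
  have B_meas[measurable]: "?B1 \<in> sets (borel \<Otimes>\<^sub>M borel)" "?B2 \<in> sets (borel \<Otimes>\<^sub>M borel)"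
    by (rule sets_pair_Collect, measurable)+
  have [measurable]: "(\<lambda>(x, y). u1 x y) \<in> borel_measurable (borel \<Otimes>\<^sub>M borel)"
    "(\<lambda>(x, y). u2 x y) \<in> borel_measurable (borel \<Otimes>\<^sub>M borel)"
    unfolding u1_def u2_def by measurable
  have u: "0 \<le> u1 x y" "u1 x y \<le> 1 - W x y" "0 \<le> u2 x y" "u2 x y \<le> W x y" "u1 x y = u1 y x" "u2 x y = u2 y x" for x y
    using W_simps[of x y] W_sym[of x y] by (auto simp: u1_def u2_def indicator_def add.commute)
  have ub: "\<bar>u1 x y\<bar> \<le> 1" "\<bar>u2 x y\<bar> \<le> 1" for x y using u[of x y] W_simps[of x y] by auto
  define I1 where "I1 = (\<integral>(x, y). u1 x y \<partial>(M \<Otimes>\<^sub>M M))"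
  define I2 where "I2 = (\<integral>(x, y). u2 x y \<partial>(M \<Otimes>\<^sub>M M))"
  have int: "integrable (M \<Otimes>\<^sub>M M) (\<lambda>(x, y). u1 x y)" "integrable (M \<Otimes>\<^sub>M M) (\<lambda>(x, y). u2 x y)"
    by (rule integrable_pair_bounded[where C=1]; use ub in simp)+
  have I: "0 \<le> I1" "0 \<le> I2" unfolding I1_def I2_def using u by (auto intro!: Bochner_Integration.integral_nonneg)
  have "I1 \<le> (\<integral>z. 1 \<partial>(M \<Otimes>\<^sub>M M))" "I2 \<le> (\<integral>z. 1 \<partial>(M \<Otimes>\<^sub>M M))"
    unfolding I1_def I2_def
    by (intro integral_mono int P.integrable_const; use ub in \<open>auto simp: abs_le_iff\<close>)+
  then have I': "I1 \<le> 1" "I2 \<le> 1" using P.prob_space by simp_all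
  have "I1 \<noteq> 0"
  proof
    assume "I1 = 0"
    then have "AE z in M \<Otimes>\<^sub>M M. (case z of (x, y) \<Rightarrow> u1 x y) = 0"
      unfolding I1_def using u by (subst (asm) integral_nonneg_eq_0_iff_AE[OF int(1)]) auto
    then have "AE z in M \<Otimes>\<^sub>M M. z \<notin> ?B1" by eventually_elim (auto simp: u1_def)
    then show False using B1 P.prob_eq_0[of ?B1] by simp
  qed
  have "I2 \<noteq> 0"
  proof
    assume "I2 = 0"
    then have "AE z in M \<Otimes>\<^sub>M M. (case z of (x, y) \<Rightarrow> u2 x y) = 0"
      unfolding I2_def using u by (subst (asm) integral_nonneg_eq_0_iff_AE[OF int(2)]) auto
    then have "AE z in M \<Otimes>\<^sub>M M. z \<notin> ?B2" by eventually_elim (auto simp: u2_def)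
    then show False using B2 P.prob_eq_0[of ?B2] by simp
  qed
  \<comment> \<open>The crossed weights \<open>I2\<close> and \<open>I1\<close> balance the total
    mass; as both are at most 1, the values stay in the unit interval.\<close>
  define \<eta> where "\<eta> = (\<lambda>x y. I2 * u1 x y - I1 * u2 x y)"
  have [measurable]: "(\<lambda>(x, y). \<eta> x y) \<in> borel_measurable (borel \<Otimes>\<^sub>M borel)" unfolding \<eta>_def by measurable
  have range: "0 \<le> W x y + \<eta> x y \<and> W x y + \<eta> x y \<le> 1" for x y
  proof -
    have "I2 * u1 x y \<le> 1 * u1 x y" "I1 * u2 x y \<le> 1 * u2 x y"
      using u[of x y] I' by (intro mult_right_mono; simp)+
    moreover have "0 \<le> I2 * u1 x y" "0 \<le> I1 * u2 x y" using I u[of x y] by auto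
    ultimately show ?thesis using u[of x y] unfolding \<eta>_def by linarith
  qed
  have \<eta>bd: "\<bar>\<eta> x y\<bar> \<le> 1" for x y using range[of x y] W_simps[of x y] by (auto simp: abs_le_iff)
  have zero: "(\<integral>(x, y). \<eta> x y \<partial>(M \<Otimes>\<^sub>M M)) = 0"
  proof -
    have "(\<integral>(x, y). \<eta> x y \<partial>(M \<Otimes>\<^sub>M M)) = (\<integral>z. I2 * (case z of (x, y) \<Rightarrow> u1 x y) - I1 * (case z of (x, y) \<Rightarrow> u2 x y) \<partial>(M \<Otimes>\<^sub>M M))"
      by (intro Bochner_Integration.integral_cong) (auto simp: \<eta>_def)
    also have "\<dots> = I2 * I1 - I1 * I2"
      using int by (subst Bochner_Integration.integral_diff) (auto simp: I1_def I2_def)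
    finally show ?thesis by simp
  qed
  \<comment> \<open>Subtracting \<open>l\<close> does not change the integral because
    \<open>\<eta>\<close> has mean zero, and it makes the integrand nonnegative pointwise.\<close>
  define F where "F = (\<lambda>x y. (\<kappa> x y - l) * \<eta> x y)"
  have F: "F x y = I2 * (\<kappa> x y - l) * u1 x y + I1 * (l - \<kappa> x y) * u2 x y" for x y
    by (simp add: F_def \<eta>_def algebra_simps)
  have F0: "0 \<le> F x y" for x y
    unfolding F using I u[of x y] by (auto simp: u1_def u2_def indicator_def intro!: add_nonneg_nonneg)
  have int\<kappa>: "integrable (M \<Otimes>\<^sub>M M) (\<lambda>(x, y). \<kappa> x y * \<eta> x y)"
  proof (rule integrable_pair_bounded[where C="2 * 1"])
    show "\<bar>\<kappa> x y * \<eta> x y\<bar> \<le> 2 * 1" for x y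
      unfolding abs_mult using \<kappa>_bounds[of x y] \<eta>bd[of x y] by (intro mult_mono) auto
  qed measurable
  have int\<eta>: "integrable (M \<Otimes>\<^sub>M M) (\<lambda>(x, y). \<eta> x y)"
    by (rule integrable_pair_bounded[where C=1]) (use \<eta>bd in auto)
  have Fz: "(case z of (x, y) \<Rightarrow> F x y) = (case z of (x, y) \<Rightarrow> \<kappa> x y * \<eta> x y) - l * (case z of (x, y) \<Rightarrow> \<eta> x y)" for z
    by (auto simp: F_def algebra_simps split: prod.split)
  have intF: "integrable (M \<Otimes>\<^sub>M M) (\<lambda>(x, y). F x y)" unfolding Fz using int\<kappa> int\<eta> by auto
  have eq: "(\<integral>(x, y). F x y \<partial>(M \<Otimes>\<^sub>M M)) = (\<integral>(x, y). \<kappa> x y * \<eta> x y \<partial>(M \<Otimes>\<^sub>M M))"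
    unfolding Fz using int\<kappa> int\<eta> zero by simp
  have "(\<integral>(x, y). \<kappa> x y * \<eta> x y \<partial>(M \<Otimes>\<^sub>M M)) = 0"
  proof (rule perturbation(2))
    show "\<eta> x y = \<eta> y x" for x y using u(5,6)[of x y] by (simp add: \<eta>_def)
    show "0 \<le> (\<integral>(x, y). \<kappa> x y * \<eta> x y \<partial>(M \<Otimes>\<^sub>M M))"
      unfolding eq[symmetric] using F0 by (auto intro!: Bochner_Integration.integral_nonneg)
  qed (use range zero in auto)
  then have "AE z in M \<Otimes>\<^sub>M M. (case z of (x, y) \<Rightarrow> F x y) = 0"
    using F0 eq by (subst (asm) integral_nonneg_eq_0_iff_AE[OF intF, symmetric] | subst integral_nonneg_eq_0_iff_AE[OF intF, symmetric]) auto
  then have "AE z in M \<Otimes>\<^sub>M M. z \<notin> ?B1"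
  proof eventually_elim
    case (elim z)
    show ?case
    proof
      assume z: "z \<in> ?B1"
      obtain x y where xy: "z = (x, y)" by (cases z)
      have "0 < I2 * (\<kappa> x y - l) * u1 x y"
        using z I \<open>I2 \<noteq> 0\<close> xy by (auto simp: u1_def)
      moreover have "0 \<le> I1 * (l - \<kappa> x y) * u2 x y"
        using I u[of x y] by (auto simp: u2_def indicator_def)
      ultimately show False using elim xy F[of x y] by simp
    qed
  qed
  then show False using B1 P.prob_eq_0[of ?B1] by simp
qed

end

section \<open>Threshold form of a maximizer\<close>

context star_maximizer
begin

text \<open>The level is the infimum of the levels above which the kernel is 1. Below the infimum
  some non-null set has kernel values less than 1 at larger \<open>\<kappa>\<close>, so
  \<open>bathtub\<close> applies; the limits run through \<open>1 / Suc n\<close> to keep the null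
  sets countable.\<close>

lemma bathtub_level:
  obtains l where "AE z in M \<Otimes>\<^sub>M M. l < \<kappa> (fst z) (snd z) \<longrightarrow> W (fst z) (snd z) = 1"
    and "AE z in M \<Otimes>\<^sub>M M. \<kappa> (fst z) (snd z) < l \<longrightarrow> W (fst z) (snd z) = 0"
proof -
  define S where "S = {l. AE z in M \<Otimes>\<^sub>M M. l < \<kappa> (fst z) (snd z) \<longrightarrow> W (fst z) (snd z) = 1}"
  have two: "2 \<in> S"
    unfolding S_def mem_Collect_eq using \<kappa>_bounds(2) by (intro AE_I2) (metis linorder_not_less)
  show thesis
  \<comment> \<open>If the kernel is 1 almost everywhere, \<open>S\<close> has no lower bound;
    \<open>-1\<close> then works because it lies below every value of
    \<open>\<kappa>\<close>.\<close>
  proof (cases "-1 \<in> S")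
    case True
    show ?thesis
    proof (rule that[of "-1"])
      show "AE z in M \<Otimes>\<^sub>M M. -1 < \<kappa> (fst z) (snd z) \<longrightarrow> W (fst z) (snd z) = 1"
        using True by (simp add: S_def)
      have "\<not> \<kappa> x y < -1" for x y using \<kappa>_bounds(1)[of x y] by simp
      then show "AE z in M \<Otimes>\<^sub>M M. \<kappa> (fst z) (snd z) < -1 \<longrightarrow> W (fst z) (snd z) = 0" by simp
    qed
  next
    case False
    have up: "b \<in> S" if "a \<in> S" "a \<le> b" for a b
      using that unfolding S_def mem_Collect_eq by (auto elim!: eventually_mono)
    have bdd: "bdd_below S"
      using up False by (intro bdd_belowI[of _ "-1"]) (meson linear)
    define l where "l = Inf S"
    have "AE z in M \<Otimes>\<^sub>M M. \<forall>n::nat. l + 1 / Suc n < \<kappa> (fst z) (snd z) \<longrightarrow> W (fst z) (snd z) = 1"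
      unfolding AE_all_countable
    proof
      fix n :: nat
      have "Inf S < l + 1 / Suc n" by (simp add: l_def)
      then obtain a where "a \<in> S" "a < l + 1 / Suc n" using two cInf_lessD[of S "l + 1 / Suc n"] by auto
      then have "l + 1 / Suc n \<in> S" using up by (meson less_imp_le)
      then show "AE z in M \<Otimes>\<^sub>M M. l + 1 / Suc n < \<kappa> (fst z) (snd z) \<longrightarrow> W (fst z) (snd z) = 1"
        by (simp add: S_def)
    qed
    then have 1: "AE z in M \<Otimes>\<^sub>M M. l < \<kappa> (fst z) (snd z) \<longrightarrow> W (fst z) (snd z) = 1"
    proof eventually_elim
      case (elim z)
      show ?case
      proof
        assume "l < \<kappa> (fst z) (snd z)"
        then obtain n where "1 / Suc n < \<kappa> (fst z) (snd z) - l"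
          using nat_approx_posE[of "\<kappa> (fst z) (snd z) - l"] by auto
        then show "W (fst z) (snd z) = 1" using elim[rule_format, of n] by simp
      qed
    qed
    have "AE z in M \<Otimes>\<^sub>M M. \<forall>n::nat. \<kappa> (fst z) (snd z) < l - 1 / Suc n \<longrightarrow> W (fst z) (snd z) = 0"
      unfolding AE_all_countable
    proof
      fix n :: nat
      define a where "a = l - 1 / Suc n"
      have "a \<notin> S" using cInf_lower[OF _ bdd, of a] by (auto simp: a_def l_def)
      let ?B1 = "{z. W (fst z) (snd z) < 1 \<and> a < \<kappa> (fst z) (snd z)}"
      let ?B2 = "{z. 0 < W (fst z) (snd z) \<and> \<kappa> (fst z) (snd z) < a}"
      have [measurable]: "?B1 \<in> sets (borel \<Otimes>\<^sub>M borel)" "?B2 \<in> sets (borel \<Otimes>\<^sub>M borel)"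
        by (rule sets_pair_Collect, measurable)+
      have "0 < P.prob ?B1"
      proof (rule ccontr)
        assume "\<not> ?thesis"
        then have "AE z in M \<Otimes>\<^sub>M M. z \<notin> ?B1"
          using P.prob_eq_0[of ?B1] by (simp add: zero_less_measure_iff)
        then have "a \<in> S" unfolding S_def mem_Collect_eq
          by eventually_elim (use W_simps in \<open>auto simp: not_less intro: antisym\<close>)
        then show False using \<open>a \<notin> S\<close> by simp
      qed
      then have "\<not> 0 < P.prob ?B2" using bathtub by blast
      then have "AE z in M \<Otimes>\<^sub>M M. z \<notin> ?B2"
        using P.prob_eq_0[of ?B2] by (simp add: zero_less_measure_iff)
      then show "AE z in M \<Otimes>\<^sub>M M. \<kappa> (fst z) (snd z) < l - 1 / Suc n \<longrightarrow> W (fst z) (snd z) = 0"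
        by eventually_elim (use W_simps in \<open>auto simp: not_less a_def intro: antisym\<close>)
    qed
    then have 2: "AE z in M \<Otimes>\<^sub>M M. \<kappa> (fst z) (snd z) < l \<longrightarrow> W (fst z) (snd z) = 0"
    proof eventually_elim
      case (elim z)
      show ?case
      proof
        assume "\<kappa> (fst z) (snd z) < l"
        then obtain n where "1 / Suc n < l - \<kappa> (fst z) (snd z)"
          using nat_approx_posE[of "l - \<kappa> (fst z) (snd z)"] by auto
        then show "W (fst z) (snd z) = 0" using elim[rule_format, of n] by simp
      qed
    qed
    show ?thesis by (rule that[OF 1 2])
  qed
qed

text \<open>Averaging the kernel over the level set leaves the linear term unchanged, since
  \<open>\<kappa>\<close> is constant there, so the averaged kernel is a maximizer too. It has the
  constant value \<open>\<tau>\<close> on the level set, and a \<open>\<tau>\<close> strictly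
  between 0 and 1 makes that set null.\<close>

lemma level_set_constant:
  shows "(AE z in M \<Otimes>\<^sub>M M. \<kappa> (fst z) (snd z) = l \<longrightarrow> W (fst z) (snd z) = 0) \<or>
    (AE z in M \<Otimes>\<^sub>M M. \<kappa> (fst z) (snd z) = l \<longrightarrow> W (fst z) (snd z) = 1)"
proof -
  define L where "L = {z. \<kappa> (fst z) (snd z) = l}"
  have L[measurable]: "L \<in> sets (borel \<Otimes>\<^sub>M borel)" unfolding L_def by (rule sets_pair_Collect) measurable
  have Lsym: "(x, y) \<in> L \<longleftrightarrow> (y, x) \<in> L" for x y by (auto simp: L_def add.commute)
  define I where "I = (\<integral>z. indicator L z * W (fst z) (snd z) \<partial>(M \<Otimes>\<^sub>M M))"
  \<comment> \<open>For a null level set, division by zero gives \<open>\<tau> = 0\<close>, which is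
    covered by the first case below.\<close>
  define \<tau> where "\<tau> = I / P.prob L"
  have int: "integrable (M \<Otimes>\<^sub>M M) (\<lambda>z. indicator L z * W (fst z) (snd z))"
    by (rule P.integrable_const_bound[of _ 1])
      (use W_simps in \<open>auto simp: indicator_def abs_mult\<close>)
  have I0: "0 \<le> I" unfolding I_def using W_simps by (auto intro!: Bochner_Integration.integral_nonneg simp: indicator_def)
  have int1: "integrable (M \<Otimes>\<^sub>M M) (\<lambda>z. indicator L z :: real)"
    by (rule P.integrable_const_bound[of _ 1]) (auto simp: indicator_def)
  have intL: "(\<integral>z. indicator L z \<partial>(M \<Otimes>\<^sub>M M)) = P.prob L" by simp
  have I1: "I \<le> P.prob L" unfolding I_def intL[symmetric]
    by (intro integral_mono int int1) (use W_simps in \<open>auto simp: indicator_def\<close>)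
  have \<tau>01: "0 \<le> \<tau>" "\<tau> \<le> 1" using I0 I1 by (auto simp: \<tau>_def divide_le_eq_1)
  have I\<tau>: "I = \<tau> * P.prob L"
    using I0 I1 by (cases "P.prob L = 0") (auto simp: \<tau>_def)
  define \<eta> where "\<eta> = (\<lambda>x y. indicator L (x, y) * (\<tau> - W x y))"
  have [measurable]: "(\<lambda>(x, y). \<eta> x y) \<in> borel_measurable (borel \<Otimes>\<^sub>M borel)" unfolding \<eta>_def by measurable
  have sym: "\<eta> x y = \<eta> y x" for x y using Lsym[of x y] W_sym[of x y] by (simp add: \<eta>_def indicator_def)
  have range: "0 \<le> W x y + \<eta> x y" "W x y + \<eta> x y \<le> 1" for x y
    using \<tau>01 W_simps[of x y] by (auto simp: \<eta>_def indicator_def)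
  have "(\<integral>(x, y). \<eta> x y \<partial>(M \<Otimes>\<^sub>M M)) = (\<integral>z. \<tau> * indicator L z - indicator L z * W (fst z) (snd z) \<partial>(M \<Otimes>\<^sub>M M))"
    by (intro Bochner_Integration.integral_cong) (auto simp: \<eta>_def algebra_simps)
  also have "\<dots> = 0" using int int1 I\<tau> intL by (simp add: I_def)
  finally have zero: "(\<integral>(x, y). \<eta> x y \<partial>(M \<Otimes>\<^sub>M M)) = 0" .
  have "(\<integral>(x, y). \<kappa> x y * \<eta> x y \<partial>(M \<Otimes>\<^sub>M M)) = (\<integral>z. l * (case z of (x, y) \<Rightarrow> \<eta> x y) \<partial>(M \<Otimes>\<^sub>M M))"
    by (intro Bochner_Integration.integral_cong) (auto simp: \<eta>_def L_def indicator_def)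
  also have "\<dots> = 0" using zero by simp
  finally have "star_maximizer M (\<lambda>x y. W x y + \<eta> x y) k m"
    using sym range zero by (intro perturbation(3)) auto
  then interpret V: star_maximizer M "\<lambda>x y. W x y + \<eta> x y" k m .
  consider "\<tau> = 0" | "\<tau> = 1" | "0 < \<tau>" "\<tau> < 1" using \<tau>01 by linarith
  then show ?thesis
  proof cases
    case 1
    then have "(\<integral>z. indicator L z * W (fst z) (snd z) \<partial>(M \<Otimes>\<^sub>M M)) = 0" using I\<tau> by (simp add: I_def)
    then have "AE z in M \<Otimes>\<^sub>M M. indicator L z * W (fst z) (snd z) = 0"
      using W_simps by (subst (asm) integral_nonneg_eq_0_iff_AE[OF int]) auto
    then have "AE z in M \<Otimes>\<^sub>M M. \<kappa> (fst z) (snd z) = l \<longrightarrow> W (fst z) (snd z) = 0"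
      by eventually_elim (auto simp: L_def)
    then show ?thesis ..
  next
    case 2
    have "(\<integral>z. indicator L z - indicator L z * W (fst z) (snd z) \<partial>(M \<Otimes>\<^sub>M M)) = 0"
      using I\<tau> int int1 intL 2 by (simp add: I_def)
    moreover have "0 \<le> indicator L z - indicator L z * W (fst z) (snd z)" for z
      using W_simps by (simp add: indicator_def)
    ultimately have "AE z in M \<Otimes>\<^sub>M M. indicator L z - indicator L z * W (fst z) (snd z) = 0"
      by (subst (asm) integral_nonneg_eq_0_iff_AE[OF Bochner_Integration.integrable_diff[OF int1 int]]) auto
    then have "AE z in M \<Otimes>\<^sub>M M. \<kappa> (fst z) (snd z) = l \<longrightarrow> W (fst z) (snd z) = 1"
      by eventually_elim (auto simp: L_def)
    then show ?thesis ..
  next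
    case 3
    have "AE z in M \<Otimes>\<^sub>M M. z \<notin> L"
      by (rule V.fractional_level_null[OF L Lsym _ 3]) (simp add: \<eta>_def)
    then have "AE z in M \<Otimes>\<^sub>M M. \<kappa> (fst z) (snd z) = l \<longrightarrow> W (fst z) (snd z) = 0"
      by eventually_elim (auto simp: L_def)
    then show ?thesis ..
  qed
qed

text \<open>An upward closed \<open>J\<close> stands for the open or the closed ray, according to
  the value taken on the level set itself.\<close>

lemma threshold_form:
  obtains J where "J \<in> sets borel" "\<And>a b. a \<in> J \<Longrightarrow> a \<le> b \<Longrightarrow> b \<in> J"
    "AE z in M \<Otimes>\<^sub>M M. W (fst z) (snd z) = of_bool (\<kappa> (fst z) (snd z) \<in> J)"
proof -
  obtain l where l: "AE z in M \<Otimes>\<^sub>M M. l < \<kappa> (fst z) (snd z) \<longrightarrow> W (fst z) (snd z) = 1"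
    "AE z in M \<Otimes>\<^sub>M M. \<kappa> (fst z) (snd z) < l \<longrightarrow> W (fst z) (snd z) = 0"
    by (rule bathtub_level)
  from level_set_constant[of l] show thesis
  proof
    assume 0: "AE z in M \<Otimes>\<^sub>M M. \<kappa> (fst z) (snd z) = l \<longrightarrow> W (fst z) (snd z) = 0"
    from 0 l have "AE z in M \<Otimes>\<^sub>M M. W (fst z) (snd z) = of_bool (\<kappa> (fst z) (snd z) \<in> {l<..})"
      by eventually_elim (auto simp: not_less le_less)
    then show thesis by (intro that[of "{l<..}"]) auto
  next
    assume 1: "AE z in M \<Otimes>\<^sub>M M. \<kappa> (fst z) (snd z) = l \<longrightarrow> W (fst z) (snd z) = 1"
    from 1 l have "AE z in M \<Otimes>\<^sub>M M. W (fst z) (snd z) = of_bool (\<kappa> (fst z) (snd z) \<in> {l..})"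
      by eventually_elim (auto simp: not_le le_less)
    then show thesis by (intro that[of "{l..}"]) auto
  qed
qed

section \<open>Weight changes inside a homogeneous class\<close>

text \<open>Under the density \<open>1 + s * h\<close> the degrees become
  \<open>d + s * \<eta>\<close>. The edge density is kept: the integral of \<open>\<eta>\<close>
  equals that of \<open>h * d\<close> by symmetry, and \<open>h * \<eta> = 0\<close> because
  \<open>\<eta>\<close> vanishes on \<open>S\<close>. Adding the gains for \<open>s = 1\<close> and
  \<open>s = -1\<close> leaves an integral of tangent gaps, which maximality forces to be 0.\<close>

lemma reweighting:
  assumes [measurable]: "h \<in> borel_measurable borel" "S \<in> sets borel"
    and h: "\<And>x. \<bar>h x\<bar> \<le> 1" "\<And>x. x \<notin> S \<Longrightarrow> h x = 0"
    and S: "\<And>x y. x \<in> S \<Longrightarrow> y \<in> S \<Longrightarrow> W x y = v"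
    and zero: "(\<integral>x. h x \<partial>M) = 0" "(\<integral>x. h x * d x \<partial>M) = 0"
  shows "AE x in M. (\<integral>y. W x y * h y \<partial>M) = 0"
proof -
  define \<eta> where "\<eta> x = (\<integral>y. W x y * h y \<partial>M)" for x
  have [measurable]: "\<eta> \<in> borel_measurable borel" unfolding \<eta>_def by measurable
  have Wh: "\<bar>W x y * h y\<bar> \<le> 1" for x y
    using W_simps[of x y] h(1)[of y] by (simp add: abs_mult mult_le_one)
  have \<eta>1: "\<bar>\<eta> x\<bar> \<le> 1" for x
    unfolding \<eta>_def using abs_deg_le[of "\<lambda>x y. W x y * h y" 1] Wh by (simp add: deg_def)
  have \<eta>S: "\<eta> x = 0" if "x \<in> S" for x
  proof -
    have "\<eta> x = (\<integral>y. v * h y \<partial>M)" unfolding \<eta>_def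
      using S[OF that] h(2) by (intro Bochner_Integration.integral_cong refl) (metis mult_zero_right)
    then show ?thesis using zero by simp
  qed
  have int_\<eta>: "(\<integral>x. \<eta> x \<partial>M) = 0"
  proof -
    have "(\<integral>x. \<eta> x \<partial>M) = (\<integral>(x, y). W x y * h y \<partial>(M \<Otimes>\<^sub>M M))"
      using integral_deg[of "\<lambda>x y. W x y * h y" 1] Wh by (simp add: \<eta>_def deg_def)
    also have "\<dots> = (\<integral>(x, y). W y x * h x \<partial>(M \<Otimes>\<^sub>M M))"
      by (rule integral_pair_swap[symmetric]) measurable
    also have "\<dots> = (\<integral>(x, y). h x * W x y \<partial>(M \<Otimes>\<^sub>M M))" using W_sym by (simp add: mult.commute)
    also have "\<dots> = (\<integral>x. h x * d x \<partial>M)"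
      by (rule integral_mult_deg[symmetric, OF W_measurable _ W_simps(3) h(1)]) measurable
    finally show ?thesis using zero by simp
  qed
  have step: "(\<integral>x. (1 + s * h x) * (d x + s * \<eta> x) ^ k \<partial>M) \<le> star k M W \<and> (\<forall>x. 0 \<le> d x + s * \<eta> x)"
    if s: "s = 1 \<or> s = -1" for s :: real
  proof -
    define N where "N = density M (\<lambda>x. ennreal (1 + s * h x))"
    have pos: "0 \<le> 1 + s * h x" "1 + s * h x \<le> 2" for x using h(1)[of x] s by (auto simp: abs_le_iff)
    have hint: "integrable M h" by (rule integrable_bounded[OF _ h(1)]) measurable
    have "emeasure N (space N) = (\<integral>\<^sup>+x. ennreal (1 + s * h x) \<partial>M)"
      unfolding N_def by (subst emeasure_density) auto
    also have "\<dots> = ennreal (\<integral>x. 1 + s * h x \<partial>M)"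
      using pos hint by (intro nn_integral_eq_integral) auto
    also have "(\<integral>x. 1 + s * h x \<partial>M) = 1" using hint zero by simp
    finally have "prob_space N" by (intro prob_spaceI) simp
    moreover have "sets N = sets borel" by (simp add: N_def)
    ultimately have N: "real_distribution N" by (simp add: real_distribution_def real_distribution_axioms_def)
    have integral_N: "(\<integral>x. f x \<partial>N) = (\<integral>x. (1 + s * h x) * f x \<partial>M)" if [measurable]: "f \<in> borel_measurable borel" for f :: "real \<Rightarrow> real"
      unfolding N_def using pos by (subst integral_density) auto
    have dN: "deg N W x = d x + s * \<eta> x" for x
    proof -
      have iW: "integrable M (\<lambda>y. W x y)" by (rule integrable_bounded[OF _ W_simps(3)]) measurable
      have iWh: "integrable M (\<lambda>y. W x y * h y)" by (rule integrable_bounded[OF _ Wh]) measurable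
      have "deg N W x = (\<integral>y. W x y + s * (W x y * h y) \<partial>M)"
        unfolding deg_def by (subst integral_N) (auto simp: algebra_simps)
      then show ?thesis using iW iWh by (simp add: \<eta>_def deg_def)
    qed
    interpret N: real_distribution N by (rule N)
    have "edge N W = (\<integral>x. d x + s * \<eta> x + s * (h x * d x) \<partial>M)"
    proof -
      have "h x * \<eta> x = 0" for x using \<eta>S[of x] h(2)[of x] by auto
      then have "(1 + s * h x) * (d x + s * \<eta> x) = d x + s * \<eta> x + s * (h x * d x)" for x
        by (simp add: algebra_simps)
      then show ?thesis unfolding star_def dN power_one_right by (subst integral_N) auto
    qed
    also have "\<dots> = edge M W"
    proof -
      have "integrable M d" by (rule integrable_bounded[OF _ d_bounds(3)]) measurable
      moreover have "integrable M \<eta>" by (rule integrable_bounded[OF _ \<eta>1]) measurable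
      moreover have "integrable M (\<lambda>x. h x * d x)"
        using h(1) d_bounds by (intro integrable_bounded[where C=1]) (auto simp: abs_mult mult_le_one)
      ultimately show ?thesis using zero int_\<eta> by (simp add: star_def)
    qed
    finally have "star k N W \<le> star k M W" using maximal[OF N kernel] by simp
    moreover have "star k N W = (\<integral>x. (1 + s * h x) * (d x + s * \<eta> x) ^ k \<partial>M)"
      unfolding star_def dN by (subst integral_N) auto
    ultimately show ?thesis using N.deg_kernel(1)[OF kernel] dN by simp
  qed
  from step[of 1] step[of "-1"]
  have le: "(\<integral>x. (1 + h x) * (d x + \<eta> x) ^ k \<partial>M) \<le> star k M W" "(\<integral>x. (1 - h x) * (d x - \<eta> x) ^ k \<partial>M) \<le> star k M W"
    and nn: "0 \<le> d x + \<eta> x" "0 \<le> d x - \<eta> x" for x by auto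
  have pw: "(d x + \<eta> x) ^ k \<le> 2 ^ k" "(d x - \<eta> x) ^ k \<le> 2 ^ k" "d x ^ k \<le> 1" for x
    using nn[of x] \<eta>1[of x] d_bounds[of x] by (auto intro!: power_mono power_le_one simp: abs_le_iff)
  have hb: "\<bar>1 + h x\<bar> \<le> 2" "\<bar>1 - h x\<bar> \<le> 2" for x using h(1)[of x] by auto
  have pw': "\<bar>(d x + \<eta> x) ^ k\<bar> \<le> 2 ^ k" "\<bar>(d x - \<eta> x) ^ k\<bar> \<le> 2 ^ k" for x
    using pw[of x] nn[of x] by auto
  have int: "integrable M (\<lambda>x. (1 + h x) * (d x + \<eta> x) ^ k)"
    by (rule integrable_bounded[where C="2 * 2 ^ k"], measurable, unfold abs_mult, intro mult_mono hb pw') auto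
  have int2: "integrable M (\<lambda>x. (1 - h x) * (d x - \<eta> x) ^ k)"
    by (rule integrable_bounded[where C="2 * 2 ^ k"], measurable, unfold abs_mult, intro mult_mono hb pw') auto
  have int': "integrable M (\<lambda>x. d x ^ k)"
    by (rule integrable_bounded[where C=1]) (use pw d_bounds in \<open>auto simp: power_abs\<close>)
  define g where "g x = (1 + h x) * (d x + \<eta> x) ^ k + (1 - h x) * (d x - \<eta> x) ^ k - 2 * d x ^ k" for x
  define t where "t x e = (d x + e) ^ Suc m - d x ^ Suc m - Suc m * d x ^ m * ((d x + e) - d x)" for x e
  \<comment> \<open>On \<open>S\<close> the terms in \<open>h\<close> cancel since
    \<open>\<eta> = 0\<close>; off \<open>S\<close>, \<open>h = 0\<close> and the linear parts of
    the two gaps cancel.\<close>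
  have gt: "g x = t x (\<eta> x) + t x (- \<eta> x)" for x
    using \<eta>S[of x] h(2)[of x] by (cases "x \<in> S") (auto simp: g_def t_def k distrib_right left_diff_distrib)
  have t0: "0 \<le> t x (\<eta> x)" "0 \<le> t x (- \<eta> x)" for x
    unfolding t_def using nn[of x] d_bounds(1)[of x] by (intro power_tangent_nonneg(1); simp)+
  have intg: "integrable M g" unfolding g_def using int int2 int' by auto
  have "integral\<^sup>L M g \<le> 0" unfolding g_def using int int2 int' le by (simp add: star_def)
  moreover have g0: "0 \<le> g x" for x using gt t0 by simp
  ultimately have "integral\<^sup>L M g = 0" by (simp add: antisym)
  then have "AE x in M. g x = 0" using integral_nonneg_eq_0_iff_AE[OF intg] g0 by simp
  then have "AE x in M. \<eta> x = 0"
  proof eventually_elim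
    case (elim x)
    then have "t x (\<eta> x) = 0" using gt[of x] t0[of x] by simp
    then show ?case unfolding t_def using power_tangent_nonneg(2)[of "d x" "d x + \<eta> x" m] nn[of x] d_bounds(1)[of x] m
      by simp
  qed
  then show ?thesis by (simp add: \<eta>_def)
qed

end

text \<open>Every point of \<open>S\<close> is an essential minimum or an essential maximum of
  \<open>f\<close> on \<open>S\<close>. The essential minima share almost everywhere one value,
  their supremum: points approaching it show that \<open>f\<close> is almost nowhere below it. The
  maxima are symmetric.\<close>

lemma (in finite_measure) AE_two_valued:
  fixes f :: "'a \<Rightarrow> real"
  assumes [measurable]: "f \<in> borel_measurable M"
    and S: "bdd_above (f ` S)" "bdd_below (f ` S)"
    and dich: "\<And>r. r \<in> S \<Longrightarrow> (AE y in M. y \<in> S \<longrightarrow> f r \<le> f y) \<or> (AE y in M. y \<in> S \<longrightarrow> f y \<le> f r)"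
  shows "\<exists>p q. AE y in M. y \<in> S \<longrightarrow> f y = p \<or> f y = q"
proof -
  define L where "L = {r \<in> S. AE y in M. y \<in> S \<longrightarrow> f r \<le> f y}"
  define H where "H = {r \<in> S. AE y in M. y \<in> S \<longrightarrow> f y \<le> f r}"
  have LH: "S \<subseteq> L \<union> H" using dich by (auto simp: L_def H_def)
  have "\<exists>p. AE y in M. y \<in> L \<longrightarrow> f y = p"
  proof (cases "L = {}")
    case False
    define p where "p = Sup (f ` L)"
    have bdd: "bdd_above (f ` L)" by (rule bdd_above_mono[OF S(1)]) (auto simp: L_def)
    have "AE y in M. \<forall>n::nat. y \<in> S \<longrightarrow> p - 1 / Suc n \<le> f y"
      unfolding AE_all_countable
    proof
      fix n :: nat
      obtain r where r: "r \<in> L" "p - 1 / Suc n < f r"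
        using less_cSup_iff[OF _ bdd, of "p - 1 / Suc n"] False by (auto simp: p_def)
      then have "AE y in M. y \<in> S \<longrightarrow> f r \<le> f y" by (simp add: L_def)
      then show "AE y in M. y \<in> S \<longrightarrow> p - 1 / Suc n \<le> f y"
        using r(2) by (auto elim!: eventually_mono)
    qed
    then have "AE y in M. y \<in> L \<longrightarrow> f y = p"
    proof eventually_elim
      case (elim y)
      show ?case
      proof
        assume y: "y \<in> L"
        have "f y \<le> p" unfolding p_def using y bdd by (auto intro: cSup_upper)
        moreover have "\<not> f y < p"
        proof
          assume "f y < p"
          then obtain n where "1 / Suc n < p - f y" using nat_approx_posE[of "p - f y"] by auto
          then show False using elim[rule_format, of n] y by (simp add: L_def)
        qed
        ultimately show "f y = p" by simp
      qed
    qed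
    then show ?thesis ..
  qed simp
  then obtain p where p: "AE y in M. y \<in> L \<longrightarrow> f y = p" ..
  have "\<exists>q. AE y in M. y \<in> H \<longrightarrow> f y = q"
  proof (cases "H = {}")
    case False
    define p where "p = Inf (f ` H)"
    have bdd: "bdd_below (f ` H)" by (rule bdd_below_mono[OF S(2)]) (auto simp: H_def)
    have "AE y in M. \<forall>n::nat. y \<in> S \<longrightarrow> f y \<le> p + 1 / Suc n"
      unfolding AE_all_countable
    proof
      fix n :: nat
      obtain r where r: "r \<in> H" "f r < p + 1 / Suc n"
        using cInf_less_iff[OF _ bdd, of "p + 1 / Suc n"] False by (auto simp: p_def)
      then have "AE y in M. y \<in> S \<longrightarrow> f y \<le> f r" by (simp add: H_def)
      then show "AE y in M. y \<in> S \<longrightarrow> f y \<le> p + 1 / Suc n"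
        using r(2) by (auto elim!: eventually_mono)
    qed
    then have "AE y in M. y \<in> H \<longrightarrow> f y = p"
    proof eventually_elim
      case (elim y)
      show ?case
      proof
        assume y: "y \<in> H"
        have "p \<le> f y" unfolding p_def using y bdd by (auto intro: cInf_lower)
        moreover have "\<not> p < f y"
        proof
          assume "p < f y"
          then obtain n where "1 / Suc n < f y - p" using nat_approx_posE[of "f y - p"] by auto
          then show False using elim[rule_format, of n] y by (simp add: H_def)
        qed
        ultimately show "f y = p" by simp
      qed
    qed
    then show ?thesis ..
  qed simp
  then obtain q where q: "AE y in M. y \<in> H \<longrightarrow> f y = q" ..
  have "AE y in M. y \<in> S \<longrightarrow> f y = p \<or> f y = q"
    using p q by eventually_elim (use LH in auto)
  then show ?thesis by blast
qed

text \<open>If \<open>f\<close> lies both below and above \<open>f r\<close> on non-null parts of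
  \<open>S\<close>, the affine identity reads \<open>f y = a + b * f y\<close> below and
  \<open>f r = a + b * f y\<close> above. Since both occur, \<open>b\<close> is neither 1 nor 0, and
  each equation has a single solution. Otherwise each point is an essential extremum.\<close>

lemma (in finite_measure) AE_two_valued_if_min_affine:
  fixes f :: "'a \<Rightarrow> real"
  assumes [measurable]: "f \<in> borel_measurable M" and bd: "\<And>x. 0 \<le> f x" "\<And>x. f x \<le> 1"
    and affine: "\<And>r. \<exists>a b. AE y in M. y \<in> S \<longrightarrow> min (f y) (f r) = a + b * f y"
  shows "\<exists>p q. AE y in M. y \<in> S \<longrightarrow> f y = p \<or> f y = q"
proof (cases "\<forall>r\<in>S. (AE y in M. y \<in> S \<longrightarrow> f r \<le> f y) \<or> (AE y in M. y \<in> S \<longrightarrow> f y \<le> f r)")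
  case True
  then show ?thesis using bd by (intro AE_two_valued) (auto intro!: bdd_aboveI[of _ 1] bdd_belowI[of _ 0])
next
  case False
  then obtain r where r: "r \<in> S" "\<not> (AE y in M. y \<in> S \<longrightarrow> f r \<le> f y)" "\<not> (AE y in M. y \<in> S \<longrightarrow> f y \<le> f r)"
    by blast
  obtain a b where ab: "AE y in M. y \<in> S \<longrightarrow> min (f y) (f r) = a + b * f y" using affine by blast
  have lo: "\<exists>y\<in>S. f y < f r \<and> f y = a + b * f y"
  proof (rule ccontr)
    assume n: "\<not> ?thesis"
    have "AE y in M. y \<in> S \<longrightarrow> f r \<le> f y" using ab
      by eventually_elim (use n in \<open>auto simp: min_def not_less split: if_splits\<close>)
    then show False using r by simp
  qed
  have hi: "\<exists>y\<in>S. f r < f y \<and> f r = a + b * f y"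
  proof (rule ccontr)
    assume n: "\<not> ?thesis"
    have "AE y in M. y \<in> S \<longrightarrow> f y \<le> f r" using ab
      by eventually_elim (use n in \<open>auto simp: min_def not_less split: if_splits\<close>)
    then show False using r by simp
  qed
  from lo hi obtain y z where y: "f y < f r" "f y = a + b * f y" and z: "f r < f z" "f r = a + b * f z"
    by blast
  have b1: "b \<noteq> 1"
  proof
    assume "b = 1" then show False using y z by simp
  qed
  have b0: "b \<noteq> 0"
  proof
    assume "b = 0" then show False using y z by simp
  qed
  have "AE w in M. w \<in> S \<longrightarrow> f w = a / (1 - b) \<or> f w = (f r - a) / b"
    using ab by eventually_elim (use b0 b1 in \<open>auto simp: min_def field_simps split: if_splits\<close>)
  then show ?thesis by blast
qed

text \<open>The threshold form holds at every point, which makes neighbourhoods exactly nested. For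
  that, \<open>W\<close> may have been altered on a null set, so \<open>\<delta>\<close> agrees with
  the degree of \<open>W\<close> only almost everywhere.\<close>

locale threshold_maximizer = star_maximizer +
  fixes \<delta> :: "real \<Rightarrow> real" and J :: "real set"
  assumes \<delta>_measurable [measurable]: "\<delta> \<in> borel_measurable borel"
    and \<delta>_nonneg: "0 \<le> \<delta> x"
    and J_measurable [measurable]: "J \<in> sets borel"
    and J_up: "a \<in> J \<Longrightarrow> a \<le> b \<Longrightarrow> b \<in> J"
    and W_threshold: "W x y = of_bool (\<delta> x ^ m + \<delta> y ^ m \<in> J)"
    and \<delta>_deg: "AE x in M. d x = \<delta> x"
begin

lemma W_mono: "\<delta> x \<le> \<delta> y \<Longrightarrow> W z x \<le> W z y"
  using J_up[of "\<delta> z ^ m + \<delta> x ^ m" "\<delta> z ^ m + \<delta> y ^ m"] power_mono[of "\<delta> x" "\<delta> y" m] \<delta>_nonneg[of x]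
  by (auto simp: W_threshold)

lemma codegree_eq_min: "(\<integral>z. W x z * W z r \<partial>M) = min (d x) (d r)"
proof -
  have int: "integrable M (\<lambda>y. W x y)" for x by (rule integrable_bounded[OF _ W_simps(3)]) measurable
  have *: "(\<integral>z. W x z * W r z \<partial>M) = d x \<and> d x \<le> d r" if "\<delta> x \<le> \<delta> r" for x r
  proof -
    have le: "W x z \<le> W r z" for z using W_mono[OF that, of z] W_sym by simp
    then have e: "W x z * W r z = W x z" for z
      using W_threshold[of x z] W_threshold[of r z] le[of z] by (auto split: if_splits)
    have "d x \<le> d r" unfolding deg_def by (intro integral_mono int le)
    then show ?thesis unfolding e by (simp add: deg_def)
  qed
  have "(\<integral>z. W x z * W z r \<partial>M) = (\<integral>z. W x z * W r z \<partial>M)" using W_sym by simp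
  also have "\<dots> = min (d x) (d r)"
  proof (cases "\<delta> x \<le> \<delta> r")
    case False
    then show ?thesis using *[of r x] by (simp add: mult.commute min_def)
  qed (use * in \<open>simp add: min_def\<close>)
  finally show ?thesis .
qed

text \<open>The function \<open>w\<close> is the residual of \<open>u\<close> after projection to
  the span of 1 and \<open>d\<close> in L2 over \<open>S\<close>, so a multiple \<open>h\<close> of
  it meets the conditions of \<open>reweighting\<close>. Integrating the resulting identity against
  \<open>W x r\<close> and using \<open>codegree_eq_min\<close> shows that \<open>w\<close> is
  orthogonal to \<open>u\<close> too, hence to itself.\<close>

lemma min_degree_affine:
  assumes [measurable]: "S \<in> sets borel" and S: "\<And>x y. x \<in> S \<Longrightarrow> y \<in> S \<Longrightarrow> W x y = v"
  shows "\<exists>a b. AE y in M. y \<in> S \<longrightarrow> min (d y) (d r) = a + b * d y"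
proof -
  define u where "u y = min (d y) (d r)" for y
  have [measurable]: "u \<in> borel_measurable borel" unfolding u_def by measurable
  have u1: "0 \<le> u y" "u y \<le> 1" for y using d_bounds[of y] d_bounds[of r] by (auto simp: u_def)
  define I where "I f = (\<integral>y. indicator S y * f y \<partial>M)" for f :: "real \<Rightarrow> real"
  have intI: "integrable M (\<lambda>y. indicator S y * f y)"
    if "f \<in> borel_measurable borel" "\<And>y. \<bar>f y\<bar> \<le> B" for f :: "real \<Rightarrow> real" and B :: real
    using that order_trans[OF abs_ge_zero that(2)] by (intro integrable_bounded[where C=B]) (auto simp: indicator_def)
  have dm: "d \<in> borel_measurable borel" by measurable
  have i1: "integrable M (\<lambda>y. indicator S y * (1::real))" by (rule intI[of _ 1]) auto
  have id: "integrable M (\<lambda>y. indicator S y * d y)" by (rule intI[OF dm d_bounds(3)])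
  have idd: "integrable M (\<lambda>y. indicator S y * (d y * d y))" using d_bounds by (intro intI[of _ 1]) (auto simp: mult_le_one)
  have iu: "integrable M (\<lambda>y. indicator S y * u y)" using u1 by (intro intI[of _ 1]) auto
  have iud: "integrable M (\<lambda>y. indicator S y * (u y * d y))" using u1 d_bounds by (intro intI[of _ 1]) (auto simp: mult_le_one abs_mult)
  define s0 s1 s2 where "s0 = I (\<lambda>_. 1)" and "s1 = I d" and "s2 = I (\<lambda>y. d y * d y)"
  define t0 t1 where "t0 = I u" and "t1 = I (\<lambda>y. u y * d y)"
  \<comment> \<open>The Gram determinant of 1 and \<open>d\<close> on \<open>S\<close>; if it
    vanishes, \<open>d\<close> is almost everywhere constant on \<open>S\<close> or \<open>S\<close>
    is null.\<close>
  define G where "G = s0 * s2 - s1 * s1"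
  show ?thesis
  proof (cases "G = 0")
    case True
    define g where "g y = s0 * s0 * (indicator S y * (d y * d y)) - 2 * s0 * s1 * (indicator S y * d y) + s1 * s1 * (indicator S y * 1)" for y
    have gs: "g y = indicator S y * (s0 * d y - s1)\<^sup>2" for y
      by (auto simp: g_def indicator_def power2_eq_square algebra_simps)
    have ig: "integrable M g" unfolding g_def using i1 id idd by auto
    have "integral\<^sup>L M g = s0 * s0 * s2 - 2 * s0 * s1 * s1 + s1 * s1 * s0"
      unfolding g_def using i1 id idd by (simp add: s0_def s1_def s2_def I_def)
    also have "\<dots> = s0 * G" by (simp add: G_def algebra_simps)
    finally have "AE y in M. g y = 0"
      using True by (subst integral_nonneg_eq_0_iff_AE[OF ig, symmetric]) (auto simp: gs)
    then have c: "AE y in M. y \<in> S \<longrightarrow> s0 * d y = s1" by eventually_elim (auto simp: gs)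
    show ?thesis
    proof (cases "s0 = 0")
      case True
      then have "AE y in M. indicator S y * (1::real) = 0"
        unfolding s0_def I_def by (subst integral_nonneg_eq_0_iff_AE[OF i1, symmetric]) auto
      then have "AE y in M. y \<notin> S" by eventually_elim auto
      then have "AE y in M. y \<in> S \<longrightarrow> min (d y) (d r) = 0 + 0 * d y" by eventually_elim auto
      then show ?thesis by blast
    next
      case False
      have "AE y in M. y \<in> S \<longrightarrow> min (d y) (d r) = min (s1 / s0) (d r) + 0 * d y"
        using c by eventually_elim (use \<open>s0 \<noteq> 0\<close> in \<open>auto simp: field_simps\<close>)
      then show ?thesis by blast
    qed
  next
    case False
    \<comment> \<open>Cramer's rule for the normal equations of the projection.\<close>
    define b where "b = (s0 * t1 - s1 * t0) / G"
    define a where "a = (s2 * t0 - s1 * t1) / G"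
    have ab: "a * s0 + b * s1 = t0" "a * s1 + b * s2 = t1"
    proof -
      have aG: "a * G = s2 * t0 - s1 * t1" and bG: "b * G = s0 * t1 - s1 * t0"
        using False by (simp_all add: a_def b_def)
      have "(a * s0 + b * s1) * G = (s2 * t0 - s1 * t1) * s0 + (s0 * t1 - s1 * t0) * s1"
        "(a * s1 + b * s2) * G = (s2 * t0 - s1 * t1) * s1 + (s0 * t1 - s1 * t0) * s2"
        unfolding aG[symmetric] bG[symmetric] by (simp_all add: algebra_simps)
      moreover have "(s2 * t0 - s1 * t1) * s0 + (s0 * t1 - s1 * t0) * s1 = t0 * G"
        "(s2 * t0 - s1 * t1) * s1 + (s0 * t1 - s1 * t0) * s2 = t1 * G"
        by (simp_all add: G_def algebra_simps)
      ultimately have "(a * s0 + b * s1) * G = t0 * G" "(a * s1 + b * s2) * G = t1 * G" by simp_all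
      then show "a * s0 + b * s1 = t0" "a * s1 + b * s2 = t1" using False by simp_all
    qed
    define C where "C = 1 + \<bar>a\<bar> + \<bar>b\<bar>"
    have C: "0 < C" by (simp add: C_def)
    define w where "w y = u y - a - b * d y" for y
    have wC: "\<bar>w y\<bar> \<le> C" for y
    proof -
      have "\<bar>b * d y\<bar> \<le> \<bar>b\<bar> * 1" unfolding abs_mult using d_bounds[of y] by (intro mult_left_mono) auto
      then show ?thesis using u1[of y] unfolding w_def C_def by linarith
    qed
    have [measurable]: "w \<in> borel_measurable borel" unfolding w_def by measurable
    have Iw: "I w = 0"
    proof -
      have "I w = (\<integral>y. indicator S y * u y - a * (indicator S y * 1) - b * (indicator S y * d y) \<partial>M)"
        unfolding I_def w_def by (intro Bochner_Integration.integral_cong) (auto simp: algebra_simps)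
      also have "\<dots> = t0 - a * s0 - b * s1"
        using iu i1 id by (simp add: t0_def s0_def s1_def I_def)
      finally show ?thesis using ab by simp
    qed
    have Iwd: "I (\<lambda>y. w y * d y) = 0"
    proof -
      have "I (\<lambda>y. w y * d y) = (\<integral>y. indicator S y * (u y * d y) - a * (indicator S y * d y) - b * (indicator S y * (d y * d y)) \<partial>M)"
        unfolding I_def w_def by (intro Bochner_Integration.integral_cong) (auto simp: algebra_simps)
      also have "\<dots> = t1 - a * s1 - b * s2"
        using iud id idd by (simp add: t1_def s1_def s2_def I_def)
      finally show ?thesis using ab by simp
    qed
    define h where "h y = indicator S y * w y / C" for y
    have [measurable]: "h \<in> borel_measurable borel" unfolding h_def by measurable
    have h1: "\<bar>h y\<bar> \<le> 1" for y using wC[of y] C by (auto simp: h_def indicator_def field_simps)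
    have AE0: "AE x in M. (\<integral>y. W x y * h y \<partial>M) = 0"
    proof (rule reweighting[where S=S and v=v])
      show "(\<integral>x. h x \<partial>M) = 0" using Iw by (simp add: h_def I_def)
      have "(\<integral>x. h x * d x \<partial>M) = I (\<lambda>y. w y * d y) / C"
        unfolding h_def I_def by (subst integral_divide_zero[symmetric]) (auto intro!: Bochner_Integration.integral_cong)
      then show "(\<integral>x. h x * d x \<partial>M) = 0" using Iwd by simp
    qed (use h1 S in \<open>auto simp: h_def\<close>)
    have "(\<integral>x. h x * u x \<partial>M) = 0"
    proof -
      have b1: "\<bar>W x y * W y r\<bar> \<le> 1" "\<bar>W x y * h y\<bar> \<le> 1" for x y
        using W_simps[of x y] W_simps[of y r] h1[of y] by (auto simp: abs_mult intro: mult_le_one)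
      have "(\<integral>x. h x * u x \<partial>M) = (\<integral>x. h x * deg M (\<lambda>x y. W x y * W y r) x \<partial>M)"
        using codegree_eq_min by (simp add: deg_def u_def)
      also have "\<dots> = (\<integral>(x, y). h x * (W x y * W y r) \<partial>(M \<Otimes>\<^sub>M M))"
        by (rule integral_mult_deg[OF _ _ b1(1) h1]) measurable
      also have "\<dots> = (\<integral>(x, y). h y * (W y x * W x r) \<partial>(M \<Otimes>\<^sub>M M))"
        by (rule integral_pair_swap[symmetric]) measurable
      also have "\<dots> = (\<integral>(x, y). W x r * (W x y * h y) \<partial>(M \<Otimes>\<^sub>M M))"
        using W_sym by (simp add: mult_ac)
      also have "\<dots> = (\<integral>x. W x r * deg M (\<lambda>x y. W x y * h y) x \<partial>M)"
        by (rule integral_mult_deg[OF _ _ b1(2) W_simps(3), symmetric]) measurable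
      also have "\<dots> = (\<integral>x. 0 \<partial>M)"
        using AE0 by (intro integral_cong_AE) (auto simp: deg_def elim!: eventually_mono)
      finally show ?thesis by simp
    qed
    then have Iwu: "I (\<lambda>y. w y * u y) = 0"
    proof -
      have "(\<integral>x. h x * u x \<partial>M) = I (\<lambda>y. w y * u y) / C"
        unfolding h_def I_def by (subst integral_divide_zero[symmetric]) (auto intro!: Bochner_Integration.integral_cong)
      then show ?thesis using \<open>(\<integral>x. h x * u x \<partial>M) = 0\<close> C by simp
    qed
    have iw: "integrable M (\<lambda>y. indicator S y * w y)" by (rule intI[OF _ wC]) measurable
    have iwd: "integrable M (\<lambda>y. indicator S y * (w y * d y))"
      by (rule intI[of _ "C * 1"], measurable, unfold abs_mult, intro mult_mono wC d_bounds(3)) (use C in auto)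
    have iwu: "integrable M (\<lambda>y. indicator S y * (w y * u y))"
      by (rule intI[of _ "C * 1"], measurable, unfold abs_mult, intro mult_mono wC) (use C u1 in auto)
    have sq: "indicator S y * (w y * u y) - a * (indicator S y * w y) - b * (indicator S y * (w y * d y)) = indicator S y * (w y)\<^sup>2" for y
      by (simp add: w_def power2_eq_square algebra_simps)
    have "integrable M (\<lambda>y. indicator S y * (w y * u y) - a * (indicator S y * w y) - b * (indicator S y * (w y * d y)))"
      using iw iwd iwu by auto
    moreover have "(\<integral>y. indicator S y * (w y * u y) - a * (indicator S y * w y) - b * (indicator S y * (w y * d y)) \<partial>M) = 0"
      using iw iwd iwu Iw Iwd Iwu by (simp add: I_def)
    ultimately have "AE y in M. indicator S y * (w y)\<^sup>2 = 0"
      unfolding sq by (subst (asm) integral_nonneg_eq_0_iff_AE) auto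
    then have "AE y in M. y \<in> S \<longrightarrow> min (d y) (d r) = a + b * d y"
      by eventually_elim (auto simp: w_def u_def)
    then show ?thesis by blast
  qed
qed

lemma two_valued:
  assumes "S \<in> sets borel" "\<And>x y. x \<in> S \<Longrightarrow> y \<in> S \<Longrightarrow> W x y = v"
  obtains p q where "0 \<le> q" "q \<le> p" "AE y in M. y \<in> S \<longrightarrow> \<delta> y = p \<or> \<delta> y = q"
proof -
  have "\<exists>p q. AE y in M. y \<in> S \<longrightarrow> d y = p \<or> d y = q"
    using min_degree_affine[OF assms] d_bounds by (intro AE_two_valued_if_min_affine) auto
  then obtain p q where "AE y in M. y \<in> S \<longrightarrow> d y = p \<or> d y = q" by blast
  \<comment> \<open>Values that are attained only on a null set could be negative. Clipping at 0 is
    harmless as \<open>\<delta>\<close> is nonnegative, and monotonicity of powers needs it.\<close>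
  then have "AE y in M. y \<in> S \<longrightarrow> \<delta> y = max (max 0 p) (max 0 q) \<or> \<delta> y = min (max 0 p) (max 0 q)"
    using \<delta>_deg by eventually_elim (use \<delta>_nonneg in \<open>auto simp: max_def min_def\<close>)
  then show thesis by (intro that[of "min (max 0 p) (max 0 q)" "max (max 0 p) (max 0 q)"]) auto
qed

end

section \<open>Four-vertex threshold graphs\<close>

text \<open>
  Four vertex classes of masses \<open>\<mu> 0, \<dots>, \<mu> 3\<close>, with \<open>a\<close> adjacent to \<open>b\<close> iff \<open>a + b \<le> s\<close>. For \<open>s \<in> {2, 3}\<close>
  the classes 0, 1 form a clique and 2, 3 an independent set; all threshold graphs with two classes on either
  side arise in this way after merging classes.
\<close>

definition block_star :: "nat \<Rightarrow> (nat \<Rightarrow> real) \<Rightarrow> nat \<Rightarrow> real" where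
  "block_star s \<mu> j = (\<Sum>a<4. \<mu> a * (\<Sum>b<4. \<mu> b * of_bool (a + b \<le> s)) ^ j)"

lemma block_star_3:
  "block_star 3 \<mu> j = \<mu> 0 * (\<mu> 0 + \<mu> 1 + \<mu> 2 + \<mu> 3) ^ j + \<mu> 1 * (\<mu> 0 + \<mu> 1 + \<mu> 2) ^ j
     + \<mu> 2 * (\<mu> 0 + \<mu> 1) ^ j + \<mu> 3 * \<mu> 0 ^ j"
  by (simp add: block_star_def eval_nat_numeral)

text \<open>Class 3 is isolated; for \<open>1 \<le> j\<close> its term contains
  \<open>0 ^ j = 0\<close>.\<close>

lemma block_star_2:
  "1 \<le> j \<Longrightarrow> block_star 2 \<mu> j = \<mu> 0 * (\<mu> 0 + \<mu> 1 + \<mu> 2) ^ j + \<mu> 1 * (\<mu> 0 + \<mu> 1) ^ j + \<mu> 2 * \<mu> 0 ^ j"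
  by (simp add: block_star_def eval_nat_numeral)

lemma block_star_realized:
  assumes \<mu>: "\<And>a. a < 4 \<Longrightarrow> 0 \<le> \<mu> a" "(\<Sum>a<4. \<mu> a) = 1"
  obtains N V where "real_distribution N" "kernel V" "\<And>j. star j N V = block_star s \<mu> j"
proof -
  let ?P = "point_measure {..<4::nat} (\<lambda>a. ennreal (\<mu> a))"
  interpret P: prob_space ?P
    by (rule prob_space_point_measure) (use \<mu> sum_ennreal[of "{..<4}" \<mu>] in auto)
  define N where "N = distr ?P borel real"
  define V where "V x y = (of_bool (x + y \<le> real s) :: real)" for x y :: real
  have N: "real_distribution N" unfolding N_def by (rule P.real_distribution_distr) (simp add: measurable_point_measure_eq1)
  have "(\<lambda>(x, y). V x y) = (\<lambda>z. indicator {z. fst z + snd z \<le> real s} z)"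
    by (auto simp: V_def indicator_def)
  then have V: "kernel V"
    using sets_pair_Collect[of "\<lambda>z. fst z + snd z \<le> real s"] by (auto simp: kernel_def V_def add.commute)
  have int: "(\<integral>x. f x \<partial>N) = (\<Sum>a<4. \<mu> a * f (real a))" if "f \<in> borel_measurable borel" for f :: "real \<Rightarrow> real"
    unfolding N_def using that \<mu>
    by (subst integral_distr, simp_all add: measurable_point_measure_eq1)
       (subst lebesgue_integral_point_measure_finite, auto)
  interpret N: real_distribution N by (rule N)
  note [measurable] = N.kernelD(1)[OF V]
  have "deg N V x = (\<Sum>b<4. \<mu> b * V x (real b))" for x unfolding deg_def by (rule int) measurable
  moreover have "star j N V = (\<Sum>a<4. \<mu> a * deg N V (real a) ^ j)" for j
    unfolding star_def by (rule int) measurable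
  ultimately have "star j N V = block_star s \<mu> j" for j
    by (simp add: block_star_def V_def flip: of_nat_add)
  then show thesis using that N V by blast
qed

lemma (in real_distribution) integral_classes:
  fixes i :: "real \<Rightarrow> nat" and f :: "nat \<Rightarrow> real"
  assumes [measurable]: "i \<in> borel \<rightarrow>\<^sub>M count_space UNIV" and i: "\<And>x. i x < 4"
  shows "(\<integral>x. f (i x) \<partial>M) = (\<Sum>a<4. prob {x. i x = a} * f a)"
proof -
  have [measurable]: "{x. i x = a} \<in> sets borel" for a
    using measurable_sets[OF assms(1), of "{a}"] by (simp add: vimage_def)
  have "f (i x) = (\<Sum>a<4. f a * indicator {x. i x = a} x)" for x
    using i[of x] by (simp add: indicator_def sum.delta)
  then have "(\<integral>x. f (i x) \<partial>M) = (\<integral>x. (\<Sum>a<4. f a * indicator {x. i x = a} x) \<partial>M)" by simp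
  also have "\<dots> = (\<Sum>a<4. \<integral>x. f a * indicator {x. i x = a} x \<partial>M)"
    by (rule Bochner_Integration.integral_sum) (auto intro!: integrable_real_indicator simp: emeasure_eq_measure)
  finally show ?thesis by (simp add: mult.commute)
qed

text \<open>The four flags tell which clique class (1 upper, 2 lower) is joined to which independent
  class; monotonicity leaves six patterns. Four distinct labels occur with \<open>s = 2\<close> when
  only the upper classes are joined, and with \<open>s = 3\<close> when only the lower classes are
  not. In the other patterns classes with equal neighbourhoods share a label.\<close>

lemma threshold_pattern_encoding:
  assumes "e12 \<Longrightarrow> e11" "e21 \<Longrightarrow> e11" "e22 \<Longrightarrow> e12" "e22 \<Longrightarrow> e21"
  obtains r0 r1 r2 r3 s :: nat where "s = 2 \<or> s = 3" "r0 < 4" "r1 < 4" "r2 < 4" "r3 < 4"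
    "r0 + r0 \<le> s" "r0 + r1 \<le> s" "r1 + r1 \<le> s" "\<not> r2 + r2 \<le> s" "\<not> r2 + r3 \<le> s" "\<not> r3 + r3 \<le> s"
    "r0 + r2 \<le> s \<longleftrightarrow> e11" "r0 + r3 \<le> s \<longleftrightarrow> e12" "r1 + r2 \<le> s \<longleftrightarrow> e21" "r1 + r3 \<le> s \<longleftrightarrow> e22"
proof -
  consider "\<not> e11" | "e11" "\<not> e12" "\<not> e21" | "e12" "\<not> e21" | "e21" "\<not> e12" | "e12" "e21" "\<not> e22" | "e22"
    using assms by blast
  then show thesis
  proof cases
    case 1 then show ?thesis using assms by (intro that[of 2 1 1 2 2]) auto
  next
    case 2 then show ?thesis using assms by (intro that[of 2 0 1 2 3]) auto
  next
    case 3 then show ?thesis using assms by (intro that[of 3 0 1 3 3]) auto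
  next
    case 4 then show ?thesis using assms by (intro that[of 3 1 1 2 3]) auto
  next
    case 5 then show ?thesis using assms by (intro that[of 3 0 1 2 3]) auto
  next
    case 6 then show ?thesis using assms by (intro that[of 3 0 0 2 2]) auto
  qed
qed

lemma (in threshold_maximizer) block_form:
  obtains i :: "real \<Rightarrow> nat" and s where "i \<in> borel \<rightarrow>\<^sub>M count_space UNIV" "\<And>x. i x < 4" "s = 2 \<or> s = 3"
    "AE z in M \<Otimes>\<^sub>M M. W (fst z) (snd z) = of_bool (i (fst z) + i (snd z) \<le> s)"
proof -
  \<comment> \<open>The vertices joined to themselves. By monotonicity in \<open>\<delta>\<close>
    they form a clique, and the others an independent set.\<close>
  define A where "A = {x. \<delta> x ^ m + \<delta> x ^ m \<in> J}"
  have "{x \<in> space borel. \<delta> x ^ m + \<delta> x ^ m \<in> J} \<in> sets borel" by measurable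
  then have A[measurable]: "A \<in> sets borel" by (simp add: A_def)
  have diag: "x \<in> A \<Longrightarrow> W x x = 1" "x \<notin> A \<Longrightarrow> W x x = 0" for x by (simp_all add: A_def W_threshold)
  have AA: "W x y = 1" if "x \<in> A" "y \<in> A" for x y
    using that diag(1)[of x] diag(1)[of y] W_mono[of x y x] W_mono[of y x y] W_simps(2)[of x y] W_sym[of x y]
    by linarith
  have BB: "W x y = 0" if "x \<in> - A" "y \<in> - A" for x y
    using that diag(2)[of x] diag(2)[of y] W_mono[of x y y] W_mono[of y x x] W_simps(1)[of x y] W_sym[of x y]
    by (cases "\<delta> x \<le> \<delta> y") auto
  obtain p q where pq: "0 \<le> q" "q \<le> p" "AE y in M. y \<in> A \<longrightarrow> \<delta> y = p \<or> \<delta> y = q"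
    by (rule two_valued[OF A AA])
  obtain p' q' where pq': "0 \<le> q'" "q' \<le> p'" "AE y in M. y \<in> - A \<longrightarrow> \<delta> y = p' \<or> \<delta> y = q'"
    by (rule two_valued[OF borel_comp[OF A] BB])
  define e where "e a b \<longleftrightarrow> a ^ m + b ^ m \<in> J" for a b :: real
  have e_mono: "e a b \<Longrightarrow> e a' b'" if "0 \<le> a" "a \<le> a'" "0 \<le> b" "b \<le> b'" for a b a' b'
    using J_up[of "a ^ m + b ^ m" "a' ^ m + b' ^ m"] that by (auto simp: e_def intro!: add_mono power_mono)
  have mono: "e p q' \<Longrightarrow> e p p'" "e q p' \<Longrightarrow> e p p'" "e q q' \<Longrightarrow> e p q'" "e q q' \<Longrightarrow> e q p'"
    by (erule e_mono[rotated -1]; use pq(1,2) pq'(1,2) in linarith)+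
  obtain r0 r1 r2 r3 s :: nat where r: "s = 2 \<or> s = 3" "r0 < 4" "r1 < 4" "r2 < 4" "r3 < 4"
    "r0 + r0 \<le> s" "r0 + r1 \<le> s" "r1 + r1 \<le> s" "\<not> r2 + r2 \<le> s" "\<not> r2 + r3 \<le> s" "\<not> r3 + r3 \<le> s"
    "r0 + r2 \<le> s \<longleftrightarrow> e p p'" "r0 + r3 \<le> s \<longleftrightarrow> e p q'" "r1 + r2 \<le> s \<longleftrightarrow> e q p'" "r1 + r3 \<le> s \<longleftrightarrow> e q q'"
    by (rule threshold_pattern_encoding[of "e p q'" "e p p'" "e q p'" "e q q'", OF mono])
  define i where "i x = (if x \<in> A then if \<delta> x = p then r0 else r1 else if \<delta> x = p' then r2 else r3)" for x
  have [measurable]: "i \<in> borel \<rightarrow>\<^sub>M count_space UNIV" unfolding i_def by measurable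
  define good where "good x \<longleftrightarrow> (x \<in> A \<longrightarrow> \<delta> x = p \<or> \<delta> x = q) \<and> (x \<notin> A \<longrightarrow> \<delta> x = p' \<or> \<delta> x = q')" for x
  have [measurable]: "Measurable.pred borel good" unfolding good_def by measurable
  have good: "AE x in M. good x" using pq(3) pq'(3) by eventually_elim (auto simp: good_def)
  have W: "W x y = of_bool (i x + i y \<le> s)" if "good x" "good y" for x y
  proof -
    have mixed: "W x y = of_bool (i x + i y \<le> s)" if "x \<in> A" "y \<notin> A" "good x" "good y" for x y
      using that r by (auto simp: good_def i_def W_threshold e_def)
    show ?thesis
    proof (cases "x \<in> A"; cases "y \<in> A")
      assume "x \<in> A" "y \<in> A" then show ?thesis using AA[of x y] r by (auto simp: i_def add.commute)
    next
      assume "x \<notin> A" "y \<notin> A" then show ?thesis using BB[of x y] r by (auto simp: i_def add.commute)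
    next
      assume "x \<notin> A" "y \<in> A" then show ?thesis using mixed[of y x] that W_sym[of x y] by (simp add: add.commute)
    qed (use mixed that in auto)
  qed
  have "AE z in M \<Otimes>\<^sub>M M. good (fst z) \<and> good (snd z)"
  proof (rule P.AE_pair_measure)
    show "AE x in M. AE y in M. good (fst (x, y)) \<and> good (snd (x, y))"
      using good by eventually_elim (use good in simp)
  qed measurable
  then have "AE z in M \<Otimes>\<^sub>M M. W (fst z) (snd z) = of_bool (i (fst z) + i (snd z) \<le> s)"
    by eventually_elim (simp add: W)
  moreover have "i x < 4" for x using r by (simp add: i_def)
  ultimately show thesis using that[of i s] r(1) by simp
qed

section \<open>Varying the masses of the four classes\<close>

context star_maximizer
begin

lemma deg_cong_AE:
  assumes "AE z in M \<Otimes>\<^sub>M M. W (fst z) (snd z) = V (fst z) (snd z)"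
    and [measurable]: "(\<lambda>(x, y). V x y) \<in> borel_measurable (borel \<Otimes>\<^sub>M borel)"
  shows "AE x in M. deg M V x = d x"
proof -
  have "AE x in M. AE y in M. W x y = V x y" using P.AE_pair[OF assms(1)] by simp
  then show ?thesis unfolding deg_def
    by eventually_elim (auto intro!: integral_cong_AE elim: eventually_mono)
qed

lemma block_form:
  obtains i :: "real \<Rightarrow> nat" and s where "i \<in> borel \<rightarrow>\<^sub>M count_space UNIV" "\<And>x. i x < 4" "s = 2 \<or> s = 3"
    "AE z in M \<Otimes>\<^sub>M M. W (fst z) (snd z) = of_bool (i (fst z) + i (snd z) \<le> s)"
proof -
  obtain J where J[measurable]: "J \<in> sets borel" and up: "\<And>a b. a \<in> J \<Longrightarrow> a \<le> b \<Longrightarrow> b \<in> J"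
    and AE: "AE z in M \<Otimes>\<^sub>M M. W (fst z) (snd z) = of_bool (\<kappa> (fst z) (snd z) \<in> J)"
    by (rule threshold_form) blast
  define V where "V x y = (of_bool (\<kappa> x y \<in> J) :: real)" for x y
  have "(\<lambda>(x, y). V x y) = (\<lambda>z. indicator {z. \<kappa> (fst z) (snd z) \<in> J} z)"
    by (auto simp: V_def indicator_def)
  moreover have "{z. \<kappa> (fst z) (snd z) \<in> J} \<in> sets (borel \<Otimes>\<^sub>M borel)" by (rule sets_pair_Collect) measurable
  ultimately have V: "kernel V" by (auto simp: kernel_def V_def add.commute)
  have dV: "AE x in M. deg M V x = d x"
    using AE kernelD(1)[OF V] by (intro deg_cong_AE) (simp_all add: V_def)
  interpret V: star_maximizer M V k m by (rule star_maximizer_cong[OF V dV])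
  interpret T: threshold_maximizer M V k m d J
    by unfold_locales (use up d_bounds dV in \<open>auto simp: V_def\<close>)
  obtain i :: "real \<Rightarrow> nat" and s where i: "i \<in> borel \<rightarrow>\<^sub>M count_space UNIV" "\<And>x. i x < 4" "s = 2 \<or> s = 3"
    "AE z in M \<Otimes>\<^sub>M M. V (fst z) (snd z) = of_bool (i (fst z) + i (snd z) \<le> s)"
    by (rule T.block_form) auto
  from AE i(4) have "AE z in M \<Otimes>\<^sub>M M. W (fst z) (snd z) = of_bool (i (fst z) + i (snd z) \<le> s)"
    by eventually_elim (simp add: V_def)
  then show thesis using that i by blast
qed

lemma block_star_maximal:
  fixes i :: "real \<Rightarrow> nat"
  assumes i[measurable]: "i \<in> borel \<rightarrow>\<^sub>M count_space UNIV" "\<And>x. i x < 4"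
    and AE: "AE z in M \<Otimes>\<^sub>M M. W (fst z) (snd z) = of_bool (i (fst z) + i (snd z) \<le> s)"
    and \<nu>: "\<And>a. a < 4 \<Longrightarrow> 0 \<le> \<nu> a" "(\<Sum>a<4. \<nu> a) = 1"
    and eq: "block_star s \<nu> 1 = block_star s (\<lambda>a. prob {x. i x = a}) 1"
  shows "block_star s \<nu> k \<le> block_star s (\<lambda>a. prob {x. i x = a}) k"
proof -
  define V where "V x y = (of_bool (i x + i y \<le> s) :: real)" for x y
  have [measurable]: "(\<lambda>x. real (i x)) \<in> borel_measurable borel" by (rule measurable_compose[OF i(1)]) simp
  have "V x y = of_bool (real (i x) + real (i y) \<le> real s)" for x y by (simp add: V_def flip: of_nat_add)
  then have Vm: "(\<lambda>(x, y). V x y) \<in> borel_measurable (borel \<Otimes>\<^sub>M borel)" by simp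
  have dV: "AE x in M. deg M V x = d x" using AE Vm by (intro deg_cong_AE) (simp_all add: V_def)
  have V: "kernel V" using Vm by (auto simp: kernel_def V_def add.commute)
  have 1: "star j M V = star j M W" for j
    unfolding star_def using dV Vm by (intro integral_cong_AE) (auto elim: eventually_mono)
  have 2: "star j M V = block_star s (\<lambda>a. prob {x. i x = a}) j" for j
  proof -
    have "deg M V x = (\<Sum>b<4. prob {x. i x = b} * of_bool (i x + b \<le> s))" for x
      unfolding deg_def V_def by (rule integral_classes[OF i])
    then show ?thesis unfolding star_def block_star_def
      using integral_classes[OF i, of "\<lambda>a. (\<Sum>b<4. prob {x. i x = b} * of_bool (a + b \<le> s)) ^ j"] by simp
  qed
  obtain N U where N: "real_distribution N" "kernel U" "\<And>j. star j N U = block_star s \<nu> j"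
    by (rule block_star_realized[OF \<nu>, of s]) auto
  have "star k N U \<le> star k M W" using N 1 2 eq by (intro maximal) auto
  then show ?thesis using N 1 2 by simp
qed

lemma class_null:
  fixes i :: "real \<Rightarrow> nat"
  assumes [measurable]: "i \<in> borel \<rightarrow>\<^sub>M count_space UNIV" and "prob {x. i x = a} = 0"
  shows "AE z in M \<Otimes>\<^sub>M M. i (fst z) \<noteq> a \<and> i (snd z) \<noteq> a"
proof (rule P.AE_pair_measure)
  have [measurable]: "{x. i x = a} \<in> sets borel"
    using measurable_sets[OF assms(1), of "{a}"] by (simp add: vimage_def)
  then have ae: "AE x in M. i x \<noteq> a" using assms(2) prob_eq_0[of "{x. i x = a}"] by simp
  then show "AE x in M. AE y in M. i (fst (x, y)) \<noteq> a \<and> i (snd (x, y)) \<noteq> a"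
    by eventually_elim (use ae in simp)
qed measurable

abbreviation "clique_form \<equiv>
  \<exists>A\<in>sets borel. AE z in M \<Otimes>\<^sub>M M. W (fst z) (snd z) = of_bool (fst z \<in> A \<and> snd z \<in> A)"
abbreviation "anticlique_form \<equiv>
  \<exists>A\<in>sets borel. AE z in M \<Otimes>\<^sub>M M. W (fst z) (snd z) = of_bool (\<not> (fst z \<in> A \<and> snd z \<in> A))"

context
  fixes i :: "real \<Rightarrow> nat" and s :: nat and \<mu> :: "nat \<Rightarrow> real"
  assumes i[measurable]: "i \<in> borel \<rightarrow>\<^sub>M count_space UNIV" and i4: "\<And>x. i x < 4"
    and AE: "AE z in M \<Otimes>\<^sub>M M. W (fst z) (snd z) = of_bool (i (fst z) + i (snd z) \<le> s)"
  defines "\<mu> \<equiv> \<lambda>a. prob {x. i x = a}"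
begin

private lemma \<mu>_nonneg: "0 \<le> \<mu> a"
  by (simp add: \<mu>_def)

private lemma \<mu>_pos: "\<mu> a \<noteq> 0 \<longleftrightarrow> 0 < \<mu> a"
  using \<mu>_nonneg[of a] by auto

private lemma \<mu>_3: "\<mu> 3 = 1 - \<mu> 0 - \<mu> 1 - \<mu> 2"
  using integral_classes[OF i i4, of "\<lambda>_. 1"] by (simp add: \<mu>_def eval_nat_numeral)

private definition vec :: "real \<Rightarrow> real \<Rightarrow> real \<Rightarrow> real \<Rightarrow> nat \<Rightarrow> real" where
  "vec a b c e j = (if j = 0 then a else if j = 1 then b else if j = 2 then c else e)"

private lemma vec_simps: "vec a b c e 0 = a" "vec a b c e 1 = b" "vec a b c e (Suc 0) = b"
  "vec a b c e 2 = c" "vec a b c e 3 = e"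
  by (simp_all add: vec_def)

private lemma competitor:
  assumes "0 \<le> a" "0 \<le> b" "0 \<le> c" "0 \<le> e" "a + b + c + e = 1"
    and "block_star s (vec a b c e) 1 = block_star s \<mu> 1"
  shows "block_star s (vec a b c e) k \<le> block_star s \<mu> k"
proof -
  have "(\<Sum>j<4. vec a b c e j) = a + b + c + e"
    by (simp add: vec_def eval_nat_numeral)
  moreover have "0 \<le> vec a b c e j" for j using assms by (simp add: vec_def)
  ultimately show ?thesis
    using block_star_maximal[OF i i4 AE, of "vec a b c e"] assms(5,6) unfolding \<mu>_def by simp
qed

private lemma k2: "2 \<le> k" using k m by simp

private lemma i_cases: "i x = 0 \<or> i x = 1 \<or> i x = 2 \<or> i x = 3"
  using i4[of x] by auto

private lemma sets_classes: "{x. Q (i x)} \<in> sets borel"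
  using measurable_sets[OF i, of "{a. Q a}"] by (simp add: vimage_def)

text \<open>If classes 1 and 3 are present, one of two curves is available. With class 2 present,
  masses 1, 2, 3 move along the flow while class 0 is fixed; without class 2 but with class 0,
  masses 0, 1, 3 move along the clique curve.\<close>

private lemma four_class_3_degenerate:
  assumes s3: "s = 3" shows "\<mu> 1 = 0 \<or> \<mu> 3 = 0 \<or> \<mu> 2 = 0 \<and> \<mu> 0 = 0"
proof (rule ccontr)
  assume n: "\<not> ?thesis"
  then have p: "0 < \<mu> 1" "0 < \<mu> 3" using \<mu>_pos by auto
  show False
  proof (cases "\<mu> 2 = 0")
    case False
    then have p2: "0 < \<mu> 2" using \<mu>_pos by auto
    show False
    proof (rule anticlique_family_no_interior_max[OF p(1) p2 refl \<mu>_nonneg[of 0] _ k2])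
      show "\<mu> 0 + (\<mu> 1 + \<mu> 2) < 1" using p \<mu>_3 by simp
      fix x v :: real
      assume xv: "0 < x" "0 < v" "\<mu> 0 + x + v < 1" "x * (x + v) + v * x = \<mu> 1 * (\<mu> 1 + \<mu> 2) + \<mu> 2 * \<mu> 1"
      have "block_star s (vec (\<mu> 0) x v (1 - \<mu> 0 - x - v)) k \<le> block_star s \<mu> k"
      proof (rule competitor)
        show "block_star s (vec (\<mu> 0) x v (1 - \<mu> 0 - x - v)) 1 = block_star s \<mu> 1"
          unfolding s3 block_star_3 vec_simps \<mu>_3 power_one_right using xv(4) by algebra
      qed (use xv \<mu>_nonneg in auto)
      then show "x * (\<mu> 0 + x + v) ^ k + v * (\<mu> 0 + x) ^ k + (1 - \<mu> 0 - x - v) * \<mu> 0 ^ k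
        \<le> \<mu> 1 * (\<mu> 0 + (\<mu> 1 + \<mu> 2)) ^ k + \<mu> 2 * (\<mu> 0 + \<mu> 1) ^ k + (1 - \<mu> 0 - (\<mu> 1 + \<mu> 2)) * \<mu> 0 ^ k"
        unfolding s3 block_star_3 vec_simps \<mu>_3 by (simp add: add.assoc diff_diff_eq)
    qed
  next
    case z: True
    then have p0: "0 < \<mu> 0" using n \<mu>_pos by auto
    show False
    proof (rule clique_family_no_interior_max[OF p0 _ _ k2, of "\<mu> 0 + \<mu> 1"])
      show "\<mu> 0 < \<mu> 0 + \<mu> 1" "\<mu> 0 + \<mu> 1 < 1" using p \<mu>_3 z by auto
      fix b c :: real
      assume bc: "0 < b" "b < c" "c < 1" "2 * b * (1 - c) + c\<^sup>2 = 2 * \<mu> 0 * (1 - (\<mu> 0 + \<mu> 1)) + (\<mu> 0 + \<mu> 1)\<^sup>2"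
      have "block_star s (vec b (c - b) 0 (1 - c)) k \<le> block_star s \<mu> k"
      proof (rule competitor)
        show "block_star s (vec b (c - b) 0 (1 - c)) 1 = block_star s \<mu> 1"
          unfolding s3 block_star_3 vec_simps \<mu>_3 power_one_right z using bc(4)
          by (simp add: power2_eq_square algebra_simps)
      qed (use bc in auto)
      then show "b + (c - b) * c ^ k + (1 - c) * b ^ k
        \<le> \<mu> 0 + (\<mu> 0 + \<mu> 1 - \<mu> 0) * (\<mu> 0 + \<mu> 1) ^ k + (1 - (\<mu> 0 + \<mu> 1)) * \<mu> 0 ^ k"
        unfolding s3 block_star_3 vec_simps \<mu>_3 z by (simp add: diff_diff_eq)
    qed
  qed
qed

text \<open>The sum of masses 0 and 1 is fixed and the product of masses 0 and 2 is kept constant;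
  class 3 absorbs the change of class 2.\<close>

private lemma four_class_2_degenerate:
  assumes s2: "s = 2" shows "\<mu> 0 = 0 \<or> \<mu> 1 = 0 \<or> \<mu> 2 = 0 \<or> \<mu> 3 = 0"
proof (rule ccontr)
  assume "\<not> ?thesis"
  then have p: "0 < \<mu> 0" "0 < \<mu> 1" "0 < \<mu> 2" "0 < \<mu> 3" using \<mu>_pos by auto
  have k1: "1 \<le> k" using k2 by simp
  show False
  proof (rule split_family_no_interior_max[OF p(1) _ p(3) _ k2, of "\<mu> 0 + \<mu> 1" 1])
    show "\<mu> 0 < \<mu> 0 + \<mu> 1" "\<mu> 0 + \<mu> 1 + \<mu> 2 < 1" using p \<mu>_3 by auto
    fix b w :: real
    assume bw: "0 < b" "b < \<mu> 0 + \<mu> 1" "0 < w" "\<mu> 0 + \<mu> 1 + w < 1" "b * w = \<mu> 0 * \<mu> 2"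
    let ?c = "\<mu> 0 + \<mu> 1"
    have "block_star s (vec b (?c - b) w (1 - ?c - w)) k \<le> block_star s \<mu> k"
    proof (rule competitor)
      show "block_star s (vec b (?c - b) w (1 - ?c - w)) 1 = block_star s \<mu> 1"
        unfolding s2 block_star_2[OF order_refl] vec_simps power_one_right using bw(5) by (simp add: algebra_simps)
    qed (use bw in auto)
    then show "b * (?c + w) ^ k + (?c - b) * ?c ^ k + w * b ^ k
      \<le> \<mu> 0 * (?c + \<mu> 2) ^ k + (?c - \<mu> 0) * ?c ^ k + \<mu> 2 * \<mu> 0 ^ k"
      unfolding s2 block_star_2[OF k1] vec_simps by simp
  qed
qed

text \<open>Without class 1, class 0 dominates an independent set; without class 3, classes 0 and 1
  both dominate class 2. If only 1 and 3 remain, class 1 is a clique and class 3 is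
  isolated.\<close>

lemma four_class_3_form:
  assumes s3: "s = 3" shows "clique_form \<or> anticlique_form"
proof -
  consider "\<mu> 1 = 0" | "\<mu> 3 = 0" | "\<mu> 2 = 0" "\<mu> 0 = 0" using four_class_3_degenerate[OF s3] by blast
  then show ?thesis
  proof cases
    case 1
    have "AE z in M \<Otimes>\<^sub>M M. W (fst z) (snd z) = of_bool (\<not> (fst z \<in> {x. i x \<noteq> 0} \<and> snd z \<in> {x. i x \<noteq> 0}))"
      using AE class_null[OF i 1[unfolded \<mu>_def]]
    proof eventually_elim
      case (elim z) then show ?case using i_cases[of "fst z"] i_cases[of "snd z"] s3 by auto
    qed
    then show ?thesis using sets_classes[of "\<lambda>a. a \<noteq> 0"] by blast
  next
    case 2
    have "AE z in M \<Otimes>\<^sub>M M. W (fst z) (snd z) = of_bool (\<not> (fst z \<in> {x. i x = 2} \<and> snd z \<in> {x. i x = 2}))"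
      using AE class_null[OF i 2[unfolded \<mu>_def]]
    proof eventually_elim
      case (elim z) then show ?case using i_cases[of "fst z"] i_cases[of "snd z"] s3 by auto
    qed
    then show ?thesis using sets_classes[of "\<lambda>a. a = 2"] by blast
  next
    case 3
    have "AE z in M \<Otimes>\<^sub>M M. W (fst z) (snd z) = of_bool (fst z \<in> {x. i x = 1} \<and> snd z \<in> {x. i x = 1})"
      using AE class_null[OF i 3(1)[unfolded \<mu>_def]] class_null[OF i 3(2)[unfolded \<mu>_def]]
    proof eventually_elim
      case (elim z) then show ?case using i_cases[of "fst z"] i_cases[of "snd z"] s3 by auto
    qed
    then show ?thesis using sets_classes[of "\<lambda>a. a = 1"] by blast
  qed
qed

text \<open>Dropping class 0 or class 2 leaves a clique with isolated vertices. Dropping class 1 or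
  class 3 leaves a graph on three classes that also fits the pattern \<open>s = 3\<close> after
  relabelling 0 as 1, respectively 2 as 3.\<close>

lemma four_class_2_form:
  assumes s2: "s = 2"
  shows "clique_form \<or> (\<exists>j. j \<in> borel \<rightarrow>\<^sub>M count_space UNIV \<and> (\<forall>x. j x < 4) \<and>
    (AE z in M \<Otimes>\<^sub>M M. W (fst z) (snd z) = of_bool (j (fst z) + j (snd z) \<le> (3::nat))))"
proof -
  consider "\<mu> 0 = 0" | "\<mu> 1 = 0" | "\<mu> 2 = 0" | "\<mu> 3 = 0" using four_class_2_degenerate[OF s2] by blast
  then show ?thesis
  proof cases
    case 1
    have "AE z in M \<Otimes>\<^sub>M M. W (fst z) (snd z) = of_bool (fst z \<in> {x. i x = 1} \<and> snd z \<in> {x. i x = 1})"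
      using AE class_null[OF i 1[unfolded \<mu>_def]]
    proof eventually_elim
      case (elim z) then show ?case using i_cases[of "fst z"] i_cases[of "snd z"] s2 by auto
    qed
    then show ?thesis using sets_classes[of "\<lambda>a. a = 1"] by blast
  next
    case 2
    define j where "j x = (if i x = 0 then 1 else i x)" for x
    have "AE z in M \<Otimes>\<^sub>M M. W (fst z) (snd z) = of_bool (j (fst z) + j (snd z) \<le> (3::nat))"
      using AE class_null[OF i 2[unfolded \<mu>_def]]
    proof eventually_elim
      case (elim z) then show ?case using i_cases[of "fst z"] i_cases[of "snd z"] s2 by (auto simp: j_def)
    qed
    moreover have "j \<in> borel \<rightarrow>\<^sub>M count_space UNIV" unfolding j_def by measurable
    moreover have "j x < 4" for x using i4[of x] by (simp add: j_def)
    ultimately show ?thesis by blast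
  next
    case 3
    have "AE z in M \<Otimes>\<^sub>M M. W (fst z) (snd z) = of_bool (fst z \<in> {x. i x \<le> 1} \<and> snd z \<in> {x. i x \<le> 1})"
      using AE class_null[OF i 3[unfolded \<mu>_def]]
    proof eventually_elim
      case (elim z) then show ?case using i_cases[of "fst z"] i_cases[of "snd z"] s2 by auto
    qed
    then show ?thesis using sets_classes[of "\<lambda>a. a \<le> 1"] by blast
  next
    case 4
    define j where "j x = (if i x = 2 then 3 else i x)" for x
    have "AE z in M \<Otimes>\<^sub>M M. W (fst z) (snd z) = of_bool (j (fst z) + j (snd z) \<le> (3::nat))"
      using AE class_null[OF i 4[unfolded \<mu>_def]]
    proof eventually_elim
      case (elim z) then show ?case using i_cases[of "fst z"] i_cases[of "snd z"] s2 by (auto simp: j_def)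
    qed
    moreover have "j \<in> borel \<rightarrow>\<^sub>M count_space UNIV" unfolding j_def by measurable
    moreover have "j x < 4" for x using i4[of x] by (simp add: j_def)
    ultimately show ?thesis by blast
  qed
qed

end

lemma clique_or_anticlique: "clique_form \<or> anticlique_form"
proof -
  obtain i :: "real \<Rightarrow> nat" and s where i: "i \<in> borel \<rightarrow>\<^sub>M count_space UNIV" "\<And>x. i x < 4"
    and s: "s = 2 \<or> s = 3"
    and AE: "AE z in M \<Otimes>\<^sub>M M. W (fst z) (snd z) = of_bool (i (fst z) + i (snd z) \<le> s)"
    by (rule block_form) auto
  from s show ?thesis
  proof
    assume "s = 2"
    from four_class_2_form[where i=i and s=s, OF i AE this] show ?thesis
    proof
      assume "\<exists>j. j \<in> borel \<rightarrow>\<^sub>M count_space UNIV \<and> (\<forall>x. j x < 4) \<and>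
        (AE z in M \<Otimes>\<^sub>M M. W (fst z) (snd z) = of_bool (j (fst z) + j (snd z) \<le> (3::nat)))"
      then obtain j where j: "j \<in> borel \<rightarrow>\<^sub>M count_space UNIV" "\<And>x. j x < 4"
        "AE z in M \<Otimes>\<^sub>M M. W (fst z) (snd z) = of_bool (j (fst z) + j (snd z) \<le> (3::nat))" by auto
      show ?thesis by (rule four_class_3_form[where i=j and s=3, OF j refl])
    qed (rule disjI1)
  qed (rule four_class_3_form[where i=i and s=s, OF i AE])
qed

end

section \<open>Graphons on the unit interval\<close>

abbreviation U :: "real measure" where
  "U \<equiv> unit_interval_measure"

lemma space_U [simp]: "space U = {0..1}"
  by (simp add: unit_interval_measure_def space_restrict_space)

lemma prob_space_U: "prob_space U"
  by (rule prob_spaceI) (simp add: unit_interval_measure_def emeasure_restrict_space space_restrict_space)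

lemma ident_measurable_U [simp]: "(\<lambda>x. x) \<in> U \<rightarrow>\<^sub>M borel"
  unfolding unit_interval_measure_def by (rule measurable_restrict_space1) simp

definition uniform :: "real measure" where
  "uniform = distr U borel (\<lambda>x. x)"

interpretation uniform: real_distribution uniform
  unfolding uniform_def by (rule prob_space.real_distribution_distr[OF prob_space_U ident_measurable_U])

lemma integral_uniform:
  fixes f :: "real \<Rightarrow> real"
  assumes "f \<in> borel_measurable borel"
  shows "(\<integral>x. f x \<partial>uniform) = (\<integral>x. f x \<partial>U)"
  unfolding uniform_def using assms by (subst integral_distr) auto

lemma integral_U:
  fixes f :: "real \<Rightarrow> real"
  shows "(\<integral>x. f x \<partial>U) = (\<integral>x. indicator {0..1} x * f x \<partial>lborel)"
  unfolding unit_interval_measure_def by (subst integral_restrict_space) auto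

lemma measure_uniform:
  assumes [measurable]: "A \<in> sets borel"
  shows "measure uniform A = measure lborel (A \<inter> {0..1})"
proof -
  have "measure uniform A = measure U (A \<inter> {0..1})"
    unfolding uniform_def by (subst measure_distr) auto
  then show ?thesis unfolding unit_interval_measure_def by (subst (asm) measure_restrict_space) auto
qed

lemma uniform_atomless: "measure uniform {x} = 0"
proof -
  have "{x} \<inter> {0..1} = (if x \<in> {0..1} then {x} else {})" by auto
  then show ?thesis by (simp add: measure_uniform)
qed

lemma star_density_graphon:
  assumes W: "kernel W" and g: "\<And>x y. x \<in> {0..1} \<Longrightarrow> y \<in> {0..1} \<Longrightarrow> g x y = W x y"
  shows "star_density j g = star j uniform W"
proof -
  note [measurable] = uniform.kernelD(1)[OF W]
  have "degree_fun g x = deg uniform W x" if "x \<in> {0..1}" for x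
  proof -
    have "degree_fun g x = (\<integral>y. W x y \<partial>U)" unfolding degree_fun_def
      using g that by (intro Bochner_Integration.integral_cong) auto
    then show ?thesis unfolding deg_def by (subst integral_uniform) auto
  qed
  then have "star_density j g = (\<integral>x. deg uniform W x ^ j \<partial>U)"
    unfolding star_density_def by (intro Bochner_Integration.integral_cong) auto
  then show ?thesis unfolding star_def by (subst integral_uniform) auto
qed

lemma graphon_kernel:
  assumes "graphon g"
  obtains W where "kernel W" "\<And>x y. x \<in> {0..1} \<Longrightarrow> y \<in> {0..1} \<Longrightarrow> g x y = W x y"
proof -
  define W where "W x y = (if x \<in> {0..1} \<and> y \<in> {0..1} then g x y else 0)" for x y
  have "(\<lambda>z. indicator ({0..1} \<times> {0..1}) z *\<^sub>R (case z of (x, y) \<Rightarrow> g x y)) \<in> borel_measurable (lborel \<Otimes>\<^sub>M lborel)"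
    using assms unfolding graphon_def
    by (subst (asm) borel_measurable_restrict_space_iff) auto
  also have "(\<lambda>z. indicator ({0..1} \<times> {0..1}) z *\<^sub>R (case z of (x, y) \<Rightarrow> g x y)) = (\<lambda>(x, y). W x y)"
    by (auto simp: W_def indicator_def)
  also have "borel_measurable (lborel \<Otimes>\<^sub>M lborel) = (borel_measurable (borel \<Otimes>\<^sub>M borel) :: (real \<times> real \<Rightarrow> real) set)"
    by (intro measurable_cong_sets sets_pair_measure_cong) auto
  finally have "kernel W" using assms by (auto simp: kernel_def W_def graphon_def)
  then show thesis by (rule that) (simp add: W_def)
qed

text \<open>A kernel on an arbitrary real distribution is pulled back to the unit interval along the quantile function.\<close>

lemma distribution_graphon:
  assumes N: "real_distribution N" and V: "kernel V"
  obtains h where "graphon h" "\<And>j. star_density j h = star j N V"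
proof -
  interpret N: cdf_distribution N unfolding cdf_distribution_def by (rule N)
  note [measurable] = uniform.kernelD(1)[OF V]
  \<comment> \<open>Measurability of the quantile function is given on the open interval only; the
    endpoints are a null set and receive the value 0.\<close>
  define q where "q x = indicator {0<..<1} x * N.I x" for x
  have "(\<lambda>x. indicator {0<..<1} x *\<^sub>R N.I x) \<in> borel_measurable borel"
    using N.measurable_CI by (subst (asm) borel_measurable_restrict_space_iff) auto
  then have q[measurable]: "q \<in> borel_measurable borel" by (simp add: q_def[abs_def])
  have int: "(\<integral>x. f (q x) \<partial>uniform) = (\<integral>x. f x \<partial>N)" if [measurable]: "f \<in> borel_measurable borel" for f :: "real \<Rightarrow> real"
  proof -
    have "(\<integral>x. f (q x) \<partial>uniform) = (\<integral>x. indicator {0..1} x * f (q x) \<partial>lborel)"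
      by (subst integral_uniform) (simp_all add: integral_U)
    also have "\<dots> = (\<integral>x. indicator {0<..<1} x *\<^sub>R f (q x) \<partial>lborel)"
    proof (rule integral_cong_AE)
      show "AE x in lborel. indicator {0..1} x * f (q x) = indicator {0<..<1} x *\<^sub>R f (q x)"
        using AE_lborel_singleton[of 0] AE_lborel_singleton[of 1]
        by eventually_elim (auto simp: indicator_def)
    qed measurable
    also have "\<dots> = (\<integral>x. f (q x) \<partial>restrict_space lborel {0<..<1})"
      by (subst integral_restrict_space) auto
    also have "\<dots> = (\<integral>x. f (N.I x) \<partial>restrict_space lborel {0<..<1})"
      by (intro Bochner_Integration.integral_cong) (auto simp: q_def space_restrict_space)
    also have "\<dots> = (\<integral>x. f x \<partial>distr (restrict_space lborel {0<..<1}) borel N.I)"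
    proof (rule integral_distr[symmetric])
      have "sets (restrict_space lborel {0<..<1::real}) = sets (restrict_space borel {0<..<1})"
        by (intro sets_restrict_space_cong) simp
      then show "N.I \<in> restrict_space lborel {0<..<1} \<rightarrow>\<^sub>M borel"
        using N.measurable_CI measurable_cong_sets by blast
    qed measurable
    also have "\<dots> = (\<integral>x. f x \<partial>N)" by (simp add: N.distr_I_eq_M)
    finally show ?thesis .
  qed
  define h where "h x y = V (q x) (q y)" for x y
  have h[measurable]: "(\<lambda>(x, y). h x y) \<in> borel_measurable (borel \<Otimes>\<^sub>M borel)" unfolding h_def by measurable
  then have kh: "kernel h" using V by (simp add: kernel_def h_def)
  have "(\<lambda>(x, y). h x y) \<in> borel_measurable (lborel \<Otimes>\<^sub>M lborel)"
    using h by (subst measurable_cong_sets[of _ "borel \<Otimes>\<^sub>M borel" _ borel]) (auto intro!: sets_pair_measure_cong)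
  then have "graphon h" using kh by (auto simp: graphon_def kernel_def intro: measurable_restrict_space1)
  moreover have "star_density j h = star j N V" for j
  proof -
    have "deg uniform h x = deg N V (q x)" for x
      unfolding deg_def h_def by (rule int) measurable
    then have "star j uniform h = (\<integral>x. deg N V (q x) ^ j \<partial>uniform)" by (simp add: star_def)
    also have "\<dots> = star j N V" unfolding star_def by (rule int) measurable
    finally show ?thesis using star_density_graphon[OF kh, of h j] by simp
  qed
  ultimately show thesis using that by blast
qed

section \<open>Homomorphism densities of two-block graphons\<close>

text \<open>Carries almost-everywhere statements from the square to an edge of a graph. Simple
  graphs have no loops, so the two coordinates are always distinct and independent.\<close>

lemma distr_coordinate_pair:
  assumes "i < n" "j < n" "i \<noteq> j"
  shows "distr (\<Pi>\<^sub>M i\<in>{..<n}. U) (borel \<Otimes>\<^sub>M borel) (\<lambda>x. (x i, x j)) = uniform \<Otimes>\<^sub>M uniform"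
proof (rule pair_measure_eqI[symmetric])
  have ij: "i \<in> {..<n}" "j \<in> {..<n}" using assms by auto
  interpret P: product_prob_space "\<lambda>_. U" "{..<n}" by (rule product_prob_spaceI) (rule prob_space_U)
  have [measurable]: "(\<lambda>x. x i) \<in> (\<Pi>\<^sub>M i\<in>{..<n}. U) \<rightarrow>\<^sub>M borel" "(\<lambda>x. x j) \<in> (\<Pi>\<^sub>M i\<in>{..<n}. U) \<rightarrow>\<^sub>M borel"
    using measurable_compose[OF measurable_component_singleton[OF ij(1)] ident_measurable_U]
      measurable_compose[OF measurable_component_singleton[OF ij(2)] ident_measurable_U] by simp_all
  show "sets (uniform \<Otimes>\<^sub>M uniform) = sets (distr (\<Pi>\<^sub>M i\<in>{..<n}. U) (borel \<Otimes>\<^sub>M borel) (\<lambda>x. (x i, x j)))"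
    by simp
  fix A B assume "A \<in> sets uniform" "B \<in> sets uniform"
  then have AB[measurable]: "A \<in> sets borel" "B \<in> sets borel" by simp_all
  define F where "F = (\<lambda>l. if l = i then A \<inter> {0..1} else B \<inter> {0..1})"
  have U_sets: "C \<inter> {0..1} \<in> sets U" if "C \<in> sets borel" for C
    using measurable_sets[OF ident_measurable_U that] by (simp add: vimage_def)
  have em: "emeasure uniform C = emeasure U (C \<inter> {0..1})" if "C \<in> sets borel" for C
    unfolding uniform_def using that by (subst emeasure_distr) auto
  have "emeasure (distr (\<Pi>\<^sub>M i\<in>{..<n}. U) (borel \<Otimes>\<^sub>M borel) (\<lambda>x. (x i, x j))) (A \<times> B) =
      emeasure (\<Pi>\<^sub>M i\<in>{..<n}. U) {x \<in> space (\<Pi>\<^sub>M i\<in>{..<n}. U). \<forall>l\<in>{i, j}. x l \<in> F l}"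
    using assms by (subst emeasure_distr) (auto intro!: arg_cong2[where f=emeasure] simp: F_def space_PiM PiE_def Pi_iff)
  also have "\<dots> = (\<Prod>l\<in>{i, j}. emeasure U (F l))"
    using ij U_sets AB by (intro P.emeasure_PiM_Collect) (auto simp: F_def)
  also have "\<dots> = emeasure uniform A * emeasure uniform B"
    using assms AB by (simp add: F_def em)
  finally show "emeasure uniform A * emeasure uniform B =
    emeasure (distr (\<Pi>\<^sub>M i\<in>{..<n}. U) (borel \<Otimes>\<^sub>M borel) (\<lambda>x. (x i, x j))) (A \<times> B)" ..
qed (rule uniform.sigma_finite_measure_axioms)+

text \<open>The integrand depends only on which coordinates lie in \<open>A\<close>, so the density
  is an expectation over independent random bits. The flag \<open>\<sigma>\<close> is
  \<open>True\<close> for cliques and \<open>False\<close> for anticliques.\<close>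

lemma hom_density_two_block:
  assumes W: "kernel W" and g: "\<And>x y. x \<in> {0..1} \<Longrightarrow> y \<in> {0..1} \<Longrightarrow> g x y = W x y"
    and A[measurable]: "A \<in> sets borel"
    and AE: "AE z in uniform \<Otimes>\<^sub>M uniform. W (fst z) (snd z) = of_bool ((fst z \<in> A \<and> snd z \<in> A) = \<sigma>)"
    and E: "simple_graph n E"
  shows "hom_density n E g = (\<integral>b. (\<Prod>(i, j)\<in>E. of_bool ((b i \<and> b j) = \<sigma>))
    \<partial>(\<Pi>\<^sub>M i\<in>{..<n}. distr U (count_space UNIV) (\<lambda>x. x \<in> A)))"
proof -
  let ?\<Pi> = "\<Pi>\<^sub>M i\<in>{..<n}. U"
  let ?K = "distr U (count_space UNIV) (\<lambda>x. x \<in> A)"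
  note [measurable] = uniform.kernelD(1)[OF W]
  have "E \<subseteq> {..<n} \<times> {..<n}" using E by (fastforce simp: simple_graph_def)
  then have Efin: "finite E" by (rule finite_subset) simp
  have Eij: "i < n" "j < n" "i \<noteq> j" if "(i, j) \<in> E" for i j
    using E that by (auto simp: simple_graph_def)
  have comp: "(\<lambda>x. x i) \<in> ?\<Pi> \<rightarrow>\<^sub>M borel" if "i < n" for i
    using measurable_compose[OF measurable_component_singleton[of i "{..<n}"] ident_measurable_U] that by simp
  have predA: "(\<lambda>x. x \<in> A) \<in> U \<rightarrow>\<^sub>M count_space UNIV"
    by (rule measurable_compose[OF ident_measurable_U]) measurable
  have K: "prob_space ?K" by (rule prob_space.prob_space_distr[OF prob_space_U predA])
  have "hom_density n E g = (\<integral>x. (\<Prod>(i, j)\<in>E. W (x i) (x j)) \<partial>?\<Pi>)"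
    unfolding hom_density_def
  proof (intro Bochner_Integration.integral_cong refl prod.cong)
    fix x e assume x: "x \<in> space ?\<Pi>" and e: "e \<in> E"
    have "x l \<in> {0..1}" if "l < n" for l using x that by (auto simp: space_PiM PiE_iff)
    then show "(case e of (i, j) \<Rightarrow> g (x i) (x j)) = (case e of (i, j) \<Rightarrow> W (x i) (x j))"
      using g Eij e by (cases e) simp
  qed
  also have "\<dots> = (\<integral>x. (\<Prod>(i, j)\<in>E. of_bool ((x i \<in> A \<and> x j \<in> A) = \<sigma>)) \<partial>?\<Pi>)"
  proof (rule integral_cong_AE)
    have *: "AE x in ?\<Pi>. W (x i) (x j) = of_bool ((x i \<in> A \<and> x j \<in> A) = \<sigma>)" if "(i, j) \<in> E" for i j
    proof -
      have "(\<lambda>x. (x i, x j)) \<in> ?\<Pi> \<rightarrow>\<^sub>M borel \<Otimes>\<^sub>M borel" using comp Eij[OF that] by (intro measurable_Pair) auto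
      from AE_distrD[OF this AE[folded distr_coordinate_pair[OF Eij[OF that]]]] show ?thesis by simp
    qed
    have "AE x in ?\<Pi>. \<forall>e\<in>E. (case e of (i, j) \<Rightarrow> W (x i) (x j) = of_bool ((x i \<in> A \<and> x j \<in> A) = \<sigma>))"
    proof (rule AE_finite_allI[OF Efin])
      fix e assume "e \<in> E"
      then show "AE x in ?\<Pi>. (case e of (i, j) \<Rightarrow> W (x i) (x j) = of_bool ((x i \<in> A \<and> x j \<in> A) = \<sigma>))"
        using *[of "fst e" "snd e"] by (simp add: case_prod_beta)
    qed
    then show "AE x in ?\<Pi>. (\<Prod>(i, j)\<in>E. W (x i) (x j)) = (\<Prod>(i, j)\<in>E. of_bool ((x i \<in> A \<and> x j \<in> A) = \<sigma>))"
      by eventually_elim (auto intro!: prod.cong)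
    show "(\<lambda>x. \<Prod>(i, j)\<in>E. W (x i) (x j)) \<in> borel_measurable ?\<Pi>"
    proof (rule borel_measurable_prod)
      fix e assume "e \<in> E"
      then obtain i j where e: "e = (i, j)" "i < n" "j < n" using Eij by (cases e) auto
      note [measurable] = comp[OF e(2)] comp[OF e(3)]
      show "(\<lambda>x. case e of (i, j) \<Rightarrow> W (x i) (x j)) \<in> borel_measurable ?\<Pi>" unfolding e by simp
    qed
    show "(\<lambda>x. \<Prod>(i, j)\<in>E. of_bool ((x i \<in> A \<and> x j \<in> A) = \<sigma>) :: real) \<in> borel_measurable ?\<Pi>"
    proof (rule borel_measurable_prod)
      fix e assume "e \<in> E"
      then obtain i j where e: "e = (i, j)" "i < n" "j < n" using Eij by (cases e) auto
      note [measurable] = comp[OF e(2)] comp[OF e(3)]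
      show "(\<lambda>x. case e of (i, j) \<Rightarrow> (of_bool ((x i \<in> A \<and> x j \<in> A) = \<sigma>) :: real)) \<in> borel_measurable ?\<Pi>"
        unfolding e prod.case by measurable
    qed
  qed
  also have "\<dots> = (\<integral>x. (\<Prod>(i, j)\<in>E. of_bool ((compose {..<n} (\<lambda>x. x \<in> A) x i \<and> compose {..<n} (\<lambda>x. x \<in> A) x j) = \<sigma>)) \<partial>?\<Pi>)"
    using Eij by (intro Bochner_Integration.integral_cong refl prod.cong) (auto simp: compose_def)
  also have "\<dots> = (\<integral>b. (\<Prod>(i, j)\<in>E. of_bool ((b i \<and> b j) = \<sigma>)) \<partial>distr ?\<Pi> (\<Pi>\<^sub>M i\<in>{..<n}. ?K) (compose {..<n} (\<lambda>x. x \<in> A)))"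
  proof (rule integral_distr[symmetric])
    have m: "(\<lambda>x. x \<in> A) \<in> U \<rightarrow>\<^sub>M ?K" using predA by simp
    show "compose {..<n} (\<lambda>x. x \<in> A) \<in> ?\<Pi> \<rightarrow>\<^sub>M (\<Pi>\<^sub>M i\<in>{..<n}. ?K)"
      unfolding compose_def
      by (intro measurable_restrict measurable_compose[OF measurable_component_singleton[where M="\<lambda>_. U"] m])
    show "(\<lambda>b. \<Prod>(i, j)\<in>E. of_bool ((b i \<and> b j) = \<sigma>) :: real) \<in> borel_measurable (\<Pi>\<^sub>M i\<in>{..<n}. ?K)"
    proof (rule borel_measurable_prod)
      fix e assume "e \<in> E"
      then obtain i j where e: "e = (i, j)" "i < n" "j < n" using Eij by (cases e) auto
      have c: "(\<lambda>b. b l) \<in> (\<Pi>\<^sub>M i\<in>{..<n}. ?K) \<rightarrow>\<^sub>M count_space UNIV" if "l < n" for l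
        using measurable_component_singleton[of l "{..<n}" "\<lambda>_. ?K"] that by simp
      note [measurable] = c[OF e(2)] c[OF e(3)]
      show "(\<lambda>b. case e of (i, j) \<Rightarrow> (of_bool ((b i \<and> b j) = \<sigma>) :: real)) \<in> borel_measurable (\<Pi>\<^sub>M i\<in>{..<n}. ?K)"
        unfolding e prod.case by measurable
    qed
  qed
  also have "distr ?\<Pi> (\<Pi>\<^sub>M i\<in>{..<n}. ?K) (compose {..<n} (\<lambda>x. x \<in> A)) = (\<Pi>\<^sub>M i\<in>{..<n}. distr U ?K (\<lambda>x. x \<in> A))"
    by (rule distr_PiM_finite_prob_space') (use prob_space_U K predA in auto)
  also have "distr U ?K (\<lambda>x. x \<in> A) = ?K"
    by (rule distr_cong) auto
  finally show ?thesis .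
qed

text \<open>The law of a random bit is determined by the probability of \<open>True\<close>, so sets
  of equal measure lead to the same integral.\<close>

lemma graphon_equiv_two_block:
  assumes "kernel W" "\<And>x y. x \<in> {0..1} \<Longrightarrow> y \<in> {0..1} \<Longrightarrow> g x y = W x y"
    and A: "A \<in> sets borel" and B: "B \<in> sets borel" and eq: "measure uniform A = measure uniform B"
    and "AE z in uniform \<Otimes>\<^sub>M uniform. W (fst z) (snd z) = of_bool ((fst z \<in> A \<and> snd z \<in> A) = \<sigma>)"
    and h: "\<And>x y. h x y = of_bool ((x \<in> B \<and> y \<in> B) = \<sigma>)"
  shows "graphon_equiv g h"
proof -
  interpret U: prob_space U by (rule prob_space_U)
  let ?K = "\<lambda>A. distr U (count_space UNIV) (\<lambda>x. x \<in> A)"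
  have predA: "(\<lambda>x. x \<in> A) \<in> U \<rightarrow>\<^sub>M count_space UNIV" if [measurable]: "A \<in> sets borel" for A
    by (rule measurable_compose[OF ident_measurable_U]) measurable
  have meas: "emeasure (?K A) {True} = measure uniform A" if "A \<in> sets borel" for A
  proof -
    have "emeasure (?K A) {True} = emeasure U (A \<inter> {0..1})"
      using predA[OF that] by (subst emeasure_distr) (auto intro!: arg_cong2[where f=emeasure])
    also have "\<dots> = emeasure uniform A" unfolding uniform_def using that by (subst emeasure_distr) auto
    finally show ?thesis by (simp add: uniform.emeasure_eq_measure)
  qed
  have "?K A = ?K B"
  proof (rule measure_eqI_finite[where A=UNIV])
    fix b :: bool
    interpret KA: prob_space "?K A" by (rule U.prob_space_distr[OF predA[OF A]])
    interpret KB: prob_space "?K B" by (rule U.prob_space_distr[OF predA[OF B]])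
    have "measure (?K A) {True} = measure (?K B) {True}"
      using meas A B eq by (simp add: measure_def[of "?K A"] measure_def[of "?K B"])
    moreover have "{False} = space (?K A) - {True}" "{False} = space (?K B) - {True}" by auto
    then have "measure (?K A) {False} = 1 - measure (?K A) {True}" "measure (?K B) {False} = 1 - measure (?K B) {True}"
      using KA.prob_compl[of "{True}"] KB.prob_compl[of "{True}"] by simp_all
    ultimately show "emeasure (?K A) {b} = emeasure (?K B) {b}"
      unfolding KA.emeasure_eq_measure KB.emeasure_eq_measure by (cases b) simp_all
  qed auto
  moreover have kh: "kernel h"
  proof -
    have [measurable]: "B \<in> sets borel" by (rule B)
    have "(\<lambda>(x, y). h x y) \<in> borel_measurable (borel \<Otimes>\<^sub>M borel)" unfolding h by measurable
    then show ?thesis by (auto simp: kernel_def h)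
  qed
  moreover have "AE z in uniform \<Otimes>\<^sub>M uniform. h (fst z) (snd z) = of_bool ((fst z \<in> B \<and> snd z \<in> B) = \<sigma>)"
    by (simp add: h)
  ultimately show ?thesis unfolding graphon_equiv_def
    using hom_density_two_block[OF assms(1,2) A assms(6)] hom_density_two_block[OF kh refl B] by simp
qed

theorem theorem4p1:
  fixes k :: nat and \<epsilon> :: real and g :: "real \<Rightarrow> real \<Rightarrow> real"
  assumes "2 \<le> k" and "k \<le> 30"
    and "0 \<le> \<epsilon>" and "\<epsilon> \<le> 1"
    and "graphon g" and "edge_density g = \<epsilon>"
    and "\<forall>h. graphon h \<and> edge_density h = \<epsilon> \<longrightarrow> star_density k h \<le> star_density k g"
  shows "graphon_equiv g (g_clique (sqrt \<epsilon>)) \<or>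
         graphon_equiv g (g_anticlique (1 - sqrt (1 - \<epsilon>)))"
proof -
  obtain W where W: "kernel W" and g: "\<And>x y. x \<in> {0..1} \<Longrightarrow> y \<in> {0..1} \<Longrightarrow> g x y = W x y"
    by (rule graphon_kernel[OF assms(5)]) blast
  note [measurable] = uniform.kernelD(1)[OF W]
  note star = star_density_graphon[OF W g]
  have edge: "edge uniform W = \<epsilon>" using assms(6) star[of 1] by (simp add: edge_density_def)
  \<comment> \<open>Maximality among graphons extends to all distributions and kernels, since each
    pair has the star densities of some graphon.\<close>
  interpret star_maximizer uniform W k "k - 1"
  proof unfold_locales
    fix N V assume N: "real_distribution N" "kernel V" and eq: "edge N V = edge uniform W"
    obtain h where h: "graphon h" "\<And>j. star_density j h = star j N V"
      by (rule distribution_graphon[OF N]) blast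
    then have "edge_density h = \<epsilon>" using eq edge by (simp add: edge_density_def)
    then show "star k N V \<le> star k uniform W" using assms(7) h star[of k] by metis
  qed (use assms(1) W uniform_atomless in auto)
  have deg_block: "(\<integral>y. of_bool (x \<in> A \<and> y \<in> A) \<partial>uniform) = indicator A x * measure uniform A"
    if [measurable]: "A \<in> sets borel" for A and x :: real
  proof -
    have "(\<integral>y. of_bool (x \<in> A \<and> y \<in> A) \<partial>uniform) = (\<integral>y. indicator A x * (indicator A y :: real) \<partial>uniform)"
      by (intro Bochner_Integration.integral_cong) (auto simp: indicator_def)
    then show ?thesis by simp
  qed
  from clique_or_anticlique show ?thesis
  proof
    assume clique_form
    then obtain A where A[measurable]: "A \<in> sets borel"
      and AE: "AE z in uniform \<Otimes>\<^sub>M uniform. W (fst z) (snd z) = of_bool (fst z \<in> A \<and> snd z \<in> A)" by blast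
    have "AE x in uniform. deg uniform (\<lambda>x y. of_bool (x \<in> A \<and> y \<in> A)) x = deg uniform W x"
      by (rule deg_cong_AE) (use AE in \<open>simp, measurable\<close>)
    then have "AE x in uniform. deg uniform W x ^ 1 = indicator A x * measure uniform A"
      unfolding deg_def deg_block[OF A] by eventually_elim simp
    then have "edge uniform W = (\<integral>x. indicator A x * measure uniform A \<partial>uniform)"
      unfolding star_def by (intro integral_cong_AE) auto
    then have "\<epsilon> = (measure uniform A)\<^sup>2" using edge by (simp add: power2_eq_square)
    then have "sqrt \<epsilon> = measure uniform A" by simp
    moreover have "{..<sqrt \<epsilon>} \<inter> {0..1} = {0..<sqrt \<epsilon>}"
      using order_trans[OF less_imp_le, of _ "sqrt \<epsilon>" 1] assms(4) by auto
    then have "measure uniform {..<sqrt \<epsilon>} = sqrt \<epsilon>" using assms(3) by (simp add: measure_uniform)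
    ultimately have "graphon_equiv g (g_clique (sqrt \<epsilon>))"
      using AE by (intro graphon_equiv_two_block[OF W g A, of "{..<sqrt \<epsilon>}" True]) (auto simp: g_clique_def)
    then show ?thesis ..
  next
    assume anticlique_form
    then obtain A where A[measurable]: "A \<in> sets borel"
      and AE: "AE z in uniform \<Otimes>\<^sub>M uniform. W (fst z) (snd z) = of_bool (\<not> (fst z \<in> A \<and> snd z \<in> A))" by blast
    let ?c = "1 - sqrt (1 - \<epsilon>)"
    have c: "0 \<le> ?c" "?c \<le> 1" using assms(3,4) by auto
    have dV: "(\<integral>y. of_bool (\<not> (x \<in> A \<and> y \<in> A)) \<partial>uniform) = 1 - indicator A x * measure uniform A" for x
    proof -
      have "(\<integral>y. of_bool (\<not> (x \<in> A \<and> y \<in> A)) \<partial>uniform) = (\<integral>y. 1 - indicator A x * (indicator A y :: real) \<partial>uniform)"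
        by (intro Bochner_Integration.integral_cong) (auto simp: indicator_def)
      then show ?thesis by (simp add: uniform.emeasure_eq_measure)
    qed
    have "AE x in uniform. deg uniform (\<lambda>x y. of_bool (\<not> (x \<in> A \<and> y \<in> A))) x = deg uniform W x"
      by (rule deg_cong_AE) (use AE in \<open>simp, measurable\<close>)
    then have "AE x in uniform. deg uniform W x ^ 1 = 1 - indicator A x * measure uniform A"
      unfolding deg_def dV by eventually_elim simp
    then have "edge uniform W = (\<integral>x. 1 - indicator A x * measure uniform A \<partial>uniform)"
      unfolding star_def by (intro integral_cong_AE) auto
    then have "1 - \<epsilon> = (measure uniform A)\<^sup>2" using edge
      by (simp add: uniform.emeasure_eq_measure power2_eq_square)
    then have "sqrt (1 - \<epsilon>) = measure uniform A" by simp
    moreover have "{?c<..} \<inter> {0..1} = {?c<..1}" using c(1) by (auto simp del: diff_ge_0_iff_ge)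
    then have "measure uniform {?c<..} = sqrt (1 - \<epsilon>)" using assms(3,4) by (simp add: measure_uniform)
    ultimately have "graphon_equiv g (g_anticlique ?c)"
      using AE by (intro graphon_equiv_two_block[OF W g A, of "{?c<..}" False]) (auto simp: g_anticlique_def)
    then show ?thesis ..
  qed
qed

end
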